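(* The contained straight number $\mathtt{cstr}(K)$ is well defined for every knot $K$; that is, every knot $K$ has a diagram in straight position in which no arc crosses the extended straight strand.
   Context: Knots are classical knots in $S^3$. Given a knot diagram with $n$ crossings, choose a non-crossing starting point and a direction and traverse the knot, labeling the crossings $1,2,\ldots,n$ in the order in which they are first encountered; listing the labels of the crossings met in one full traversal gives a $2n$-tuple, a knot word of the diagram. The diagram is straight if, for some choice of starting point and direction, its knot word has the form $(1,2,\ldots,n,\sigma(1),\ldots,\sigma(n))$ with $\sigma\in S_n$. A straight diagram is in straight position if it is drawn in the plane (via planar isotopy) so that the first sub-arc, which passes through the crossings $1,\ldots,n$ in order, is a horizontal line segment, called the straight strand, traversed from left to right; all crossings of the diagram lie on it. The rest of the knot is a sub-arc without self-crossings running from the right end of the straight strand to its left end. The extended straight strand is the horizontal line containing the straight strand, with the straight strand itself removed. The contained straight number $\mathtt{cstr}(K)$ is the minimum $n$ such that $K$ has an $n$-crossing diagram in straight position in which no arc of the knot crosses the extended straight strand. *)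

theory Defs
  imports "HOL-Analysis.Analysis" "HOL-Combinatorics.Permutations"
begin

text \<open>The 3-sphere is the one-point compactification of Euclidean 3-space; points of
  \<^typ>\<open>real^3\<close> enter it through \<^const>\<open>Some\<close>, and \<^const>\<open>None\<close> is the point at infinity.\<close>

definition S3 :: "(real^3) option topology" where
  "S3 = Alexandroff_compactification euclidean"

definition ambient_isotopic :: "(real^3) option set \<Rightarrow> (real^3) option set \<Rightarrow> bool" where
  "ambient_isotopic K L \<longleftrightarrow>
    (\<exists>H :: real \<times> (real^3) option \<Rightarrow> (real^3) option.
       continuous_map (prod_topology (top_of_set {0..1}) S3) S3 H \<and>
       (\<forall>t\<in>{0..1}. homeomorphic_map S3 S3 (\<lambda>x. H (t, x))) \<and>
       (\<forall>x\<in>topspace S3. H (0, x) = x) \<and>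
       (\<lambda>x. H (1, x)) ` K = L)"

text \<open>The closed polygon with vertex list \<open>vs\<close>, parametrised periodically by the real line:
  vertex \<open>i\<close> is reached at time \<open>i\<close>, and one full traversal takes time \<open>length vs\<close>.\<close>

definition polygon_curve :: "'a::real_vector list \<Rightarrow> real \<Rightarrow> 'a" where
  "polygon_curve vs t =
    (let i = nat (\<lfloor>t\<rfloor> mod int (length vs))
     in (1 - frac t) *\<^sub>R (vs ! i) + frac t *\<^sub>R (vs ! (Suc i mod length vs)))"

definition polygonal_knot :: "(real^3) list \<Rightarrow> bool" where
  "polygonal_knot vs \<longleftrightarrow>
    3 \<le> length vs \<and> inj_on (polygon_curve vs) {0..<real (length vs)}"

definition knot_of :: "(real^3) list \<Rightarrow> (real^3) option set" where
  "knot_of vs = Some ` polygon_curve vs ` {0..<real (length vs)}"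

text \<open>Classical knots are tame.\<close>

definition knot :: "(real^3) option set \<Rightarrow> bool" where
  "knot K \<longleftrightarrow> (\<exists>vs. polygonal_knot vs \<and> ambient_isotopic K (knot_of vs))"

text \<open>A diagram is given by a polygonal knot in general position with respect to the
  vertical projection; at each crossing of the projected curve, the over-strand is the one with
  the larger third coordinate.\<close>

definition shadow :: "real^3 \<Rightarrow> real^2" where
  "shadow v = vector [v $ 1, v $ 2]"

definition diagram_curve :: "(real^3) list \<Rightarrow> real \<Rightarrow> real^2" where
  "diagram_curve vs t = shadow (polygon_curve vs t)"

text \<open>In the following, \<open>c\<close> is one full traversal, during \<open>{0..<N}\<close>, of a closed curve.\<close>

definition crossing_times :: "(real \<Rightarrow> real^2) \<Rightarrow> real \<Rightarrow> real set" where
  "crossing_times c N = {t \<in> {0..<N}. \<exists>u\<in>{0..<N}. u \<noteq> t \<and> c u = c t}"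

definition crossings :: "(real \<Rightarrow> real^2) \<Rightarrow> real \<Rightarrow> (real^2) set" where
  "crossings c N = c ` crossing_times c N"

text \<open>Finitely many crossings, all of them double points away from the vertices. Since two
  overlapping parallel edges, or an edge projecting to a point, would give infinitely many crossing
  times, the two edges meeting at a crossing intersect transversally.\<close>

definition knot_diagram :: "(real^3) list \<Rightarrow> bool" where
  "knot_diagram vs \<longleftrightarrow> polygonal_knot vs \<and>
    (let c = diagram_curve vs; N = real (length vs) in
      finite (crossing_times c N) \<and>
      (\<forall>t\<in>crossing_times c N. t \<notin> \<int> \<and> card {u \<in> {0..<N}. c u = c t} = 2))"

definition diagram_of :: "(real^3) option set \<Rightarrow> (real^3) list \<Rightarrow> bool" where
  "diagram_of K vs \<longleftrightarrow> knot_diagram vs \<and> ambient_isotopic K (knot_of vs)"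

definition crossing_count :: "(real^3) list \<Rightarrow> nat" where
  "crossing_count vs = card (crossings (diagram_curve vs) (real (length vs)))"

text \<open>The label of the crossing met at time \<open>t\<close> is the number of distinct crossings met up to
  the time at which this crossing is first encountered.\<close>

definition crossing_label :: "(real \<Rightarrow> real^2) \<Rightarrow> real \<Rightarrow> real \<Rightarrow> nat" where
  "crossing_label c N t =
    card (c ` {u \<in> crossing_times c N. u \<le> Min {w \<in> crossing_times c N. c w = c t}})"

definition knot_word :: "(real \<Rightarrow> real^2) \<Rightarrow> real \<Rightarrow> nat list" where
  "knot_word c N = map (crossing_label c N) (sorted_list_of_set (crossing_times c N))"

definition straight_word :: "nat \<Rightarrow> nat list \<Rightarrow> bool" where
  "straight_word n w \<longleftrightarrow> (\<exists>\<sigma>. \<sigma> permutes {1..n} \<and> w = [1..<Suc n] @ map \<sigma> [1..<Suc n])"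

text \<open>The traversal starting at parameter \<open>s\<close> in direction \<open>d\<close>, where \<open>d = 1\<close> or \<open>d = -1\<close>.\<close>

definition traversal :: "(real^3) list \<Rightarrow> real \<Rightarrow> real \<Rightarrow> real \<Rightarrow> real^2" where
  "traversal vs s d t = diagram_curve vs (s + d * t)"

definition straight_traversal :: "(real^3) list \<Rightarrow> real \<Rightarrow> real \<Rightarrow> bool" where
  "straight_traversal vs s d \<longleftrightarrow> d \<in> {1, -1} \<and>
    (let c = traversal vs s d; N = real (length vs) in
      0 \<notin> crossing_times c N \<and> straight_word (crossing_count vs) (knot_word c N))"

definition straight_diagram :: "(real^3) list \<Rightarrow> bool" where
  "straight_diagram vs \<longleftrightarrow> knot_diagram vs \<and> (\<exists>s d. straight_traversal vs s d)"

text \<open>The straight strand is the part of the traversal during \<open>{0..m}\<close>.\<close>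

definition straight_strand :: "(real^3) list \<Rightarrow> real \<Rightarrow> real \<Rightarrow> real \<Rightarrow> bool" where
  "straight_strand vs s d m \<longleftrightarrow> straight_traversal vs s d \<and>
    (let c = traversal vs s d; N = real (length vs) in
      0 < m \<and> m < N \<and>
      (\<forall>t\<in>{0..m}. c t $ 2 = c 0 $ 2) \<and>
      strict_mono_on {0..m} (\<lambda>t. c t $ 1) \<and>
      crossings c N \<subseteq> c ` {0..m} \<and>
      inj_on c {m..N})"

definition straight_position :: "(real^3) list \<Rightarrow> bool" where
  "straight_position vs \<longleftrightarrow> knot_diagram vs \<and> (\<exists>s d m. straight_strand vs s d m)"

definition extended_straight_strand :: "(real^3) list \<Rightarrow> real \<Rightarrow> real \<Rightarrow> real \<Rightarrow> (real^2) set" where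
  "extended_straight_strand vs s d m =
    {p. p $ 2 = traversal vs s d 0 $ 2} - traversal vs s d ` {0..m}"

text \<open>That no arc crosses the extended straight strand means that the diagram is disjoint from it;
  in particular, arcs touching it without passing to the other side are excluded as well.\<close>

definition contained_straight_position :: "(real^3) list \<Rightarrow> bool" where
  "contained_straight_position vs \<longleftrightarrow> knot_diagram vs \<and>
    (\<exists>s d m. straight_strand vs s d m \<and>
       range (diagram_curve vs) \<inter> extended_straight_strand vs s d m = {})"

definition contained_crossing_counts :: "(real^3) option set \<Rightarrow> nat set" where
  "contained_crossing_counts K =
    {crossing_count vs | vs. diagram_of K vs \<and> contained_straight_position vs}"

definition cstr :: "(real^3) option set \<Rightarrow> nat" where
  "cstr K = (LEAST n. n \<in> contained_crossing_counts K)"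

end

theory Submission
  imports Defs
begin

text \<open>
  Represent the knot by a closed polygon and regard the first coordinate as height over the
  plane of the other two. The first sub-arc is grown edge by edge, keeping its projection to this
  plane injective. After a generic perturbation of the vertices still to come, the crossings of
  the next edge with the sub-arc are removed by thin fingers: at the crossing nearest to the
  beginning of the sub-arc, the new edge is pushed back along the sub-arc beyond the last corner, which
  removes the crossing or moves it to the preceding edge of the sub-arc. In the end only the
  last edge crosses the sub-arc.

  Then change the viewpoint. The heights matter only at these crossings, so the sub-arc can be
  given the height \<open>t\<close> at time \<open>t \<in> [0, M]\<close>, and the last edge heights strictly between \<open>0\<close> and \<open>M\<close>, without
  changing the isotopy type. A shear along the second coordinate, depending only on the height,
  makes that coordinate vanish on the sub-arc. In the projection to the first two coordinates the
  sub-arc is now a straight segment, and the rest of the knot, on which the second coordinate was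
  monotone before the shear, has no self-crossings and stays strictly between the vertical lines
  through the ends of the segment.

  Small Lipschitz perturbations of a closed polygon are ambient isotopies, because they extend to
  all of space (McShane) and the sum of the identity and a contraction is a homeomorphism.
\<close>

section \<open>Ambient isotopies from small perturbations\<close>

text \<open>All isotopies have one source: a straight-line homotopy through embedded closed
  piecewise linear curves is ambient, because compactness cuts it into steps that are small against
  the bi-Lipschitz constant of the curve. So each move only has to be checked for injectivity. A
  finger has to respect only the sub-arc and the edge being added. The rest of the knot may cross
  both in projection, and the finger misses it in space by a generic tilt of its height. Taking the
  crossing nearest to the beginning keeps the finger off its own edge, and running past the
  beginning creates no crossing that has to be removed. The closing edge is the obstacle: clearing
  it too would give the whole knot a simple projection and make every knot trivial. The shear is
  harmless because it preserves the height on which it depends, so it keeps points of space apart.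
  Two points of the last edge with equal height are shifted equally, so a monotone second coordinate
  before the shear gives an injective projection after it.\<close>

lemma topspace_S3 [simp]: "topspace S3 = UNIV"
  by (auto simp: S3_def) (metis not_None_eq rangeI)

lemma Hausdorff_S3: "Hausdorff_space S3"
  unfolding S3_def Hausdorff_space_Alexandroff_compactification
  by (simp add: locally_compact_space_euclidean)

lemma compact_S3: "compact_space S3"
  by (simp add: S3_def)

lemma ambient_isotopic_trans:
  assumes "ambient_isotopic K L" "ambient_isotopic L M"
  shows "ambient_isotopic K M"
proof -
  let ?I = "top_of_set {0..1::real}"
  let ?P = "prod_topology ?I S3"
  obtain G where G: "continuous_map ?P S3 G"
    "\<And>t. t \<in> {0..1} \<Longrightarrow> homeomorphic_map S3 S3 (\<lambda>x. G (t, x))"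
    "\<And>x. G (0, x) = x" "(\<lambda>x. G (1, x)) ` K = L"
    using assms(1) unfolding ambient_isotopic_def by auto
  obtain H where H: "continuous_map ?P S3 H"
    "\<And>t. t \<in> {0..1} \<Longrightarrow> homeomorphic_map S3 S3 (\<lambda>x. H (t, x))"
    "\<And>x. H (0, x) = x" "(\<lambda>x. H (1, x)) ` L = M"
    using assms(2) unfolding ambient_isotopic_def by auto
  define J where "J = (\<lambda>z. if fst z \<le> 1/2 then G (2 * fst z, snd z)
                        else H (2 * fst z - 1, G (1, snd z)))"
  have fst: "continuous_map ?P euclideanreal fst"
    by (metis continuous_map_fst continuous_map_into_fulltopology)
  have "continuous_map ?P S3 J"
    unfolding J_def
  proof (rule continuous_map_cases_le [OF fst])
    show "continuous_map ?P euclideanreal (\<lambda>z. 1/2)" by simp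
    show "continuous_map (subtopology ?P {x \<in> topspace ?P. fst x \<le> 1/2}) S3
       (\<lambda>x. G (2 * fst x, snd x))"
    proof (rule continuous_map_compose [OF _ G(1), unfolded o_def])
      show "continuous_map (subtopology ?P {x \<in> topspace ?P. fst x \<le> 1/2}) ?P
          (\<lambda>x. (2 * fst x, snd x))"
        by (intro continuous_map_pairedI continuous_map_into_subtopology continuous_map_real_mult
            continuous_map_from_subtopology [OF fst] continuous_map_from_subtopology [OF continuous_map_snd])
          (auto simp: topspace_subtopology)
    qed
    show "continuous_map (subtopology ?P {x \<in> topspace ?P. 1/2 \<le> fst x}) S3
       (\<lambda>x. H (2 * fst x - 1, G (1, snd x)))"
    proof (rule continuous_map_compose [OF _ H(1), unfolded o_def])
      have "continuous_map (subtopology ?P {x \<in> topspace ?P. 1/2 \<le> fst x}) S3 (\<lambda>x. G (1, snd x))"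
        by (rule continuous_map_compose [OF _ G(1), unfolded o_def])
          (auto intro!: continuous_map_pairedI continuous_map_from_subtopology continuous_map_snd)
      then show "continuous_map (subtopology ?P {x \<in> topspace ?P. 1/2 \<le> fst x}) ?P
          (\<lambda>x. (2 * fst x - 1, G (1, snd x)))"
        by (intro continuous_map_pairedI continuous_map_into_subtopology continuous_map_diff
            continuous_map_real_mult continuous_map_from_subtopology [OF fst])
          (auto simp: topspace_subtopology)
    qed
    show "G (2 * fst x, snd x) = H (2 * fst x - 1, G (1, snd x))" if "fst x = 1/2" for x
      unfolding that by (simp add: G H)
  qed
  moreover have "homeomorphic_map S3 S3 (\<lambda>x. J (t, x))" if "t \<in> {0..1}" for t
  proof (cases "t \<le> 1/2")
    case True
    then show ?thesis using that G(2) [of "2*t"] by (simp add: J_def)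
  next
    case False
    then show ?thesis using that G(2) [of 1] H(2) [of "2*t-1"]
      by (auto simp: J_def dest: homeomorphic_map_compose [unfolded o_def])
  qed
  moreover have "(\<lambda>x. J (1, x)) ` K = M"
    using G(4) H(4) by (auto simp: J_def image_image)
  ultimately show ?thesis
    unfolding ambient_isotopic_def using G(3) by (intro exI [of _ J]) (auto simp: J_def)
qed

text \<open>\<open>F\<close> shrinks distances, so it cannot cancel \<open>x - y\<close>; and a
  preimage of \<open>y\<close> is a fixed point of the contraction sending \<open>x\<close> to
  \<open>y - F x\<close>.\<close>

lemma bij_id_plus_contraction:
  fixes F :: "'a::banach \<Rightarrow> 'a"
  assumes F: "\<And>x y. norm (F x - F y) \<le> c * norm (x - y)" and c: "0 \<le> c" "c < 1"
  shows "bij (\<lambda>x. x + F x)"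
proof (rule bijI)
  show "inj (\<lambda>x. x + F x)"
  proof (rule injI)
    fix x y assume "x + F x = y + F y"
    then have "x - y = F y - F x" by (simp add: algebra_simps)
    with F [of y x] have "norm (x - y) \<le> c * norm (x - y)" by (simp add: norm_minus_commute)
    then have "(1 - c) * norm (x - y) \<le> 0" by (simp add: algebra_simps)
    then show "x = y" using c by (simp add: mult_le_0_iff)
  qed
  show "surj (\<lambda>x. x + F x)"
  proof -
    have "\<exists>x. x + F x = y" for y
    proof -
    have "\<exists>!x. y - F x = x"
      by (rule banach_fix_type [OF c]) (use F in \<open>auto simp: dist_norm norm_minus_commute\<close>)
    then show ?thesis by (metis diff_add_cancel)
    qed
    then show ?thesis by (metis surjI)
  qed
qed

text \<open>The isotopy is \<open>x + t F x\<close> with \<open>None\<close> fixed. Since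
  \<open>F\<close> grows at most half as fast as its argument, these maps are proper uniformly in
  \<open>t\<close>, which gives continuity at infinity; each of them is a continuous bijection of a
  compact Hausdorff space.\<close>

lemma ambient_isotopic_id_plus_contraction:
  fixes F :: "real^3 \<Rightarrow> real^3"
  assumes F: "\<And>x y. norm (F x - F y) \<le> norm (x - y) / 2"
  shows "ambient_isotopic (Some ` A) (Some ` (\<lambda>x. x + F x) ` A)"
proof -
  let ?I = "top_of_set {0..1::real}"
  let ?P = "prod_topology ?I S3"
  let ?Q = "prod_topology ?I (euclidean :: (real^3) topology)"
  define h where "h = (\<lambda>z::real \<times> (real^3). snd z + fst z *\<^sub>R F (snd z))"
  define H where "H = (\<lambda>z::real \<times> (real^3) option. map_option (\<lambda>x. h (fst z, x)) (snd z))"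
  have contF: "continuous_on UNIV F"
    unfolding continuous_on_iff
  proof (intro ballI allI impI)
    fix x and e :: real assume "0 < e"
    have "dist (F x') (F x) < e" if "dist x' x < e" for x'
      using F [of x' x] that norm_ge_zero [of "F x' - F x"] unfolding dist_norm by linarith
    then show "\<exists>d>0. \<forall>x'\<in>UNIV. dist x' x < d \<longrightarrow> dist (F x') (F x) < e"
      using \<open>0 < e\<close> by blast
  qed
  have conth: "continuous_on UNIV h"
    unfolding h_def by (intro continuous_intros continuous_on_compose2 [OF contF]) auto
  have Q: "?Q = top_of_set ({0..1} \<times> UNIV)"
    by (simp add: prod_topology_subtopology(1) euclidean_product_topology)
  have Some: "continuous_map ?Q ?P (map_prod id Some)"
  proof -
    have "continuous_map ?Q S3 (\<lambda>x. Some (snd x))"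
      unfolding S3_def
      by (rule continuous_map_compose [OF continuous_map_snd continuous_map_Some, unfolded o_def])
    then show ?thesis
      unfolding map_prod_def case_prod_unfold id_apply
      by (intro continuous_map_pairedI continuous_map_fst)
  qed
  \<comment> \<open>The finite points form an open part of \<open>S3\<close>, so preimages
    consisting of finite points can be computed in \<open>?Q\<close>.\<close>
  have open_Some: "openin ?P (map_prod id Some ` W)" if W: "openin ?Q W" for W
    unfolding openin_prod_topology_alt
  proof (intro allI impI)
    fix t z assume "(t, z) \<in> map_prod id Some ` W"
    then obtain y where y: "(t, y) \<in> W" "z = Some y" by auto
    obtain U V where UV: "openin ?I U" "open V" "t \<in> U" "y \<in> V" "U \<times> V \<subseteq> W"
      using W [unfolded openin_prod_topology_alt, rule_format, OF y(1)] by auto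
    have "openin S3 (Some ` V)" using \<open>open V\<close> by (simp add: S3_def)
    moreover have "U \<times> Some ` V \<subseteq> map_prod id Some ` W"
    proof clarify
      fix a b assume "a \<in> U" "b \<in> V"
      then have "(a, b) \<in> W" using UV(5) by auto
      then show "(a, Some b) \<in> map_prod id Some ` W" by (metis id_apply image_eqI map_prod_simp)
    qed
    ultimately show "\<exists>U V. openin ?I U \<and> openin S3 V \<and> t \<in> U \<and> z \<in> V \<and> U \<times> V \<subseteq> map_prod id Some ` W"
      using y UV by (intro exI[of _ U] exI[of _ "Some ` V"]) auto
  qed
  have HausP: "Hausdorff_space ?P"
    by (simp add: Hausdorff_space_prod_topology Hausdorff_S3 Hausdorff_space_subtopology)
  have contH: "continuous_map ?P S3 H"
    unfolding continuous_map_def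
  proof (intro conjI allI impI)
    show "H \<in> topspace ?P \<rightarrow> topspace S3" by auto
    fix U assume "openin S3 U"
    then consider V where "open V" "U = Some ` V"
      | C where "compact C" "U = insert None (Some ` (UNIV - C))"
      unfolding S3_def openin_Alexandroff_compactification by auto
    then show "openin ?P {z \<in> topspace ?P. H z \<in> U}"
    proof cases
      case 1
      have "openin ?Q {z \<in> topspace ?Q. h z \<in> V}"
      proof -
        have "open (h -` V)" using conth 1(1) by (simp add: open_vimage)
        moreover have eq: "{z \<in> topspace ?Q. h z \<in> V} = ({0..1} \<times> UNIV) \<inter> h -` V" by auto
        ultimately show ?thesis unfolding eq unfolding Q by (intro openin_open_Int)
      qed
      then have "openin ?P (map_prod id Some ` {z \<in> topspace ?Q. h z \<in> V})"
        by (rule open_Some)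
      moreover have "map_prod id Some ` {z \<in> topspace ?Q. h z \<in> V} = {z \<in> topspace ?P. H z \<in> U}"
      proof (intro set_eqI iffI)
        fix z assume "z \<in> {z \<in> topspace ?P. H z \<in> U}"
        then have "fst z \<in> {0..1}" "H z \<in> Some ` V" by (auto simp: 1(2))
        then obtain x where "snd z = Some x" "h (fst z, x) \<in> V" "fst z \<in> {0..1}"
          by (auto simp: H_def)
        then have "(fst z, x) \<in> {z \<in> topspace ?Q. h z \<in> V}" "z = map_prod id Some (fst z, x)"
          by (auto simp: prod_eq_iff)
        then show "z \<in> map_prod id Some ` {z \<in> topspace ?Q. h z \<in> V}" by blast
      qed (auto simp: 1(2) H_def)
      ultimately show ?thesis by simp
    next
      case 2
      \<comment> \<open>A neighbourhood of infinity is the complement of a compact \<open>C\<close>.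
        Its preimage is open once the preimage \<open>D\<close> of \<open>C\<close> is compact in
        the finite part, since compact sets are closed in the Hausdorff space
        \<open>?P\<close>.\<close>
      define D where "D = {z \<in> {0..1} \<times> UNIV. h z \<in> C}"
      have "closed D"
      proof -
        have "D = ({0..1} \<times> UNIV) \<inter> h -` C" by (auto simp: D_def)
        moreover have "closed (h -` C)"
          using conth 2(1) by (simp add: closed_vimage compact_imp_closed)
        ultimately show ?thesis
          by (simp add: closed_Int closed_Times)
      qed
      moreover have "bounded D"
      proof -
        obtain B where B: "\<And>x. x \<in> C \<Longrightarrow> norm x \<le> B"
          using compact_imp_bounded [OF 2(1)] by (auto simp: bounded_iff)
        \<comment> \<open>The radius comes from solving
          \<open>norm x \<le> B + norm (F 0) + norm x / 2\<close>.\<close>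
        have "D \<subseteq> {0..1} \<times> cball 0 (2 * B + 2 * norm (F 0))"
        proof clarify
          fix t x assume "(t, x) \<in> D"
          then have t: "0 \<le> t" "t \<le> 1" and "h (t, x) \<in> C" by (auto simp: D_def)
          then have "norm (x + t *\<^sub>R F x) \<le> B" using B by (auto simp: h_def)
          moreover have "norm x \<le> norm (x + t *\<^sub>R F x) + norm (t *\<^sub>R F x)"
            by (metis add_diff_cancel norm_triangle_ineq4)
          moreover have "norm (t *\<^sub>R F x) \<le> norm (F x)" using t by (simp add: mult_left_le_one_le)
          moreover have "norm (F x) \<le> norm (F 0) + norm x / 2"
            using F [of x 0] norm_triangle_sub [of "F x" "F 0"] by simp
          ultimately have "norm x \<le> 2 * B + 2 * norm (F 0)" by simp
          then show "t \<in> {0..1} \<and> x \<in> cball 0 (2 * B + 2 * norm (F 0))" using t by simp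
        qed
        then show ?thesis
          by (rule bounded_subset [rotated]) (simp add: bounded_Times)
      qed
      ultimately have "compactin ?Q D"
        unfolding Q by (simp add: compactin_subtopology compact_eq_bounded_closed D_def subset_eq)
      then have "closedin ?P (map_prod id Some ` D)"
        using image_compactin [OF _ Some] compactin_imp_closedin [OF HausP] by blast
      then have "openin ?P (topspace ?P - map_prod id Some ` D)" by blast
      moreover have "topspace ?P - map_prod id Some ` D = {z \<in> topspace ?P. H z \<in> U}"
      proof (intro set_eqI iffI)
        fix z assume z: "z \<in> topspace ?P - map_prod id Some ` D"
        obtain t y where [simp]: "z = (t, y)" by fastforce
        show "z \<in> {z \<in> topspace ?P. H z \<in> U}"
        proof (cases y)
          case None
          then show ?thesis using z by (simp add: 2(2) H_def)
        next
          case (Some x)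
          then have "(t, x) \<notin> D" using z by force
          then show ?thesis using Some z by (simp add: 2(2) H_def D_def)
        qed
      next
        fix z assume z: "z \<in> {z \<in> topspace ?P. H z \<in> U}"
        then show "z \<in> topspace ?P - map_prod id Some ` D"
          by (auto simp: 2(2) H_def D_def)
      qed
      ultimately show ?thesis by simp
    qed
  qed
  have homH: "homeomorphic_map S3 S3 (\<lambda>x. H (t, x))" if t: "t \<in> {0..1}" for t
  proof (rule continuous_imp_homeomorphic_map [OF _ compact_S3 Hausdorff_S3])
    show "continuous_map S3 S3 (\<lambda>x. H (t, x))"
      by (rule continuous_map_compose [OF _ contH, unfolded o_def])
        (use t in \<open>auto intro!: continuous_map_pairedI\<close>)
    have "bij (\<lambda>x. x + t *\<^sub>R F x)"
    proof (rule bij_id_plus_contraction [of _ "1/2"])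
      fix x y
      have "norm (t *\<^sub>R F x - t *\<^sub>R F y) = t * norm (F x - F y)"
        using t by (simp flip: scaleR_diff_right)
      also have "\<dots> \<le> 1 * norm (F x - F y)" using t by (intro mult_right_mono) auto
      finally show "norm (t *\<^sub>R F x - t *\<^sub>R F y) \<le> 1/2 * norm (x - y)" using F [of x y] by simp
    qed auto
    then have b: "bij (\<lambda>x. h (t, x))" by (simp add: h_def)
    show "inj_on (\<lambda>x. H (t, x)) (topspace S3)"
      using b by (auto simp: H_def bij_def intro!: option.inj_map)
    show "(\<lambda>x. H (t, x)) ` topspace S3 = topspace S3"
    proof -
      have "\<exists>x. y = H (t, x)" for y
      proof (cases y)
        case None then show ?thesis by (intro exI [of _ None]) (simp add: H_def)
      next
        case (Some w)
        obtain x where "w = h (t, x)" using b by (metis bij_pointE)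
        then show ?thesis using Some by (intro exI [of _ "Some x"]) (simp add: H_def)
      qed
      then show ?thesis by (auto simp: image_iff)
    qed
  qed
  show ?thesis
    unfolding ambient_isotopic_def
    by (intro exI [of _ H] conjI contH ballI homH)
      (auto simp: H_def h_def option.map_ident image_image)
qed

section \<open>Lipschitz extension from the curve to space\<close>

lemma Lipschitz_extension_real:
  fixes f :: "'a::real_normed_vector \<Rightarrow> real"
  assumes f: "\<And>x y. x \<in> K \<Longrightarrow> y \<in> K \<Longrightarrow> \<bar>f x - f y\<bar> \<le> e * norm (x - y)" and e: "0 \<le> e"
  obtains g where "\<And>x. x \<in> K \<Longrightarrow> g x = f x" "\<And>x y. \<bar>g x - g y\<bar> \<le> e * norm (x - y)"
proof (cases "K = {}")
  case True
  then show ?thesis using e by (intro that [of "\<lambda>_. 0"]) auto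
next
  case False
  \<comment> \<open>McShane's formula, the largest extension with Lipschitz constant
    \<open>e\<close>. The bound \<open>low\<close> below makes the infimum finite.\<close>
  define g where "g = (\<lambda>x. INF k\<in>K. f k + e * norm (x - k))"
  have low: "f k0 - e * norm (x - k0) \<le> f k + e * norm (x - k)" if "k \<in> K" "k0 \<in> K" for x k k0
  proof -
    have "f k0 - f k \<le> e * norm (k0 - k)" using f [OF that(2,1)] by simp
    also have "\<dots> \<le> e * (norm (x - k) + norm (x - k0))"
      using e norm_triangle_ineq4 [of "x - k" "x - k0"] by (intro mult_left_mono) (auto simp: algebra_simps)
    finally show ?thesis by (simp add: algebra_simps)
  qed
  have bdd: "bdd_below ((\<lambda>k. f k + e * norm (x - k)) ` K)" for x
    using low False by (metis (mono_tags, lifting) bdd_belowI2 ex_in_conv)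
  have gle: "g x \<le> f k + e * norm (x - k)" if "k \<in> K" for x k
    unfolding g_def by (rule cINF_lower [OF bdd that])
  have one: "g x - g y \<le> e * norm (x - y)" for x y
  proof -
    have "g x - e * norm (x - y) \<le> g y"
      unfolding g_def
    proof (rule cINF_greatest [OF False])
      fix k assume k: "k \<in> K"
      have "g x \<le> f k + e * norm (x - k)" using gle k .
      moreover have "e * norm (x - k) \<le> e * (norm (x - y) + norm (y - k))"
        using e norm_triangle_ineq [of "x - y" "y - k"] by (intro mult_left_mono) auto
      ultimately show "(INF k\<in>K. f k + e * norm (x - k)) - e * norm (x - y) \<le> f k + e * norm (y - k)"
        by (simp add: g_def algebra_simps)
    qed
    then show ?thesis by simp
  qed
  show ?thesis
  proof
    show "g x = f x" if "x \<in> K" for x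
    proof (rule antisym)
      show "g x \<le> f x" using gle [OF that, of x] by simp
      show "f x \<le> g x"
        unfolding g_def using low [OF _ that, of _ x] by (intro cINF_greatest [OF False]) auto
    qed
    show "\<bar>g x - g y\<bar> \<le> e * norm (x - y)" for x y
      using one [of x y] one [of y x] by (simp add: norm_minus_commute)
  qed
qed

text \<open>Each coordinate is extended separately; the factor 3 is the price of estimating the norm
  by the sum of the three absolute coordinates.\<close>

lemma Lipschitz_extension_vec3:
  fixes f :: "real^3 \<Rightarrow> real^3"
  assumes f: "\<And>x y. x \<in> K \<Longrightarrow> y \<in> K \<Longrightarrow> norm (f x - f y) \<le> e * norm (x - y)" and e: "0 \<le> e"
  obtains g where "\<And>x. x \<in> K \<Longrightarrow> g x = f x" "\<And>x y. norm (g x - g y) \<le> 3 * e * norm (x - y)"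
proof -
  have "\<exists>g. (\<forall>x\<in>K. g x = f x $ i) \<and> (\<forall>x y. \<bar>g x - g y\<bar> \<le> e * norm (x - y))" for i
  proof -
    have "\<bar>f x $ i - f y $ i\<bar> \<le> e * norm (x - y)" if "x \<in> K" "y \<in> K" for x y
      using f [OF that] component_le_norm_cart [of "f x - f y" i] by simp
    from Lipschitz_extension_real [OF this e] show ?thesis by metis
  qed
  then obtain g where g: "\<And>i x. x \<in> K \<Longrightarrow> g i x = f x $ i"
     "\<And>i x y. \<bar>g i x - g i y\<bar> \<le> e * norm (x - y)" by metis
  show ?thesis
  proof
    show "(\<chi> i. g i x) = f x" if "x \<in> K" for x using g(1) [OF that] by (simp add: vec_eq_iff)
    show "norm ((\<chi> i. g i x) - (\<chi> i. g i y)) \<le> 3 * e * norm (x - y)" for x y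
    proof -
      have "norm ((\<chi> i. g i x) - (\<chi> i. g i y)) \<le> (\<Sum>i\<in>UNIV. \<bar>g i x - g i y\<bar>)"
        using norm_le_l1_cart [of "(\<chi> i. g i x) - (\<chi> i. g i y)"] by simp
      also have "\<dots> \<le> (\<Sum>i\<in>(UNIV::3 set). e * norm (x - y))" using g(2) by (intro sum_mono) auto
      finally show ?thesis by simp
    qed
  qed
qed

text \<open>The displacement is a function of the point \<open>c s\<close>, as equal points force
  equal displacements. The 6 is the 3 of the coordinatewise extension times the 2 of the contraction
  constant 1/2.\<close>

lemma ambient_isotopic_perturbation:
  fixes c d :: "real \<Rightarrow> real^3"
  assumes cd: "\<And>s t. s \<in> S \<Longrightarrow> t \<in> S \<Longrightarrow> norm (d s - d t) \<le> norm (c s - c t) / 6"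
  shows "ambient_isotopic (Some ` c ` S) (Some ` (\<lambda>t. c t + d t) ` S)"
proof -
  define f where "f = (\<lambda>x. d (SOME s. s \<in> S \<and> c s = x))"
  have f: "f (c s) = d s" if "s \<in> S" for s
  proof -
    define t where "t = (SOME t. t \<in> S \<and> c t = c s)"
    have "t \<in> S \<and> c t = c s" unfolding t_def by (rule someI [of _ s]) (use that in auto)
    then have "d t = d s" using cd [of t s] that by auto
    then show ?thesis unfolding f_def t_def .
  qed
  have "norm (f x - f y) \<le> (1/6) * norm (x - y)" if "x \<in> c ` S" "y \<in> c ` S" for x y
    using that cd by (auto simp: f)
  then obtain g where g: "\<And>x. x \<in> c ` S \<Longrightarrow> g x = f x" "\<And>x y. norm (g x - g y) \<le> 3 * (1/6) * norm (x - y)"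
    by (rule Lipschitz_extension_vec3) auto
  have "ambient_isotopic (Some ` c ` S) (Some ` (\<lambda>x. x + g x) ` c ` S)"
    using g(2) by (intro ambient_isotopic_id_plus_contraction) auto
  moreover have "(\<lambda>x. x + g x) ` c ` S = (\<lambda>t. c t + d t) ` S"
    using g(1) f by (force simp: image_image)
  ultimately show ?thesis by simp
qed

section \<open>Piecewise linear curves\<close>

definition right_vel :: "(real \<Rightarrow> 'a::real_normed_vector) \<Rightarrow> real \<Rightarrow> 'a \<Rightarrow> bool" where
  "right_vel c t v \<longleftrightarrow> (\<exists>r>0. \<forall>x\<in>{0..r}. c (t + x) = c t + x *\<^sub>R v)"

text \<open>The velocity points in the direction of travel, so at a time without a corner both
  one-sided velocities agree.\<close>

definition left_vel :: "(real \<Rightarrow> 'a::real_normed_vector) \<Rightarrow> real \<Rightarrow> 'a \<Rightarrow> bool" where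
  "left_vel c t v \<longleftrightarrow> (\<exists>r>0. \<forall>x\<in>{0..r}. c (t - x) = c t - x *\<^sub>R v)"

text \<open>Encoded by one-sided germs instead of a subdivision: sums, linear images and
  compositions are then checked time by time, without common refinements. A finite subdivision is
  recovered by compactness in \<open>pl_breakpoints\<close>.\<close>

definition pl :: "real \<Rightarrow> real \<Rightarrow> (real \<Rightarrow> 'a::real_normed_vector) \<Rightarrow> bool" where
  "pl a b c \<longleftrightarrow> (\<forall>t\<in>{a..<b}. \<exists>v. right_vel c t v) \<and> (\<forall>t\<in>{a<..b}. \<exists>v. left_vel c t v)"

definition lin :: "real \<Rightarrow> real \<Rightarrow> (real \<Rightarrow> 'a::real_normed_vector) \<Rightarrow> bool" where
  "lin a b c \<longleftrightarrow> (\<exists>p v. \<forall>t\<in>{a..b}. c t = p + t *\<^sub>R v)"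

lemma left_vel_iff_right_vel: "left_vel c t v \<longleftrightarrow> right_vel (\<lambda>x. c (- x)) (- t) (- v)"
  by (simp add: left_vel_def right_vel_def)

lemma right_velE:
  assumes "right_vel c t v" "0 < e"
  obtains r where "0 < r" "r \<le> e" "\<And>x. 0 \<le> x \<Longrightarrow> x \<le> r \<Longrightarrow> c (t + x) = c t + x *\<^sub>R v"
proof -
  obtain r where "r > 0" "\<forall>x\<in>{0..r}. c (t + x) = c t + x *\<^sub>R v"
    using assms(1) by (auto simp: right_vel_def)
  then show ?thesis using assms(2) by (intro that [of "min r e"]) auto
qed

lemma left_velE:
  assumes "left_vel c t v" "0 < e"
  obtains r where "0 < r" "r \<le> e" "\<And>x. 0 \<le> x \<Longrightarrow> x \<le> r \<Longrightarrow> c (t - x) = c t - x *\<^sub>R v"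
proof -
  obtain r where "r > 0" "\<forall>x\<in>{0..r}. c (t - x) = c t - x *\<^sub>R v"
    using assms(1) by (auto simp: left_vel_def)
  then show ?thesis using assms(2) by (intro that [of "min r e"]) auto
qed

lemma right_vel_cong:
  assumes "right_vel c t v" "t < b" "\<And>x. t \<le> x \<Longrightarrow> x \<le> b \<Longrightarrow> d x = c x"
  shows "right_vel d t v"
proof -
  obtain r where "0 < r" "r \<le> b - t" "\<And>x. 0 \<le> x \<Longrightarrow> x \<le> r \<Longrightarrow> c (t + x) = c t + x *\<^sub>R v"
    using right_velE [OF assms(1), of "b - t"] assms(2) by auto
  then show ?thesis unfolding right_vel_def using assms(2,3) by (intro exI [of _ r]) auto
qed

lemma left_vel_cong:
  assumes "left_vel c t v" "a < t" "\<And>x. a \<le> x \<Longrightarrow> x \<le> t \<Longrightarrow> d x = c x"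
  shows "left_vel d t v"
proof -
  obtain r where "0 < r" "r \<le> t - a" "\<And>x. 0 \<le> x \<Longrightarrow> x \<le> r \<Longrightarrow> c (t - x) = c t - x *\<^sub>R v"
    using left_velE [OF assms(1), of "t - a"] assms(2) by auto
  then show ?thesis unfolding left_vel_def using assms(2,3) by (intro exI [of _ r]) auto
qed

lemma right_vel_unique: assumes "right_vel c t v" "right_vel c t w" shows "v = w"
proof -
  obtain r where r: "0 < r" "\<And>x. 0 \<le> x \<Longrightarrow> x \<le> r \<Longrightarrow> c (t + x) = c t + x *\<^sub>R v"
    using right_velE [OF assms(1) zero_less_one] by auto
  obtain q where q: "0 < q" "q \<le> r" "\<And>x. 0 \<le> x \<Longrightarrow> x \<le> q \<Longrightarrow> c (t + x) = c t + x *\<^sub>R w"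
    using right_velE [OF assms(2) r(1)] by auto
  show ?thesis using q(1,2) r(2) [of q] q(3) [of q] by simp
qed

lemma right_vel_const: "right_vel (\<lambda>_. k) t 0" and left_vel_const: "left_vel (\<lambda>_. k) t 0"
  by (auto simp: right_vel_def left_vel_def intro: exI [of _ 1])

lemma right_vel_add:
  assumes "right_vel c t v" "right_vel d t w" shows "right_vel (\<lambda>x. c x + d x) t (v + w)"
proof -
  obtain r where r: "0 < r" "\<And>x. 0 \<le> x \<Longrightarrow> x \<le> r \<Longrightarrow> c (t + x) = c t + x *\<^sub>R v"
    using right_velE [OF assms(1) zero_less_one] by auto
  obtain q where q: "0 < q" "q \<le> r" "\<And>x. 0 \<le> x \<Longrightarrow> x \<le> q \<Longrightarrow> d (t + x) = d t + x *\<^sub>R w"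
    using right_velE [OF assms(2) r(1)] by auto
  show ?thesis unfolding right_vel_def using r q by (intro exI [of _ q]) (auto simp: algebra_simps)
qed

lemma left_vel_add: "left_vel c t v \<Longrightarrow> left_vel d t w \<Longrightarrow> left_vel (\<lambda>x. c x + d x) t (v + w)"
  unfolding left_vel_iff_right_vel by (drule (1) right_vel_add) simp

lemma right_vel_linear:
  assumes "linear f" "right_vel c t v" shows "right_vel (\<lambda>x. f (c x)) t (f v)"
  using assms by (fastforce simp: right_vel_def linear_add linear_scale)

lemma left_vel_linear:
  assumes "linear f" "left_vel c t v" shows "left_vel (\<lambda>x. f (c x)) t (f v)"
  using right_vel_linear [OF assms(1), of "\<lambda>x. c (- x)" "- t" "- v"] assms
  unfolding left_vel_iff_right_vel by (simp add: linear_neg)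

lemma pl_right_velE:
  assumes "pl a b c" "a \<le> t" "t < b" obtains v where "right_vel c t v"
  using assms unfolding pl_def by (meson atLeastLessThan_iff)

lemma pl_left_velE:
  assumes "pl a b c" "a < t" "t \<le> b" obtains v where "left_vel c t v"
  using assms unfolding pl_def by (meson greaterThanAtMost_iff)

lemma pl_cong:
  assumes "pl a b c" "\<And>t. a \<le> t \<Longrightarrow> t \<le> b \<Longrightarrow> d t = c t" shows "pl a b d"
  unfolding pl_def
proof (intro conjI ballI)
  fix t assume t: "t \<in> {a..<b}"
  then obtain v where "right_vel c t v" using assms(1) by (auto elim: pl_right_velE)
  then have "right_vel d t v" by (rule right_vel_cong [where b = b]) (use t assms(2) in auto)
  then show "\<exists>v. right_vel d t v" by blast
next
  fix t assume t: "t \<in> {a<..b}"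
  then obtain v where "left_vel c t v" using assms(1) by (auto elim: pl_left_velE)
  then have "left_vel d t v" by (rule left_vel_cong [where a = a]) (use t assms(2) in auto)
  then show "\<exists>v. left_vel d t v" by blast
qed

lemma pl_subset: "pl a b c \<Longrightarrow> a \<le> a' \<Longrightarrow> b' \<le> b \<Longrightarrow> pl a' b' c"
  by (force simp: pl_def)

lemma pl_trans: assumes "pl a b c" "pl b d c" shows "pl a d c"
  unfolding pl_def
proof (intro conjI ballI)
  fix t assume "t \<in> {a..<d}"
  then show "\<exists>v. right_vel c t v" using assms by (cases "t < b") (auto simp: pl_def)
next
  fix t assume "t \<in> {a<..d}"
  then show "\<exists>v. left_vel c t v" using assms by (cases "t \<le> b") (auto simp: pl_def)
qed

lemma pl_add: "pl a b c \<Longrightarrow> pl a b d \<Longrightarrow> pl a b (\<lambda>x. c x + d x)"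
  unfolding pl_def by (fast intro: right_vel_add left_vel_add)

lemma pl_linear: "linear f \<Longrightarrow> pl a b c \<Longrightarrow> pl a b (\<lambda>x. f (c x))"
  unfolding pl_def by (fast intro: right_vel_linear left_vel_linear)

lemma pl_const: "pl a b (\<lambda>_. k)"
  unfolding pl_def using right_vel_const left_vel_const by blast

lemma pl_ident: "pl a b (\<lambda>t. t)"
  unfolding pl_def right_vel_def left_vel_def by (auto intro!: exI [of _ 1])

lemma pl_scaleR_left: "pl a b h \<Longrightarrow> pl a b (\<lambda>x. h x *\<^sub>R v)"
  by (rule pl_linear [where f = "\<lambda>x. x *\<^sub>R v"]) (auto simp: linear_iff algebra_simps)

lemma pl_uminus: "pl a b c \<Longrightarrow> pl a b (\<lambda>x. - c x)"
  by (rule pl_linear [where f = uminus]) (auto simp: linear_iff)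

lemma pl_diff: 
  assumes "pl a b c" "pl a b d" shows "pl a b (\<lambda>x. c x - d x)"
  using pl_add [OF assms(1) pl_uminus [OF assms(2)]] by simp

lemma lin_subset: "lin a b c \<Longrightarrow> a \<le> a' \<Longrightarrow> b' \<le> b \<Longrightarrow> lin a' b' c"
  unfolding lin_def by (meson atLeastatMost_subset_iff subsetD)

lemma lin_cong: "lin a b c \<Longrightarrow> (\<And>t. a \<le> t \<Longrightarrow> t \<le> b \<Longrightarrow> d t = c t) \<Longrightarrow> lin a b d"
  by (simp add: lin_def)

lemma lin_refl: "lin a a c"
  unfolding lin_def by (rule exI [of _ "c a"], rule exI [of _ 0]) simp

lemma lin_add:
  assumes "lin a b c" "lin a b d" shows "lin a b (\<lambda>x. c x + d x)"
proof -
  obtain p v q w where "\<forall>t\<in>{a..b}. c t = p + t *\<^sub>R v" "\<forall>t\<in>{a..b}. d t = q + t *\<^sub>R w"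
    using assms by (auto simp: lin_def)
  then show ?thesis unfolding lin_def
    by (intro exI [of _ "p + q"] exI [of _ "v + w"]) (auto simp: algebra_simps)
qed

lemma lin_linear:
  assumes "linear f" "lin a b c" shows "lin a b (\<lambda>x. f (c x))"
proof -
  obtain p v where "\<forall>t\<in>{a..b}. c t = p + t *\<^sub>R v" using assms by (auto simp: lin_def)
  then show ?thesis unfolding lin_def using assms(1)
    by (intro exI [of _ "f p"] exI [of _ "f v"]) (auto simp: linear_add linear_scale)
qed

lemma linE:
  assumes "lin a b c" "a \<le> b"
  obtains v where "\<And>t. a \<le> t \<Longrightarrow> t \<le> b \<Longrightarrow> c t = c a + (t - a) *\<^sub>R v"
    "\<And>t. a \<le> t \<Longrightarrow> t \<le> b \<Longrightarrow> c t = c b - (b - t) *\<^sub>R v" "c b - c a = (b - a) *\<^sub>R v"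
proof -
  obtain p v where v: "\<And>t. a \<le> t \<Longrightarrow> t \<le> b \<Longrightarrow> c t = p + t *\<^sub>R v"
    using assms by (auto simp: lin_def)
  show ?thesis using v assms(2) by (intro that [of v]) (auto simp: algebra_simps)
qed

lemma lin_right_vel: 
  assumes "lin a b c" "a \<le> t" "t < b" shows "right_vel c t ((c b - c a) /\<^sub>R (b - a))"
proof -
  obtain p v where v: "\<And>t. a \<le> t \<Longrightarrow> t \<le> b \<Longrightarrow> c t = p + t *\<^sub>R v"
    using assms by (auto simp: lin_def)
  have e: "(c b - c a) /\<^sub>R (b - a) = v" using assms by (simp add: v flip: scaleR_left_diff_distrib)
  show ?thesis unfolding e right_vel_def using assms v by (intro exI [of _ "b - t"]) (auto simp: algebra_simps)
qed

lemma lin_left_vel: 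
  assumes "lin a b c" "a < t" "t \<le> b" shows "left_vel c t ((c b - c a) /\<^sub>R (b - a))"
proof -
  obtain p v where v: "\<And>t. a \<le> t \<Longrightarrow> t \<le> b \<Longrightarrow> c t = p + t *\<^sub>R v"
    using assms by (auto simp: lin_def)
  have e: "(c b - c a) /\<^sub>R (b - a) = v" using assms by (simp add: v flip: scaleR_left_diff_distrib)
  show ?thesis unfolding e left_vel_def using assms v by (intro exI [of _ "t - a"]) (auto simp: algebra_simps)
qed

lemma lin_imp_pl: "lin a b c \<Longrightarrow> pl a b c"
  unfolding pl_def using lin_right_vel lin_left_vel by (metis atLeastLessThan_iff greaterThanAtMost_iff)

text \<open>A property of intervals that holds locally and survives gluing holds on the whole
  interval, by bisection (\<open>Bolzano\<close>). The norms of the two velocities at a time are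
  local constants, and a glued interval gets the sum of the constants of its parts.\<close>

lemma pl_Lipschitz:
  assumes "pl a b c" "a \<le> b"
  obtains L where "0 \<le> L" "\<And>s t. s \<in> {a..b} \<Longrightarrow> t \<in> {a..b} \<Longrightarrow> norm (c s - c t) \<le> L * \<bar>s - t\<bar>"
proof -
  define P where "P = (\<lambda>p q. a \<le> p \<and> q \<le> b \<longrightarrow>
    (\<exists>L\<ge>0. \<forall>s t. p \<le> s \<and> s \<le> t \<and> t \<le> q \<longrightarrow> norm (c s - c t) \<le> L * (t - s)))"
  have P3: "P p q"
    if s: "p \<le> m" "m \<le> q" and L: "0 \<le> L" "0 \<le> M" 
     and 1: "\<And>s t. p \<le> s \<Longrightarrow> s \<le> t \<Longrightarrow> t \<le> m \<Longrightarrow> norm (c s - c t) \<le> L * (t - s)"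
     and 2: "\<And>s t. m \<le> s \<Longrightarrow> s \<le> t \<Longrightarrow> t \<le> q \<Longrightarrow> norm (c s - c t) \<le> M * (t - s)"
   for p m q L M
  proof -
    have "norm (c s - c t) \<le> (L + M) * (t - s)" if st: "p \<le> s" "s \<le> t" "t \<le> q" for s t
    proof (cases "t \<le> m \<or> m \<le> s")
      case True
      then show ?thesis using 1 [of s t] 2 [of s t] st L mult_nonneg_nonneg [of L "t - s"]
          mult_nonneg_nonneg [of M "t - s"] by (auto simp: algebra_simps)
    next
      case False
      have "norm (c s - c t) \<le> norm (c s - c m) + norm (c m - c t)"
        using norm_triangle_ineq [of "c s - c m" "c m - c t"] by simp
      also have "\<dots> \<le> L * (m - s) + M * (t - m)" using 1 [of s m] 2 [of m t] False st by auto
      also have "\<dots> \<le> L * (t - s) + M * (t - s)"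
        using False st L by (intro add_mono mult_left_mono) auto
      finally show ?thesis by (simp add: algebra_simps)
    qed
    then show ?thesis unfolding P_def using L by (intro impI exI [of _ "L + M"]) auto
  qed
  have "P a b"
  proof (rule Bolzano [OF assms(2)])
    show "P p r" if PP: "P p q" "P q r" and pqr: "p \<le> q" "q \<le> r" for p q r
    proof (cases "a \<le> p \<and> r \<le> b")
      case True
      then have "a \<le> p \<and> q \<le> b" "a \<le> q \<and> r \<le> b" using pqr by auto
      then obtain L M where "0 \<le> L" "\<forall>s t. p \<le> s \<and> s \<le> t \<and> t \<le> q \<longrightarrow> norm (c s - c t) \<le> L * (t - s)"
        "0 \<le> M" "\<forall>s t. q \<le> s \<and> s \<le> t \<and> t \<le> r \<longrightarrow> norm (c s - c t) \<le> M * (t - s)"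
        using PP unfolding P_def by blast
      then show ?thesis using pqr by (intro P3 [of p q r L M]) auto
    qed (auto simp: P_def)
    show "\<exists>d>0. \<forall>p q. p \<le> x \<and> x \<le> q \<and> q - p < d \<longrightarrow> P p q" if x: "a \<le> x" "x \<le> b" for x
    proof -
      obtain r v where r: "0 < r" "x < b \<Longrightarrow> \<forall>y. 0 \<le> y \<and> y \<le> r \<longrightarrow> c (x + y) = c x + y *\<^sub>R v"
      proof (cases "x < b")
        case True
        then obtain v where "right_vel c x v" using assms(1) x by (auto elim: pl_right_velE)
        from right_velE [OF this zero_less_one] show ?thesis using that by metis
      qed (use that [of 1] in auto)
      obtain l w where l: "0 < l" "a < x \<Longrightarrow> \<forall>y. 0 \<le> y \<and> y \<le> l \<longrightarrow> c (x - y) = c x - y *\<^sub>R w"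
      proof (cases "a < x")
        case True
        then obtain v where "left_vel c x v" using assms(1) x by (auto elim: pl_left_velE)
        from left_velE [OF this zero_less_one] show ?thesis using that by metis
      qed (use that [of 1] in auto)
      have "P p q" if pq: "p \<le> x" "x \<le> q" "q - p < min r l" for p q
      proof (cases "a \<le> p \<and> q \<le> b")
        case True
        show ?thesis
        proof (rule P3 [of p x q "norm w" "norm v"])
          fix s t assume st: "p \<le> s" "s \<le> t" "t \<le> x"
          show "norm (c s - c t) \<le> norm w * (t - s)"
          proof (cases "a < x")
            case True
            have cs: "c s = c x - (x - s) *\<^sub>R w" and ct: "c t = c x - (x - t) *\<^sub>R w"
              using l(2) [OF True, rule_format, of "x - s"] l(2) [OF True, rule_format, of "x - t"] st pq by auto
            have "c s - c t = - ((t - s) *\<^sub>R w)" unfolding cs ct by (simp add: algebra_simps)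
            then show ?thesis using st by simp
          next
            case False then have "s = t" using st \<open>a \<le> p \<and> q \<le> b\<close> by auto
            then show ?thesis by simp
          qed
        next
          fix s t assume st: "x \<le> s" "s \<le> t" "t \<le> q"
          show "norm (c s - c t) \<le> norm v * (t - s)"
          proof (cases "x < b")
            case True
            have cs: "c s = c x + (s - x) *\<^sub>R v" and ct: "c t = c x + (t - x) *\<^sub>R v"
              using r(2) [OF True, rule_format, of "s - x"] r(2) [OF True, rule_format, of "t - x"] st pq by auto
            have "c s - c t = - ((t - s) *\<^sub>R v)" unfolding cs ct by (simp add: algebra_simps)
            then show ?thesis using st by simp
          next
            case False then have "s = t" using st \<open>a \<le> p \<and> q \<le> b\<close> by auto
            then show ?thesis by simp
          qed
        qed (use pq in auto)
      qed (auto simp: P_def)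
      then show ?thesis using r l by (intro exI [of _ "min r l"]) auto
    qed
  qed
  then obtain L where L: "L \<ge> 0" "\<And>s t. a \<le> s \<and> s \<le> t \<and> t \<le> b \<Longrightarrow> norm (c s - c t) \<le> L * (t - s)"
    unfolding P_def by auto
  show ?thesis
  proof (rule that [OF L(1)])
    fix s t assume "s \<in> {a..b}" "t \<in> {a..b}"
    then show "norm (c s - c t) \<le> L * \<bar>s - t\<bar>"
      using L(2) [of s t] L(2) [of t s] by (cases "s \<le> t") (auto simp: norm_minus_commute)
  qed
qed

lemma pl_continuous_on: assumes "pl a b c" shows "continuous_on {a..b} c"
proof (cases "a \<le> b")
  case True
  obtain L where "0 \<le> L" "\<And>s t. s \<in> {a..b} \<Longrightarrow> t \<in> {a..b} \<Longrightarrow> norm (c s - c t) \<le> L * \<bar>s - t\<bar>"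
    using pl_Lipschitz [OF assms True] by blast
  then have "L-lipschitz_on {a..b} c" by (intro lipschitz_onI) (auto simp: dist_norm)
  then show ?thesis by (rule lipschitz_on_continuous_on)
qed auto

text \<open>The same bisection, now with finite sets of break times: a linear germ needs only its
  ends, and gluing takes the union, in which the gluing time occurs as an end.\<close>

lemma pl_breakpoints:
  assumes "pl a b c" "a \<le> b"
  obtains B where "finite B" "{a, b} \<subseteq> B" "B \<subseteq> {a..b}"
    "\<And>p q. a \<le> p \<Longrightarrow> p \<le> q \<Longrightarrow> q \<le> b \<Longrightarrow> {p<..<q} \<inter> B = {} \<Longrightarrow> lin p q c"
proof -
  define P where "P = (\<lambda>p q. p \<le> q \<and> a \<le> p \<and> q \<le> b \<longrightarrow>
    (\<exists>B. finite B \<and> {p, q} \<subseteq> B \<and> B \<subseteq> {p..q} \<and>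
      (\<forall>s t. p \<le> s \<and> s \<le> t \<and> t \<le> q \<and> {s<..<t} \<inter> B = {} \<longrightarrow> lin s t c)))"
  have P3: "P p q" if pmq: "p \<le> m" "m \<le> q" and PP: "P p m" "P m q" for p m q
  proof (cases "a \<le> p \<and> q \<le> b")
    case True
    then have in1: "p \<le> m \<and> a \<le> p \<and> m \<le> b" and in2: "m \<le> q \<and> a \<le> m \<and> q \<le> b" using pmq by auto
    obtain B1 where B1: "finite B1" "{p, m} \<subseteq> B1" "B1 \<subseteq> {p..m}"
      "\<forall>s t. p \<le> s \<and> s \<le> t \<and> t \<le> m \<and> {s<..<t} \<inter> B1 = {} \<longrightarrow> lin s t c"
      using PP(1) in1 unfolding P_def by blast
    obtain B2 where B2: "finite B2" "{m, q} \<subseteq> B2" "B2 \<subseteq> {m..q}"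
      "\<forall>s t. m \<le> s \<and> s \<le> t \<and> t \<le> q \<and> {s<..<t} \<inter> B2 = {} \<longrightarrow> lin s t c"
      using PP(2) in2 unfolding P_def by blast
    have "lin s t c" if st: "p \<le> s" "s \<le> t" "t \<le> q" "{s<..<t} \<inter> (B1 \<union> B2) = {}" for s t
    proof -
      have "m \<notin> {s<..<t}" using st B1(2) by auto
      then consider "t \<le> m" | "m \<le> s" by fastforce
      then show ?thesis
        by cases (use st B1(4) B2(4) in \<open>blast+\<close>)
    qed
    moreover have "B1 \<union> B2 \<subseteq> {p..q}" using B1(3) B2(3) pmq by fastforce
    ultimately show ?thesis unfolding P_def using B1 B2 by (intro impI exI [of _ "B1 \<union> B2"]) auto
  qed (auto simp: P_def)
  have P1: "P p q" if "lin p q c" for p q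
    unfolding P_def
  proof (intro impI exI [of _ "{p, q}"] conjI allI)
    fix s t assume "p \<le> q \<and> a \<le> p \<and> q \<le> b" "p \<le> s \<and> s \<le> t \<and> t \<le> q \<and> {s<..<t} \<inter> {p, q} = {}"
    then show "lin s t c" using lin_subset [OF that] by auto
  qed auto
  have "P a b"
  proof (rule Bolzano [OF assms(2)])
    show "P p r" if "P p q" "P q r" "p \<le> q" "q \<le> r" for p q r
      using P3 that by blast
    show "\<exists>d>0. \<forall>p q. p \<le> x \<and> x \<le> q \<and> q - p < d \<longrightarrow> P p q" if x: "a \<le> x" "x \<le> b" for x
    proof -
      obtain r where r: "0 < r" "\<And>q. x \<le> q \<Longrightarrow> q < x + r \<Longrightarrow> P x q"
      proof (cases "x < b")
        case True
        then obtain v where "right_vel c x v" using assms(1) x by (auto elim: pl_right_velE)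
        from right_velE [OF this zero_less_one] obtain r where
          r: "0 < r" "\<And>y. 0 \<le> y \<Longrightarrow> y \<le> r \<Longrightarrow> c (x + y) = c x + y *\<^sub>R v" by metis
        have "lin x q c" if "x \<le> q" "q < x + r" for q
          unfolding lin_def
        proof (rule exI [of _ "c x - x *\<^sub>R v"], rule exI [of _ v], rule ballI)
          fix t assume "t \<in> {x..q}" then show "c t = c x - x *\<^sub>R v + t *\<^sub>R v"
            using r(2) [of "t - x"] that by (auto simp: algebra_simps)
        qed
        then show ?thesis using that [OF r(1)] P1 by blast
      next
        case False
        then have "P x q" if "x \<le> q" for q using that x P1 [OF lin_refl, of x]
          by (cases "q = x") (auto simp: P_def)
        then show ?thesis using that [of 1] by auto
      qed
      obtain l where l: "0 < l" "\<And>p. p \<le> x \<Longrightarrow> x - l < p \<Longrightarrow> P p x"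
      proof (cases "a < x")
        case True
        then obtain v where "left_vel c x v" using assms(1) x by (auto elim: pl_left_velE)
        from left_velE [OF this zero_less_one] obtain r where
          r: "0 < r" "\<And>y. 0 \<le> y \<Longrightarrow> y \<le> r \<Longrightarrow> c (x - y) = c x - y *\<^sub>R v" by metis
        have "lin p x c" if "p \<le> x" "x - r < p" for p
          unfolding lin_def
        proof (rule exI [of _ "c x - x *\<^sub>R v"], rule exI [of _ v], rule ballI)
          fix t assume "t \<in> {p..x}" then show "c t = c x - x *\<^sub>R v + t *\<^sub>R v"
            using r(2) [of "x - t"] that by (auto simp: algebra_simps)
        qed
        then show ?thesis using that [OF r(1)] P1 by blast
      next
        case False
        then have "P p x" if "p \<le> x" for p using that x P1 [OF lin_refl, of x]
          by (cases "p = x") (auto simp: P_def)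
        then show ?thesis using that [of 1] by auto
      qed
      have "P p q" if "p \<le> x" "x \<le> q" "q - p < min r l" for p q
        using that r(2) [of q] l(2) [of p] by (intro P3 [of p x q]) auto
      then show ?thesis using r l by (intro exI [of _ "min r l"]) auto
    qed
  qed
  then obtain B where "finite B" "{a, b} \<subseteq> B" "B \<subseteq> {a..b}"
      "\<forall>s t. a \<le> s \<and> s \<le> t \<and> t \<le> b \<and> {s<..<t} \<inter> B = {} \<longrightarrow> lin s t c"
    using assms(2) unfolding P_def by auto
  then show ?thesis by (intro that [of B]) auto
qed

section \<open>Composition, and lower distance bounds for injective curves\<close>

lemma right_vel_compose:
  fixes X :: "real \<Rightarrow> real"
  assumes X: "right_vel X t v" and f: "v > 0 \<Longrightarrow> \<exists>w. right_vel f (X t) w"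
    "v < 0 \<Longrightarrow> \<exists>w. left_vel f (X t) w"
  shows "\<exists>w. right_vel (\<lambda>x. f (X x)) t w"
proof -
  obtain r where r: "0 < r" "\<And>x. 0 \<le> x \<Longrightarrow> x \<le> r \<Longrightarrow> X (t + x) = X t + x * v"
    using right_velE [OF X zero_less_one] by auto
  consider "v = 0" | "v > 0" | "v < 0" by linarith
  then show ?thesis
  proof cases
    case 1
    then have "right_vel (\<lambda>x. f (X x)) t 0" unfolding right_vel_def using r by (intro exI [of _ r]) auto
    then show ?thesis ..
  next
    case 2
    then obtain w where "right_vel f (X t) w" using f by blast
    then obtain q where q: "0 < q" "\<And>x. 0 \<le> x \<Longrightarrow> x \<le> q \<Longrightarrow> f (X t + x) = f (X t) + x *\<^sub>R w"
      using right_velE [OF _ zero_less_one] by metis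
    have "right_vel (\<lambda>x. f (X x)) t (v *\<^sub>R w)"
      unfolding right_vel_def
    proof (intro exI [of _ "min r (q / v)"] conjI ballI)
      fix x assume "x \<in> {0..min r (q / v)}"
      then have "x \<ge> 0" "x \<le> r" "x * v \<le> q" using 2 by (auto simp: field_simps)
      then show "f (X (t + x)) = f (X t) + x *\<^sub>R v *\<^sub>R w" using r(2) [of x] q(2) [of "x * v"] 2 by auto
    qed (use r q 2 in auto)
    then show ?thesis ..
  next
    case 3
    then obtain w where "left_vel f (X t) w" using f by blast
    then obtain q where q: "0 < q" "\<And>x. 0 \<le> x \<Longrightarrow> x \<le> q \<Longrightarrow> f (X t - x) = f (X t) - x *\<^sub>R w"
      using left_velE [OF _ zero_less_one] by metis
    have "right_vel (\<lambda>x. f (X x)) t (v *\<^sub>R w)"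
      unfolding right_vel_def
    proof (intro exI [of _ "min r (q / (- v))"] conjI ballI)
      fix x assume "x \<in> {0..min r (q / (- v))}"
      then have "x \<ge> 0" "x \<le> r" "x * (- v) \<le> q" using 3 by (auto simp: field_simps)
      then show "f (X (t + x)) = f (X t) + x *\<^sub>R v *\<^sub>R w"
        using r(2) [of x] q(2) [of "x * (- v)"] 3 by (auto simp: mult_nonneg_nonpos)
    qed (use r q 3 in \<open>auto simp: divide_pos_neg\<close>)
    then show ?thesis ..
  qed
qed

lemma pl_compose:
  fixes X :: "real \<Rightarrow> real"
  assumes X: "pl a b X" "\<And>t. a \<le> t \<Longrightarrow> t \<le> b \<Longrightarrow> X t \<in> {p..q}" and f: "pl p q f"
  shows "pl a b (\<lambda>t. f (X t))"
proof -
  have R: "\<exists>w. right_vel (\<lambda>x. f (Y x)) t w"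
    if Y: "right_vel Y t v" and tb: "t < b'" and Ypq: "\<And>x. t \<le> x \<Longrightarrow> x \<le> b' \<Longrightarrow> Y x \<in> {p..q}" for Y t v b'
  proof (rule right_vel_compose [OF Y])
    obtain r where r: "0 < r" "r \<le> b' - t" "\<And>x. 0 \<le> x \<Longrightarrow> x \<le> r \<Longrightarrow> Y (t + x) = Y t + x * v"
      using right_velE [OF Y, of "b' - t"] tb by auto
    \<comment> \<open>As \<open>Y\<close> stays in \<open>{p..q}\<close>, a positive velocity forces
      \<open>Y t < q\<close>, so that \<open>f\<close> has a right germ there; a negative one forces
      \<open>p < Y t\<close>.\<close>
    have i: "Y t \<in> {p..q}" "Y t + r * v \<in> {p..q}" using Ypq [of t] Ypq [of "t + r"] r(1,2) r(3) [of r] by auto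
    show "\<exists>w. right_vel f (Y t) w" if "v > 0"
      using f i mult_pos_pos [OF r(1) that] unfolding pl_def by fastforce
    show "\<exists>w. left_vel f (Y t) w" if "v < 0"
      using f i mult_pos_neg [OF r(1) that] unfolding pl_def by fastforce
  qed
  show ?thesis
    unfolding pl_def
  proof (intro conjI ballI)
    fix t assume t: "t \<in> {a..<b}"
    then obtain v where "right_vel X t v" using X(1) by (auto elim: pl_right_velE)
    then show "\<exists>w. right_vel (\<lambda>x. f (X x)) t w" by (rule R) (use t X(2) in auto)
  next
    fix t assume t: "t \<in> {a<..b}"
    then obtain v where "left_vel X t v" using X(1) by (auto elim: pl_left_velE)
    then have "right_vel (\<lambda>x. X (- x)) (- t) (- v)" by (simp add: left_vel_iff_right_vel)
    then have "\<exists>w. right_vel (\<lambda>x. f (X (- x))) (- t) w" by (rule R [where b' = "- a"]) (use t X(2) in auto)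
    then show "\<exists>w. left_vel (\<lambda>x. f (X x)) t w" unfolding left_vel_iff_right_vel by (metis minus_minus)
  qed
qed

text \<open>By homogeneity it suffices to treat \<open>u + w = 1\<close>, a compact segment on which
  the norm does not vanish.\<close>

lemma cone_lower_bound:
  fixes f g :: "'a::real_normed_vector"
  assumes "\<And>u. 0 \<le> u \<Longrightarrow> u \<le> 1 \<Longrightarrow> u *\<^sub>R f + (1 - u) *\<^sub>R g \<noteq> 0"
  obtains k where "0 < k" "\<And>u w. 0 \<le> u \<Longrightarrow> 0 \<le> w \<Longrightarrow> norm (u *\<^sub>R f + w *\<^sub>R g) \<ge> k * (u + w)"
proof -
  have "continuous_on {0..1} (\<lambda>u. norm (u *\<^sub>R f + (1 - u) *\<^sub>R g))" by (intro continuous_intros)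
  then obtain m where m: "m \<in> {0..1}" 
     "\<And>u. u \<in> {0..1} \<Longrightarrow> norm (m *\<^sub>R f + (1 - m) *\<^sub>R g) \<le> norm (u *\<^sub>R f + (1 - u) *\<^sub>R g)"
    using continuous_attains_inf [of "{0..1::real}" "\<lambda>u. norm (u *\<^sub>R f + (1 - u) *\<^sub>R g)"] by auto
  show ?thesis
  proof (rule that [of "norm (m *\<^sub>R f + (1 - m) *\<^sub>R g)"])
    show "0 < norm (m *\<^sub>R f + (1 - m) *\<^sub>R g)" using assms m(1) by auto
    fix u w :: real assume uw: "0 \<le> u" "0 \<le> w"
    show "norm (m *\<^sub>R f + (1 - m) *\<^sub>R g) * (u + w) \<le> norm (u *\<^sub>R f + w *\<^sub>R g)"
    proof (cases "u + w = 0")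
      case False
      then have pos: "u + w > 0" using uw by auto
      have "norm (u *\<^sub>R f + w *\<^sub>R g) = norm ((u + w) *\<^sub>R ((u / (u + w)) *\<^sub>R f + (1 - u / (u + w)) *\<^sub>R g))"
        using pos by (simp add: scaleR_add_right right_diff_distrib)
      also have "\<dots> = (u + w) * norm ((u / (u + w)) *\<^sub>R f + (1 - u / (u + w)) *\<^sub>R g)" using pos by simp
      also have "\<dots> \<ge> (u + w) * norm (m *\<^sub>R f + (1 - m) *\<^sub>R g)"
        using m(2) [of "u / (u + w)"] uw pos by (intro mult_left_mono) auto
      finally show ?thesis by (simp add: mult.commute)
    qed (use uw in auto)
  qed
qed

text \<open>Injectivity keeps the two germs at a time from folding back onto each other, which
  bounds the distortion near that time. Pairs violating every bound would accumulate at two times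
  with the same image, hence at a single time, where the local bound contradicts them.\<close>

lemma pl_inj_bilipschitz:
  assumes c: "pl a b c" "inj_on c {a..b}" and ab: "a \<le> b"
  obtains k where "0 < k" "\<And>s t. s \<in> {a..b} \<Longrightarrow> t \<in> {a..b} \<Longrightarrow> k * \<bar>s - t\<bar> \<le> norm (c s - c t)"
proof -
  have cont: "continuous_on {a..b} c" using c(1) by (rule pl_continuous_on)
  have local: "\<exists>d>0. \<exists>k>0. \<forall>s\<in>{a..b}. \<forall>t\<in>{a..b}. \<bar>s - x\<bar> < d \<longrightarrow> \<bar>t - x\<bar> < d \<longrightarrow> k * \<bar>s - t\<bar> \<le> norm (c s - c t)"
    if x: "x \<in> {a..b}" for x
  proof -
    obtain r g where r: "0 < r" "x < b \<Longrightarrow> \<forall>y. 0 \<le> y \<and> y \<le> r \<longrightarrow> c (x + y) = c x + y *\<^sub>R g \<and> x + y \<le> b"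
    proof (cases "x < b")
      case True
      then obtain v where v: "right_vel c x v" using c(1) x by (auto elim: pl_right_velE)
      from right_velE [OF this, of "b - x"] True show ?thesis using that by (smt (verit))
    qed (use that [of 1] in auto)
    obtain l f where l: "0 < l" "a < x \<Longrightarrow> \<forall>y. 0 \<le> y \<and> y \<le> l \<longrightarrow> c (x - y) = c x - y *\<^sub>R f \<and> a \<le> x - y"
    proof (cases "a < x")
      case True
      then obtain v where v: "left_vel c x v" using c(1) x by (auto elim: pl_left_velE)
      from left_velE [OF this, of "x - a"] True show ?thesis using that by (smt (verit))
    qed (use that [of 1] in auto)
    define d where "d = min r l"
    have d: "d > 0" using r l by (simp add: d_def)
    have g0: "g \<noteq> 0" if "x < b"
      using r(2) [OF that, rule_format, of r] r(1) x inj_onD [OF c(2), of "x + r" x] by fastforce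
    have f0: "f \<noteq> 0" if "a < x"
      using l(2) [OF that, rule_format, of l] l(1) x inj_onD [OF c(2), of "x - l" x] by fastforce
    obtain k where k: "0 < k" "x < b \<Longrightarrow> k \<le> norm g" "a < x \<Longrightarrow> k \<le> norm f"
      "\<And>u w. a < x \<Longrightarrow> x < b \<Longrightarrow> 0 \<le> u \<Longrightarrow> 0 \<le> w \<Longrightarrow> norm (u *\<^sub>R f + w *\<^sub>R g) \<ge> k * (u + w)"
    proof (cases "a < x \<and> x < b")
      case True
      \<comment> \<open>A vanishing combination would mean that the outgoing germ retraces the
        incoming one or that one of them stands still; in each case two times near \<open>x\<close>
        have the same image.\<close>
      have ne: "u *\<^sub>R f + (1 - u) *\<^sub>R g \<noteq> 0" if u: "0 \<le> u" "u \<le> 1" for u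
      proof
        assume "u *\<^sub>R f + (1 - u) *\<^sub>R g = 0"
        then have "d *\<^sub>R (u *\<^sub>R f + (1 - u) *\<^sub>R g) = 0" by simp
        then have 0: "- ((d * u) *\<^sub>R f) = (d * (1 - u)) *\<^sub>R g"
          by (simp add: scaleR_add_right add_eq_0_iff)
        have "d \<le> l" "d \<le> r" "d * u \<le> d" "d * (1 - u) \<le> d"
          using u d mult_left_le [of u d] mult_left_le [of "1 - u" d] by (auto simp: d_def)
        moreover have "0 \<le> d * u" "0 \<le> d * (1 - u)" using u d by auto
        ultimately have b: "0 \<le> d * u" "d * u \<le> l" "0 \<le> d * (1 - u)" "d * (1 - u) \<le> r"
          by linarith+
        have "c (x - d * u) = c (x + d * (1 - u))"
          using l(2) r(2) True b 0 by simp
        then have "x - d * u = x + d * (1 - u)"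
          using l(2) r(2) True b d x by (intro inj_onD [OF c(2)]) auto
        then show False using d by (simp add: algebra_simps)
      qed
      from cone_lower_bound [OF ne] obtain k where k: "0 < k"
        "\<And>u w. 0 \<le> u \<Longrightarrow> 0 \<le> w \<Longrightarrow> norm (u *\<^sub>R f + w *\<^sub>R g) \<ge> k * (u + w)" by blast
      show ?thesis using that [OF k(1)] k(2) [of 1 0] k(2) [of 0 1] k(2) by auto
    next
      case False
      then show ?thesis 
        using that [of "if x < b then norm g else if a < x then norm f else 1"] f0 g0 by auto
    qed
    have main: "k * \<bar>s - t\<bar> \<le> norm (c s - c t)"
      if st: "s \<in> {a..b}" "t \<in> {a..b}" "\<bar>s - x\<bar> < d" "\<bar>t - x\<bar> < d" "s \<le> t" for s t
    proof -
      consider "t \<le> x" "s < t" | "s \<ge> x" "s < t" | "s < x" "x < t" | "s = t" using st by fastforce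
      then show ?thesis
      proof cases
        case 1
        then have ax: "a < x" using st x by auto
        have cs: "c s = c x - (x - s) *\<^sub>R f" and ct: "c t = c x - (x - t) *\<^sub>R f"
          using l(2) [OF ax, rule_format, of "x - s"] l(2) [OF ax, rule_format, of "x - t"] 1 st
          by (auto simp: d_def)
        have "c s - c t = - ((t - s) *\<^sub>R f)" unfolding cs ct by (simp add: algebra_simps)
        then show ?thesis using 1 k(3) [OF ax] by (simp add: mult.commute mult_right_mono)
      next
        case 2
        then have xb: "x < b" using st x by auto
        have cs: "c s = c x + (s - x) *\<^sub>R g" and ct: "c t = c x + (t - x) *\<^sub>R g"
          using r(2) [OF xb, rule_format, of "s - x"] r(2) [OF xb, rule_format, of "t - x"] 2 st
          by (auto simp: d_def)
        have "c s - c t = - ((t - s) *\<^sub>R g)" unfolding cs ct by (simp add: algebra_simps)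
        then show ?thesis using 2 k(2) [OF xb] by (simp add: mult.commute mult_right_mono)
      next
        case 3
        then have ax: "a < x" and xb: "x < b" using st by auto
        have cs: "c s = c x - (x - s) *\<^sub>R f" and ct: "c t = c x + (t - x) *\<^sub>R g"
          using l(2) [OF ax, rule_format, of "x - s"] r(2) [OF xb, rule_format, of "t - x"] 3 st
          by (auto simp: d_def)
        have "c s - c t = - ((x - s) *\<^sub>R f + (t - x) *\<^sub>R g)" unfolding cs ct by simp
        then have "norm (c s - c t) = norm ((x - s) *\<^sub>R f + (t - x) *\<^sub>R g)" by (simp only: norm_minus_cancel)
        then show ?thesis using k(4) [OF ax xb, of "x - s" "t - x"] 3 by simp
      qed simp
    qed
    have "k * \<bar>s - t\<bar> \<le> norm (c s - c t)"
      if st: "s \<in> {a..b}" "t \<in> {a..b}" "\<bar>s - x\<bar> < d" "\<bar>t - x\<bar> < d" for s t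
      using main [of s t] main [of t s] st by (cases "s \<le> t") (auto simp: abs_minus_commute norm_minus_commute)
    then show ?thesis using d k(1) by blast
  qed
  have "\<exists>k>0. \<forall>s\<in>{a..b}. \<forall>t\<in>{a..b}. k * \<bar>s - t\<bar> \<le> norm (c s - c t)"
  proof (rule ccontr)
    assume "\<not> ?thesis"
    then have "\<exists>s\<in>{a..b}. \<exists>t\<in>{a..b}. norm (c s - c t) < inverse (real (Suc n)) * \<bar>s - t\<bar>" for n
      by (meson inverse_positive_iff_positive not_le of_nat_0_less_iff zero_less_Suc)
    then obtain s t where st: "\<And>n. s n \<in> {a..b}" "\<And>n. t n \<in> {a..b}"
      "\<And>n. norm (c (s n) - c (t n)) < inverse (real (Suc n)) * \<bar>s n - t n\<bar>" by metis
    obtain x \<rho> where \<rho>: "x \<in> {a..b}" "strict_mono \<rho>" "(s \<circ> \<rho>) \<longlonglongrightarrow> x"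
      using st(1) compact_Icc [of a b] unfolding compact_def by metis
    obtain y \<tau> where \<tau>: "y \<in> {a..b}" "strict_mono \<tau>" "((t \<circ> \<rho>) \<circ> \<tau>) \<longlonglongrightarrow> y"
      using st(2) compact_Icc [of a b] unfolding compact_def by (metis comp_apply)
    define \<sigma> where "\<sigma> = \<rho> \<circ> \<tau>"
    have \<sigma>: "strict_mono \<sigma>" using \<rho> \<tau> by (simp add: \<sigma>_def strict_mono_o)
    have sx: "(\<lambda>n. s (\<sigma> n)) \<longlonglongrightarrow> x"
      using LIMSEQ_subseq_LIMSEQ [OF \<rho>(3) \<tau>(2)] by (simp add: \<sigma>_def o_def)
    have ty: "(\<lambda>n. t (\<sigma> n)) \<longlonglongrightarrow> y" using \<tau>(3) by (simp add: \<sigma>_def o_def)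
    have inv: "(\<lambda>n. inverse (real (Suc (\<sigma> n)))) \<longlonglongrightarrow> 0"
      using LIMSEQ_subseq_LIMSEQ [OF LIMSEQ_inverse_real_of_nat \<sigma>] by (simp add: o_def)
    have "(\<lambda>n. c (s (\<sigma> n)) - c (t (\<sigma> n))) \<longlonglongrightarrow> c x - c y"
      using cont sx ty \<rho>(1) \<tau>(1) st(1,2)
      by (intro tendsto_diff continuous_on_tendsto_compose [OF cont]) auto
    moreover have "(\<lambda>n. c (s (\<sigma> n)) - c (t (\<sigma> n))) \<longlonglongrightarrow> 0"
    proof (rule Lim_null_comparison)
      show "\<forall>\<^sub>F n in sequentially. norm (c (s (\<sigma> n)) - c (t (\<sigma> n))) \<le> inverse (real (Suc (\<sigma> n))) * (b - a)"
      proof (rule always_eventually, rule allI)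
        fix n
        have "\<bar>s (\<sigma> n) - t (\<sigma> n)\<bar> \<le> b - a" using st(1,2) [of "\<sigma> n"] by auto
        then have "inverse (real (Suc (\<sigma> n))) * \<bar>s (\<sigma> n) - t (\<sigma> n)\<bar> \<le> inverse (real (Suc (\<sigma> n))) * (b - a)"
          by (intro mult_left_mono) auto
        then show "norm (c (s (\<sigma> n)) - c (t (\<sigma> n))) \<le> inverse (real (Suc (\<sigma> n))) * (b - a)"
          using st(3) [of "\<sigma> n"] by linarith
      qed
      show "(\<lambda>n. inverse (real (Suc (\<sigma> n))) * (b - a)) \<longlonglongrightarrow> 0"
        using tendsto_mult_left_zero [OF inv] .
    qed
    ultimately have "c x - c y = 0" by (rule LIMSEQ_unique)
    then have xy: "x = y" using inj_onD [OF c(2)] \<rho>(1) \<tau>(1) by simp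
    obtain d k where dk: "d > 0" "k > 0" "\<forall>s\<in>{a..b}. \<forall>t\<in>{a..b}. \<bar>s - x\<bar> < d \<longrightarrow> \<bar>t - x\<bar> < d \<longrightarrow> k * \<bar>s - t\<bar> \<le> norm (c s - c t)"
      using local [OF \<rho>(1)] by blast
    have "\<forall>\<^sub>F n in sequentially. \<bar>s (\<sigma> n) - x\<bar> < d" "\<forall>\<^sub>F n in sequentially. \<bar>t (\<sigma> n) - x\<bar> < d"
      using tendstoD [OF sx dk(1)] tendstoD [OF ty dk(1)] by (auto simp: dist_real_def xy)
    moreover have "\<forall>\<^sub>F n in sequentially. inverse (real (Suc (\<sigma> n))) < k"
      using order_tendstoD(2) [OF inv dk(2)] .
    ultimately have "\<forall>\<^sub>F n in sequentially. False"
    proof eventually_elim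
      case (elim n)
      then have "k * \<bar>s (\<sigma> n) - t (\<sigma> n)\<bar> \<le> norm (c (s (\<sigma> n)) - c (t (\<sigma> n)))" using dk(3) st(1,2) by blast
      also have "\<dots> < inverse (real (Suc (\<sigma> n))) * \<bar>s (\<sigma> n) - t (\<sigma> n)\<bar>" using st(3) .
      finally show False using elim(3) by (simp add: mult_less_cancel_right)
    qed
    then show False by simp
  qed
  then show ?thesis using that by blast
qed

section \<open>Isotopies of closed piecewise linear curves\<close>

definition closed_pl :: "real \<Rightarrow> (real \<Rightarrow> 'a::real_normed_vector) \<Rightarrow> bool" where
  "closed_pl N c \<longleftrightarrow> 0 < N \<and> pl 0 N c \<and> c 0 = c N \<and> inj_on c {0..<N}"

text \<open>For times in \<open>{0..N}\<close>, the distance on a circle of length \<open>N\<close>.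
  Unlike \<open>\<bar>s - t\<bar>\<close> it is comparable to distances along a closed curve also
  near the base point, where \<open>0\<close> and \<open>N\<close> coincide.\<close>

definition circ :: "real \<Rightarrow> real \<Rightarrow> real \<Rightarrow> real" where
  "circ N s t = min \<bar>s - t\<bar> (N - \<bar>s - t\<bar>)"

lemma pl_shift: "pl a b c \<Longrightarrow> pl (a - k) (b - k) (\<lambda>u. c (u + k))"
  by (rule pl_compose [where p = a and q = b]) (auto intro: pl_add pl_ident pl_const)

lemma closed_pl_inj:
  assumes "closed_pl N c" "s \<in> {0..N}" "t \<in> {0..N}" "c s = c t" "s \<noteq> t"
  shows "{s, t} = {0, N}"
proof -
  have c: "c 0 = c N" "inj_on c {0..<N}" "0 < N" using assms(1) by (auto simp: closed_pl_def)
  define f where "f = (\<lambda>x. if x = N then 0 else x)"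
  have "c (f s) = c (f t)" "f s \<in> {0..<N}" "f t \<in> {0..<N}" using assms c by (auto simp: f_def)
  then have "f s = f t" using inj_onD [OF c(2)] by blast
  then show ?thesis using assms(5) by (auto simp: f_def split: if_splits)
qed

text \<open>Three overlapping injective arcs, each two thirds of the curve, contain every pair of
  times between them. The third one passes through the base point and is parametrised by
  \<open>e\<close>, with negative times before that point.\<close>

lemma closed_pl_bilipschitz:
  assumes "closed_pl N c"
  obtains k where "0 < k" "\<And>s t. s \<in> {0..N} \<Longrightarrow> t \<in> {0..N} \<Longrightarrow> k * circ N s t \<le> norm (c s - c t)"
proof -
  have N: "0 < N" and c: "pl 0 N c" "c 0 = c N" using assms by (auto simp: closed_pl_def)
  note inj = closed_pl_inj [OF assms]
  define e where "e = (\<lambda>u. if u < 0 then c (u + N) else c u)"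
  have "inj_on c {0..2*N/3}"
  proof (rule inj_onI, rule ccontr)
    fix s t assume "s \<in> {0..2*N/3}" "t \<in> {0..2*N/3}" "c s = c t" "s \<noteq> t"
    then show False using inj [of s t] N by (auto simp: doubleton_eq_iff)
  qed
  moreover have "inj_on c {N/3..N}"
  proof (rule inj_onI, rule ccontr)
    fix s t assume "s \<in> {N/3..N}" "t \<in> {N/3..N}" "c s = c t" "s \<noteq> t"
    then show False using inj [of s t] N by (auto simp: doubleton_eq_iff)
  qed
  moreover have "inj_on e {-N/3..N/3}"
  proof (rule inj_onI)
    fix s t assume st: "s \<in> {-N/3..N/3}" "t \<in> {-N/3..N/3}" "e s = e t"
    define f where "f = (\<lambda>u. if u < 0 then u + N else u)"
    have "c (f s) = c (f t)" using st by (simp add: e_def f_def split: if_splits)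
    moreover have "f s \<in> {0..<N}" "f t \<in> {0..<N}" using st N by (auto simp: f_def)
    moreover have "inj_on c {0..<N}" using assms by (simp add: closed_pl_def)
    ultimately have "f s = f t" by (blast dest: inj_onD)
    then show "s = t" using st N by (auto simp: f_def split: if_splits)
  qed
  moreover have "pl (-N/3) (N/3) e"
  proof (rule pl_trans)
    have "pl (-N/3) 0 (\<lambda>u. c (u + N))"
      by (rule pl_subset [OF pl_shift [OF c(1), of N]]) (use N in auto)
    then show "pl (-N/3) 0 e" by (rule pl_cong) (use c in \<open>auto simp: e_def\<close>)
    show "pl 0 (N/3) e" by (rule pl_cong [OF pl_subset [OF c(1)]]) (use N in \<open>auto simp: e_def\<close>)
  qed
  moreover have "pl 0 (2*N/3) c" "pl (N/3) N c" by (rule pl_subset [OF c(1)]; use N in simp)+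
  ultimately have arcs: "pl 0 (2*N/3) c" "inj_on c {0..2*N/3}" "pl (N/3) N c" "inj_on c {N/3..N}"
    "pl (-N/3) (N/3) e" "inj_on e {-N/3..N/3}" by auto
  have le: "0 \<le> 2*N/3" "N/3 \<le> N" "-N/3 \<le> N/3" using N by auto
  obtain k1 where k1: "0 < k1"
    "\<And>s t. s \<in> {0..2*N/3} \<Longrightarrow> t \<in> {0..2*N/3} \<Longrightarrow> k1 * \<bar>s - t\<bar> \<le> norm (c s - c t)"
    using pl_inj_bilipschitz [OF arcs(1,2) le(1)] by blast
  obtain k2 where k2: "0 < k2"
    "\<And>s t. s \<in> {N/3..N} \<Longrightarrow> t \<in> {N/3..N} \<Longrightarrow> k2 * \<bar>s - t\<bar> \<le> norm (c s - c t)"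
    using pl_inj_bilipschitz [OF arcs(3,4) le(2)] by blast
  obtain k3 where k3: "0 < k3"
    "\<And>s t. s \<in> {-N/3..N/3} \<Longrightarrow> t \<in> {-N/3..N/3} \<Longrightarrow> k3 * \<bar>s - t\<bar> \<le> norm (e s - e t)"
    using pl_inj_bilipschitz [OF arcs(5,6) le(3)] by blast
  note k = k1(1) k2(1) k3(1) k1(2) k2(2) k3(2)
  define k where "k = min k1 (min k2 k3)"
  have k0: "0 < k" "k \<le> k1" "k \<le> k2" "k \<le> k3" using k by (auto simp: k_def)
  have main: "k * circ N s t \<le> norm (c s - c t)" if st: "0 \<le> s" "s \<le> t" "t \<le> N" for s t
  proof -
    have c0: "circ N s t \<le> t - s" "circ N s t \<le> N - (t - s)" "0 \<le> circ N s t" using st by (auto simp: circ_def)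
    consider "t \<le> 2*N/3" | "N/3 \<le> s" | "s < N/3" "2*N/3 < t" by linarith
    then show ?thesis
    proof cases
      case 1
      have "k * circ N s t \<le> k1 * (t - s)" using k0 c0 k st by (intro mult_mono) auto
      also have "\<dots> \<le> norm (c s - c t)" using k(4) [of s t] 1 st by auto
      finally show ?thesis .
    next
      case 2
      have "k * circ N s t \<le> k2 * (t - s)" using k0 c0 k st by (intro mult_mono) auto
      also have "\<dots> \<le> norm (c s - c t)" using k(5) [of s t] 2 st by auto
      finally show ?thesis .
    next
      case 3
      have "k * circ N s t \<le> k3 * (N - (t - s))" using k0 c0 k st by (intro mult_mono) auto
      also have "\<dots> \<le> norm (e s - e (t - N))" using k(6) [of s "t - N"] 3 st by (auto simp: algebra_simps)
      also have "e s = c s" using st by (simp add: e_def)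
      also have "e (t - N) = c t" using st c by (auto simp: e_def)
      finally show ?thesis .
    qed
  qed
  show ?thesis
  proof (rule that [OF k0(1)])
    fix s t assume "s \<in> {0..N}" "t \<in> {0..N}"
    then show "k * circ N s t \<le> norm (c s - c t)"
      using main [of s t] main [of t s]
      by (cases "s \<le> t") (auto simp: circ_def abs_minus_commute norm_minus_commute)
  qed
qed

lemma pl_circ_Lipschitz:
  assumes "pl 0 N d" "d 0 = d N" "0 < N"
  obtains L where "0 \<le> L" "\<And>s t. s \<in> {0..N} \<Longrightarrow> t \<in> {0..N} \<Longrightarrow> norm (d s - d t) \<le> L * circ N s t"
proof -
  obtain L where L: "0 \<le> L" "\<And>s t. s \<in> {0..N} \<Longrightarrow> t \<in> {0..N} \<Longrightarrow> norm (d s - d t) \<le> L * \<bar>s - t\<bar>"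
    using pl_Lipschitz [OF assms(1)] assms(3) by auto
  have main: "norm (d s - d t) \<le> L * circ N s t" if st: "0 \<le> s" "s \<le> t" "t \<le> N" for s t
  proof -
    have "norm (d s - d t) \<le> norm (d s - d 0) + norm (d N - d t)"
      using norm_triangle_ineq [of "d s - d 0" "d N - d t"] assms(2) by simp
    also have "\<dots> \<le> L * (N - (t - s))" using L(2) [of s 0] L(2) [of N t] st by (simp add: algebra_simps)
    finally show ?thesis using L(2) [of s t] st by (auto simp: circ_def min_def)
  qed
  show ?thesis
  proof (rule that [OF L(1)])
    fix s t assume "s \<in> {0..N}" "t \<in> {0..N}"
    then show "norm (d s - d t) \<le> L * circ N s t"
      using main [of s t] main [of t s]
      by (cases "s \<le> t") (auto simp: circ_def abs_minus_commute norm_minus_commute)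
  qed
qed

lemma closed_pl_perturbation:
  fixes c d :: "real \<Rightarrow> real^3"
  assumes c: "closed_pl N c" and k: "0 < k"
      "\<And>s t. s \<in> {0..N} \<Longrightarrow> t \<in> {0..N} \<Longrightarrow> k * circ N s t \<le> norm (c s - c t)"
    and d: "pl 0 N d" "d 0 = d N" "\<And>s t. s \<in> {0..N} \<Longrightarrow> t \<in> {0..N} \<Longrightarrow> norm (d s - d t) \<le> k/6 * circ N s t"
  shows "closed_pl N (\<lambda>t. c t + d t)"
    "ambient_isotopic (Some ` c ` {0..<N}) (Some ` (\<lambda>t. c t + d t) ` {0..<N})"
proof -
  have cd: "norm (d s - d t) \<le> norm (c s - c t) / 6" if "s \<in> {0..<N}" "t \<in> {0..<N}" for s t
    using k(2) [of s t] d(3) [of s t] that by auto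
  then show "ambient_isotopic (Some ` c ` {0..<N}) (Some ` (\<lambda>t. c t + d t) ` {0..<N})"
    by (rule ambient_isotopic_perturbation)
  have "inj_on (\<lambda>t. c t + d t) {0..<N}"
  proof (rule inj_onI)
    fix s t assume st: "s \<in> {0..<N}" "t \<in> {0..<N}" "c s + d s = c t + d t"
    then have "c s - c t = d t - d s" by (simp add: algebra_simps)
    then have "norm (c s - c t) = norm (d s - d t)" by (simp add: norm_minus_commute)
    then have "c s = c t" using cd [OF st(1,2)] by simp
    then show "s = t" using c st by (auto simp: closed_pl_def dest: inj_onD)
  qed
  then show "closed_pl N (\<lambda>t. c t + d t)" using c d by (auto simp: closed_pl_def pl_add)
qed

text \<open>Each stage is bi-Lipschitz with respect to \<open>circ\<close> and \<open>d\<close> is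
  Lipschitz, so a short stretch of the homotopy is a perturbation as in
  \<open>closed_pl_perturbation\<close>; bisection joins the stretches.\<close>

lemma closed_pl_linear_isotopy:
  fixes c d :: "real \<Rightarrow> real^3"
  assumes c: "\<And>\<theta>. 0 \<le> \<theta> \<Longrightarrow> \<theta> \<le> 1 \<Longrightarrow> closed_pl N (\<lambda>t. c t + \<theta> *\<^sub>R d t)" and d: "pl 0 N d"
  shows "ambient_isotopic (Some ` c ` {0..<N}) (Some ` (\<lambda>t. c t + d t) ` {0..<N})"
proof -
  define e where "e = (\<lambda>\<theta> t. c t + \<theta> *\<^sub>R d t)"
  define P where "P = (\<lambda>p q. 0 \<le> p \<and> q \<le> 1 \<longrightarrow>
      ambient_isotopic (Some ` e p ` {0..<N}) (Some ` e q ` {0..<N}))"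
  have e: "closed_pl N (e \<theta>)" if "0 \<le> \<theta>" "\<theta> \<le> 1" for \<theta> using c that by (simp add: e_def)
  have N: "0 < N" using e [of 0] by (simp add: closed_pl_def)
  have d0: "d 0 = d N" using e [of 0] e [of 1] by (simp add: closed_pl_def e_def)
  obtain L where L: "0 \<le> L" "\<And>s t. s \<in> {0..N} \<Longrightarrow> t \<in> {0..N} \<Longrightarrow> norm (d s - d t) \<le> L * circ N s t"
    using pl_circ_Lipschitz [OF d d0 N] by blast
  have "P 0 1"
  proof (rule Bolzano)
    show "(0::real) \<le> 1" by simp
    show "P p r" if "P p q" "P q r" "p \<le> q" "q \<le> r" for p q r
      using that unfolding P_def by (auto intro: ambient_isotopic_trans)
    show "\<exists>\<delta>>0. \<forall>p q. p \<le> x \<and> x \<le> q \<and> q - p < \<delta> \<longrightarrow> P p q" if x: "0 \<le> x" "x \<le> 1" for x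
    proof -
      obtain k where k: "0 < k" "\<And>s t. s \<in> {0..N} \<Longrightarrow> t \<in> {0..N} \<Longrightarrow> k * circ N s t \<le> norm (e x s - e x t)"
        using closed_pl_bilipschitz [OF e [OF x]] by blast
      \<comment> \<open>Chosen to get \<open>L * \<delta> \<le> k / 12\<close>: going from
        \<open>x\<close> back to \<open>p\<close> leaves at least half of \<open>k\<close>, and
        \<open>k / 12\<close> is the sixth part of \<open>k / 2\<close> that a perturbation may use
        up.\<close>
      define \<delta> where "\<delta> = k / (12 * (L + 1))"
      have \<delta>: "0 < \<delta>" using k L by (simp add: \<delta>_def)
      have L\<delta>: "L * \<delta> \<le> k / 12" using k L by (simp add: \<delta>_def field_simps)
      have "P p q" if pq: "p \<le> x" "x \<le> q" "q - p < \<delta>" for p q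
        unfolding P_def
      proof
        assume b: "0 \<le> p \<and> q \<le> 1"
        have ep: "k/2 * circ N s t \<le> norm (e p s - e p t)" if st: "s \<in> {0..N}" "t \<in> {0..N}" for s t
        proof -
          have "e x s - e x t = (e p s - e p t) + (x - p) *\<^sub>R (d s - d t)"
            by (simp add: e_def algebra_simps)
          then have "norm (e x s - e x t) \<le> norm (e p s - e p t) + (x - p) * norm (d s - d t)"
            using norm_triangle_ineq [of "e p s - e p t" "(x - p) *\<^sub>R (d s - d t)"] pq by simp
          moreover have "(x - p) * norm (d s - d t) \<le> \<delta> * (L * circ N s t)"
            using pq L(2) [OF st] by (intro mult_mono) auto
          moreover have "\<delta> * (L * circ N s t) \<le> k/12 * circ N s t"
            using L\<delta> st by (subst mult.assoc [symmetric], intro mult_right_mono) (auto simp: mult.commute circ_def)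
          moreover have "0 \<le> k * circ N s t" using st k by (auto simp: circ_def)
          ultimately show ?thesis using k(2) [OF st] by simp
        qed
        have "ambient_isotopic (Some ` e p ` {0..<N}) (Some ` (\<lambda>t. e p t + (q - p) *\<^sub>R d t) ` {0..<N})"
        proof (rule closed_pl_perturbation)
          show "closed_pl N (e p)" using b pq by (intro e) auto
          show "k/2 * circ N s t \<le> norm (e p s - e p t)" if "s \<in> {0..N}" "t \<in> {0..N}" for s t
            using ep that by blast
          show "norm ((q - p) *\<^sub>R d s - (q - p) *\<^sub>R d t) \<le> k/2/6 * circ N s t"
            if st: "s \<in> {0..N}" "t \<in> {0..N}" for s t
          proof -
            have "norm ((q - p) *\<^sub>R d s - (q - p) *\<^sub>R d t) = (q - p) * norm (d s - d t)"
              using pq by (simp flip: scaleR_diff_right)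
            also have "\<dots> \<le> \<delta> * (L * circ N s t)" using pq L(2) [OF st] by (intro mult_mono) auto
            also have "\<dots> \<le> k/12 * circ N s t"
              using L\<delta> st by (subst mult.assoc [symmetric], intro mult_right_mono) (auto simp: mult.commute circ_def)
            finally show ?thesis by simp
          qed
        qed (use k d d0 in \<open>auto intro: pl_linear simp: linear_iff algebra_simps\<close>)
        moreover have eq: "(\<lambda>t. e p t + (q - p) *\<^sub>R d t) = e q" by (auto simp: e_def algebra_simps)
        ultimately show "ambient_isotopic (Some ` e p ` {0..<N}) (Some ` e q ` {0..<N})" unfolding eq by - assumption
      qed
      then show ?thesis using \<delta> by blast
    qed
  qed
  then show ?thesis by (simp add: P_def e_def)
qed

section \<open>Tent functions and thin fingers\<close>

definition tent :: "real \<Rightarrow> real \<Rightarrow> real" where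
  "tent r x = max 0 (1 - \<bar>x\<bar> / r)"

lemma tent_0 [simp]: "tent r 0 = 1" and tent_nonneg: "0 \<le> tent r x"
  by (auto simp: tent_def)

lemma tent_le_1: "0 < r \<Longrightarrow> tent r x \<le> 1"
  by (auto simp: tent_def)

lemma tent_eq_0: "0 < r \<Longrightarrow> r \<le> \<bar>x\<bar> \<Longrightarrow> tent r x = 0"
  by (auto simp: tent_def max_def field_simps)

lemma tent_eq: "0 < r \<Longrightarrow> \<bar>x\<bar> \<le> r \<Longrightarrow> tent r x = 1 - \<bar>x\<bar> / r"
  by (auto simp: tent_def)

lemma lin_tent:
  assumes r: "0 < r" and ab: "{a<..<b} \<inter> {s - r, s, s + r} = {}"
  shows "lin a b (\<lambda>t. tent r (t - s))"
proof (cases "a < b")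
  case True
  consider "b \<le> s - r" | "s - r \<le> a" "b \<le> s" | "s \<le> a" "b \<le> s + r" | "s + r \<le> a"
    using ab True by fastforce
  then show ?thesis
  proof cases
    case 1
    then show ?thesis unfolding lin_def using r
      by (intro exI [of _ 0]) (auto simp: tent_eq_0)
  next
    case 2
    then show ?thesis unfolding lin_def using r
      by (intro exI [of _ "1 - s/r"] exI [of _ "1/r"]) (auto simp: tent_eq diff_divide_distrib add_divide_distrib)
  next
    case 3
    then show ?thesis unfolding lin_def using r
      by (intro exI [of _ "1 + s/r"] exI [of _ "- 1/r"]) (auto simp: tent_eq diff_divide_distrib add_divide_distrib)
  next
    case 4
    then show ?thesis unfolding lin_def using r
      by (intro exI [of _ 0]) (auto simp: tent_eq_0)
  qed
next
  case False
  then consider "a = b" | "{a..b} = {}" by fastforce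
  then show ?thesis by cases (simp_all add: lin_refl, simp add: lin_def)
qed

lemma pl_tent: assumes r: "0 < r" shows "pl a b (\<lambda>t. tent r (t - s))"
proof -
  define M where "M = \<bar>a\<bar> + \<bar>b\<bar> + \<bar>s\<bar> + r"
  have "lin (-M) (s - r) (\<lambda>t. tent r (t - s))" "lin (s - r) s (\<lambda>t. tent r (t - s))"
    "lin s (s + r) (\<lambda>t. tent r (t - s))" "lin (s + r) M (\<lambda>t. tent r (t - s))"
    by (rule lin_tent [OF r]; use r in force)+
  note pieces = this [THEN lin_imp_pl]
  have "pl (-M) M (\<lambda>t. tent r (t - s))"
    by (rule pl_trans [OF pl_trans [OF pl_trans [OF pieces(1,2)] pieces(3)] pieces(4)])
  then show ?thesis by (rule pl_subset) (use r in \<open>auto simp: M_def\<close>)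
qed

lemma thin_segment_avoids:
  fixes p A D :: "'a::euclidean_space"
  assumes Z: "closed Z" and av: "\<And>l. 0 \<le> l \<Longrightarrow> l \<le> 1 \<Longrightarrow> p + l *\<^sub>R D \<notin> Z"
  obtains r where "0 < r" "\<And>x l. \<bar>x\<bar> \<le> r \<Longrightarrow> 0 \<le> l \<Longrightarrow> l \<le> 1 \<Longrightarrow> p + x *\<^sub>R A + l *\<^sub>R D \<notin> Z"
proof -
  have "compact ((\<lambda>l. p + l *\<^sub>R D) ` {0..1})"
    by (intro compact_continuous_image continuous_intros) auto
  moreover have "(\<lambda>l. p + l *\<^sub>R D) ` {0..1} \<inter> Z = {}" using av by auto
  ultimately obtain d where d: "0 < d" "\<forall>x\<in>(\<lambda>l. p + l *\<^sub>R D) ` {0..1}. \<forall>y\<in>Z. d \<le> dist x y"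
    using separate_compact_closed [OF _ Z] by meson
  show ?thesis
  proof (rule that [of "d / (2 * (norm A + 1))"])
    show "0 < d / (2 * (norm A + 1))" using d(1) by (simp add: add_nonneg_pos)
    fix x l :: real assume x: "\<bar>x\<bar> \<le> d / (2 * (norm A + 1))" and l: "0 \<le> l" "l \<le> 1"
    have "\<bar>x\<bar> * norm A \<le> d / (2 * (norm A + 1)) * (norm A + 1)"
      using x d(1) by (intro mult_mono) (auto simp: add_nonneg_pos)
    also have "\<dots> = d / 2" using add_nonneg_pos [OF norm_ge_zero zero_less_one, of A] by (simp add: field_simps)
    finally have less: "dist (p + l *\<^sub>R D) (p + x *\<^sub>R A + l *\<^sub>R D) < d" using d(1) by (simp add: dist_norm)
    show "p + x *\<^sub>R A + l *\<^sub>R D \<notin> Z"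
    proof
      assume "p + x *\<^sub>R A + l *\<^sub>R D \<in> Z"
      then have "d \<le> dist (p + l *\<^sub>R D) (p + x *\<^sub>R A + l *\<^sub>R D)"
        using d(2) l by (intro d(2) [rule_format]) auto
      then show False using less by linarith
    qed
  qed
qed

text \<open>On the straight piece around \<open>s\<close> the component along \<open>A\<close> still
  tells the time, because the displacement is along \<open>D\<close>; the rest of the curve lies in
  \<open>Z\<close>, which the swept strip avoids. The general space is there because the lemma
  serves the knot as well as its plane projection.\<close>

lemma finger_inj_on:
  fixes c :: "real \<Rightarrow> 'a::euclidean_space"
  assumes c: "inj_on c S" and r: "0 < r" "r \<le> \<rho>"
    and A: "\<And>x. \<bar>x\<bar> < \<rho> \<Longrightarrow> c (s + x) = c s + x *\<^sub>R A"
    and indep: "\<And>x y. x *\<^sub>R A + y *\<^sub>R D = 0 \<Longrightarrow> x = 0"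
    and Z: "\<And>t. t \<in> S \<Longrightarrow> \<rho> \<le> \<bar>t - s\<bar> \<Longrightarrow> c t \<in> Z"
    and av: "\<And>x l. \<bar>x\<bar> \<le> r \<Longrightarrow> 0 \<le> l \<Longrightarrow> l \<le> 1 \<Longrightarrow> c s + x *\<^sub>R A + l *\<^sub>R D \<notin> Z"
    and \<theta>: "0 \<le> \<theta>" "\<theta> \<le> 1"
  shows "inj_on (\<lambda>t. c t + (\<theta> * tent r (t - s)) *\<^sub>R D) S"
proof -
  have far: "c t + (\<theta> * tent r (t - s)) *\<^sub>R D \<noteq> c u"
    if "\<bar>t - s\<bar> < \<rho>" "u \<in> S" "\<rho> \<le> \<bar>u - s\<bar>" "t \<in> S" for t u
  proof (cases "\<bar>t - s\<bar> \<le> r")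
    case True
    have "c t + (\<theta> * tent r (t - s)) *\<^sub>R D = c s + (t - s) *\<^sub>R A + (\<theta> * tent r (t - s)) *\<^sub>R D"
      using A [of "t - s"] that by simp
    moreover have "0 \<le> \<theta> * tent r (t - s)" "\<theta> * tent r (t - s) \<le> 1"
      using \<theta> tent_nonneg tent_le_1 [OF r(1)] by (auto intro: mult_le_one)
    ultimately show ?thesis using av [OF True] Z that by metis
  next
    case False
    then have "tent r (t - s) = 0" "t \<noteq> u" using r that by (auto intro: tent_eq_0)
    then show ?thesis using that inj_onD [OF c] by auto
  qed
  show ?thesis
  proof (rule inj_onI)
    fix t u assume t: "t \<in> S" and u: "u \<in> S"
      and eq: "c t + (\<theta> * tent r (t - s)) *\<^sub>R D = c u + (\<theta> * tent r (u - s)) *\<^sub>R D"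
    consider "\<bar>t - s\<bar> < \<rho>" "\<bar>u - s\<bar> < \<rho>" | "\<bar>t - s\<bar> < \<rho>" "\<rho> \<le> \<bar>u - s\<bar>"
      | "\<rho> \<le> \<bar>t - s\<bar>" "\<bar>u - s\<bar> < \<rho>" | "\<rho> \<le> \<bar>t - s\<bar>" "\<rho> \<le> \<bar>u - s\<bar>" by linarith
    then show "t = u"
    proof cases
      case 1
      have "c t = c s + (t - s) *\<^sub>R A" "c u = c s + (u - s) *\<^sub>R A"
        using A [of "t - s"] A [of "u - s"] 1 by auto
      with eq have "(t - u) *\<^sub>R A + (\<theta> * tent r (t - s) - \<theta> * tent r (u - s)) *\<^sub>R D = 0"
        by (simp add: algebra_simps)
      then show ?thesis using indep by fastforce
    next
      case 2
      then show ?thesis using far [of t u] eq t u r by (auto simp: tent_eq_0)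
    next
      case 3
      then show ?thesis using far [of u t] eq t u r by (auto simp: tent_eq_0)
    next
      case 4
      then show ?thesis using eq t u r inj_onD [OF c] by (auto simp: tent_eq_0)
    qed
  qed
qed

text \<open>It is enough that the single segment from \<open>c s\<close> to \<open>c s + D\<close>
  is free from the curve: by compactness a narrow strip around it is free too. All small widths
  remain available because the projection will impose further bounds on \<open>r\<close>.\<close>

lemma finger_isotopy:
  fixes c :: "real \<Rightarrow> real^3"
  assumes c: "closed_pl N c" and \<rho>: "0 < \<rho>" "0 < s - \<rho>" "s + \<rho> < N"
    and A: "\<And>x. \<bar>x\<bar> \<le> \<rho> \<Longrightarrow> c (s + x) = c s + x *\<^sub>R A"
    and indep: "\<And>x y. x *\<^sub>R A + y *\<^sub>R D = 0 \<Longrightarrow> x = 0"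
    and J: "\<And>l t. 0 \<le> l \<Longrightarrow> l \<le> 1 \<Longrightarrow> 0 \<le> t \<Longrightarrow> t < N \<Longrightarrow> t \<noteq> s \<Longrightarrow> c s + l *\<^sub>R D \<noteq> c t"
  obtains r0 where "0 < r0" "r0 \<le> \<rho>"
    "\<And>r. 0 < r \<Longrightarrow> r \<le> r0 \<Longrightarrow> closed_pl N (\<lambda>t. c t + tent r (t - s) *\<^sub>R D)"
    "\<And>r. 0 < r \<Longrightarrow> r \<le> r0 \<Longrightarrow> 
      ambient_isotopic (Some ` c ` {0..<N}) (Some ` (\<lambda>t. c t + tent r (t - s) *\<^sub>R D) ` {0..<N})"
proof -
  have c': "pl 0 N c" "inj_on c {0..<N}" "c 0 = c N" "0 < N" using c by (auto simp: closed_pl_def)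
  define Z where "Z = c ` ({0..N} - {s - \<rho><..<s + \<rho>})"
  have cl: "closed Z" unfolding Z_def
    by (intro compact_imp_closed compact_continuous_image continuous_on_subset [OF pl_continuous_on [OF c'(1)]]
        compact_diff) auto
  have av: "c s + l *\<^sub>R D \<notin> Z" if l: "0 \<le> l" "l \<le> 1" for l
  proof
    assume "c s + l *\<^sub>R D \<in> Z"
    then obtain t where t: "t \<in> {0..N}" "t \<notin> {s - \<rho><..<s + \<rho>}" "c s + l *\<^sub>R D = c t" by (auto simp: Z_def)
    show False using J [OF l, of t] J [OF l, of 0] t \<rho> c' by (cases "t = N") auto
  qed
  obtain r1 where r1: "0 < r1" "\<And>x l. \<bar>x\<bar> \<le> r1 \<Longrightarrow> 0 \<le> l \<Longrightarrow> l \<le> 1 \<Longrightarrow> c s + x *\<^sub>R A + l *\<^sub>R D \<notin> Z"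
    using thin_segment_avoids [OF cl av] by blast
  have all: "closed_pl N (\<lambda>t. c t + \<theta> *\<^sub>R (tent r (t - s) *\<^sub>R D))"
    if r: "0 < r" "r \<le> min r1 \<rho>" and \<theta>: "0 \<le> \<theta>" "\<theta> \<le> 1" for r \<theta>
  proof -
    have "inj_on (\<lambda>t. c t + (\<theta> * tent r (t - s)) *\<^sub>R D) {0..<N}"
      by (rule finger_inj_on [OF c'(2) r(1), where \<rho> = \<rho> and A = A and Z = Z])
        (use r A indep r1(2) \<theta> in \<open>auto simp: Z_def abs_if split: if_splits\<close>)
    moreover have "pl 0 N (\<lambda>t. \<theta> *\<^sub>R (tent r (t - s) *\<^sub>R D))"
      using r by (intro pl_linear [of "\<lambda>x. \<theta> *\<^sub>R x"] pl_scaleR_left pl_tent) (auto simp: linear_iff algebra_simps)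
    moreover have "tent r (0 - s) = 0" "tent r (N - s) = 0" using r \<rho> by (auto intro!: tent_eq_0)
    ultimately show ?thesis using c' by (auto simp: closed_pl_def pl_add)
  qed
  show ?thesis
  proof (rule that [of "min r1 \<rho>"])
    fix r assume r: "0 < r" "r \<le> min r1 \<rho>"
    show "closed_pl N (\<lambda>t. c t + tent r (t - s) *\<^sub>R D)" using all [OF r, of 1] by simp
    show "ambient_isotopic (Some ` c ` {0..<N}) (Some ` (\<lambda>t. c t + tent r (t - s) *\<^sub>R D) ` {0..<N})"
      by (rule closed_pl_linear_isotopy) (use all [OF r] r in \<open>auto intro: pl_scaleR_left pl_tent\<close>)
  qed (use r1 \<rho> in auto)
qed

lemma bump_perturbation:
  fixes c :: "real \<Rightarrow> real^3" and h :: "real \<Rightarrow> real"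
  assumes c: "closed_pl N c" and h: "pl 0 N h" "h 0 = h N"
  obtains e where "0 < e" "\<And>w. norm w < e \<Longrightarrow> closed_pl N (\<lambda>t. c t + h t *\<^sub>R w)"
    "\<And>w. norm w < e \<Longrightarrow> ambient_isotopic (Some ` c ` {0..<N}) (Some ` (\<lambda>t. c t + h t *\<^sub>R w) ` {0..<N})"
proof -
  have N: "0 < N" using c by (simp add: closed_pl_def)
  obtain k where k: "0 < k" "\<And>s t. s \<in> {0..N} \<Longrightarrow> t \<in> {0..N} \<Longrightarrow> k * circ N s t \<le> norm (c s - c t)"
    using closed_pl_bilipschitz [OF c] by blast
  obtain L where L: "0 \<le> L" "\<And>s t. s \<in> {0..N} \<Longrightarrow> t \<in> {0..N} \<Longrightarrow> norm (h s - h t) \<le> L * circ N s t"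
    using pl_circ_Lipschitz [OF h N] by blast
  define e where "e = k / (6 * (L + 1))"
  have dd: "norm (h s *\<^sub>R w - h t *\<^sub>R w) \<le> k/6 * circ N s t"
    if w: "norm w < e" and st: "s \<in> {0..N}" "t \<in> {0..N}" for w :: "real^3" and s t
  proof -
    have c0: "0 \<le> circ N s t" using st by (auto simp: circ_def)
    have "norm (h s *\<^sub>R w - h t *\<^sub>R w) = norm (h s - h t) * norm w" by (simp flip: scaleR_diff_left)
    also have "\<dots> \<le> (L * circ N s t) * e" using L(2) [OF st] w c0 L by (intro mult_mono) auto
    also have "\<dots> = (L * e) * circ N s t" by simp
    also have "\<dots> \<le> k/6 * circ N s t" using c0 k L by (intro mult_right_mono) (auto simp: e_def field_simps)
    finally show ?thesis .
  qed
  show ?thesis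
  proof (rule that [of e])
    show "0 < e" using k L by (simp add: e_def)
    fix w :: "real^3" assume w: "norm w < e"
    show "closed_pl N (\<lambda>t. c t + h t *\<^sub>R w)"
      "ambient_isotopic (Some ` c ` {0..<N}) (Some ` (\<lambda>t. c t + h t *\<^sub>R w) ` {0..<N})"
      using closed_pl_perturbation [OF c k pl_scaleR_left [OF h(1)] _ dd [OF w]] h(2) by auto
  qed
qed

section \<open>Removing the crossings of an edge with a simple arc\<close>

definition pr :: "real^3 \<Rightarrow> complex" where
  "pr v = Complex (v $ 2) (v $ 3)"

text \<open>The determinant of two plane vectors. That it is nonzero expresses both that a corner is
  genuine and that a crossing is transversal.\<close>

definition cr :: "complex \<Rightarrow> complex \<Rightarrow> real" where
  "cr a b = Re a * Im b - Im a * Re b"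

lemma linear_pr: "linear pr"
  by (rule linearI) (auto simp: pr_def complex_eq_iff)

lemma pr_add: "pr (v + w) = pr v + pr w" and pr_diff: "pr (v - w) = pr v - pr w"
  and pr_scale: "pr (x *\<^sub>R v) = x *\<^sub>R pr v"
  by (auto simp: pr_def complex_eq_iff)

lemma pr_eq_imp: "pr v = pr w \<Longrightarrow> v = w + axis 1 (v $ 1 - w $ 1)"
  by (auto simp: pr_def vec_eq_iff forall_3 axis_def)

lemma cr_nonzero_imp: "cr a b \<noteq> 0 \<Longrightarrow> a \<noteq> 0" "cr a b \<noteq> 0 \<Longrightarrow> b \<noteq> 0"
  by (auto simp: cr_def)

lemma cr_indep:
  assumes "cr a b \<noteq> 0" "x *\<^sub>R a + y *\<^sub>R b = 0" shows "x = 0" "y = 0"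
proof -
  have "x * Re a + y * Re b = 0" "x * Im a + y * Im b = 0"
    using assms(2) by (auto simp: complex_eq_iff)
  then have "x * cr a b = 0" "y * cr a b = 0" unfolding cr_def by algebra+
  then show "x = 0" "y = 0" using assms(1) by auto
qed

text \<open>Cramer's rule.\<close>

lemma cr_decompose:
  assumes "cr a g \<noteq> 0"
  shows "f = (cr f g / cr a g) *\<^sub>R a + (cr a f / cr a g) *\<^sub>R g"
proof -
  have "cr a g * Re f = cr f g * Re a + cr a f * Re g" "cr a g * Im f = cr f g * Im a + cr a f * Im g"
    by (auto simp: cr_def algebra_simps)
  then show ?thesis using assms by (auto simp: complex_eq_iff field_simps)
qed

lemma cr_comb: "cr (a + k *\<^sub>R g) (\<alpha> *\<^sub>R a + \<beta> *\<^sub>R g) = (\<beta> - k * \<alpha>) * cr a g"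
  by (simp add: cr_def algebra_simps)

lemma cr_self [simp]: "cr a a = 0" and cr_swap: "cr b a = - cr a b"
  by (auto simp: cr_def)

lemma cr_scale: "cr (x *\<^sub>R a) b = x * cr a b" "cr a (x *\<^sub>R b) = x * cr a b"
  by (auto simp: cr_def algebra_simps)

lemma right_vel_tent:
  assumes r: "0 < r"
  shows "s - r \<le> t \<Longrightarrow> t < s \<Longrightarrow> right_vel (\<lambda>t. tent r (t - s)) t (1 / r)"
    "s \<le> t \<Longrightarrow> t < s + r \<Longrightarrow> right_vel (\<lambda>t. tent r (t - s)) t (- 1 / r)"
    "s + r \<le> t \<Longrightarrow> right_vel (\<lambda>t. tent r (t - s)) t 0"
  unfolding right_vel_def using r
  by (intro exI [of _ "s - t"] exI [of _ "s + r - t"] exI [of _ "1::real"];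
      auto simp: tent_eq tent_eq_0 field_simps)+

lemma left_vel_tent:
  assumes r: "0 < r"
  shows "s < t \<Longrightarrow> t \<le> s + r \<Longrightarrow> left_vel (\<lambda>t. tent r (t - s)) t (- 1 / r)"
    "s - r < t \<Longrightarrow> t \<le> s \<Longrightarrow> left_vel (\<lambda>t. tent r (t - s)) t (1 / r)"
    "t \<le> s - r \<Longrightarrow> left_vel (\<lambda>t. tent r (t - s)) t 0"
  unfolding left_vel_def using r
  by (intro exI [of _ "t - s"] exI [of _ "t - (s - r)"] exI [of _ "1::real"];
      auto simp: tent_eq tent_eq_0 field_simps)+

text \<open>In a snake, the piece \<open>T\<close> of the curve during \<open>{0..m}\<close> has a simple projection already, and the
  piece \<open>X\<close> during \<open>{m..m + 1}\<close> is to be made disjoint from it. The set \<open>B\<close> contains the vertex times.\<close>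

definition meets :: "real \<Rightarrow> (real \<Rightarrow> real^3) \<Rightarrow> real set" where
  "meets m c = {s \<in> {m<..m+1}. \<exists>t\<in>{0..m}. pr (c s) = pr (c t)}"

text \<open>Interior vertices have to be genuine corners so that the prolongation of an edge beyond
  its vertex leaves the curve.\<close>

definition cornered :: "real set \<Rightarrow> real \<Rightarrow> (real \<Rightarrow> real^3) \<Rightarrow> bool" where
  "cornered B M c \<longleftrightarrow> finite B \<and> {0, M} \<subseteq> B \<and> B \<subseteq> {0..M} \<and>
    (\<forall>p q. 0 \<le> p \<and> p \<le> q \<and> q \<le> M \<and> {p<..<q} \<inter> B = {} \<longrightarrow> lin p q c) \<and>
    (\<forall>b\<in>B. 0 < b \<and> b < M \<longrightarrow> (\<exists>f g. left_vel (\<lambda>t. pr (c t)) b f \<and> right_vel (\<lambda>t. pr (c t)) b g \<and> cr f g \<noteq> 0))"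

text \<open>The last three clauses control the rest of the knot. It projects to the arc at finitely
  many times only and never to a vertex of the arc. At the base point the closing edge forms a
  corner with the first edge: it replaces the missing earlier edge when a finger runs off the
  beginning of the arc.\<close>

definition snake :: "real \<Rightarrow> real \<Rightarrow> (real \<Rightarrow> real^3) \<Rightarrow> real set \<Rightarrow> bool" where
  "snake N m c B \<longleftrightarrow> closed_pl N c \<and> 0 \<le> m \<and> m + 1 < N \<and> cornered B (m + 1) c \<and> m \<in> B \<and>
    inj_on (\<lambda>t. pr (c t)) {0..m} \<and> inj_on (\<lambda>t. pr (c t)) {m..m+1} \<and>
    finite (meets m c) \<and>
    (\<forall>s\<in>{m<..m+1}. \<forall>t\<in>{0..m}. pr (c s) = pr (c t) \<longrightarrow> s \<notin> B \<and> t \<notin> B \<and>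
      (\<exists>a g. right_vel (\<lambda>t. pr (c t)) s a \<and> right_vel (\<lambda>t. pr (c t)) t g \<and> cr a g \<noteq> 0)) \<and>
    finite {s \<in> {m+1<..<N}. pr (c s) \<in> (\<lambda>t. pr (c t)) ` {0..m}} \<and>
    (\<forall>b\<in>B \<inter> {0..m}. \<forall>s\<in>{m+1<..<N}. pr (c s) \<noteq> pr (c b)) \<and>
    (0 < m \<longrightarrow> (\<exists>e g. left_vel (\<lambda>t. pr (c t)) N e \<and> right_vel (\<lambda>t. pr (c t)) 0 g \<and> cr e g \<noteq> 0))"

lemma finite_gap:
  fixes x :: real
  assumes "finite B" obtains e where "0 < e" "\<And>b. b \<in> B \<Longrightarrow> b \<noteq> x \<Longrightarrow> e \<le> \<bar>b - x\<bar>"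
proof -
  have "finite ((\<lambda>b. \<bar>b - x\<bar>) ` (B - {x}))" using assms by simp
  define e where "e = Min (insert 1 ((\<lambda>b. \<bar>b - x\<bar>) ` (B - {x})))"
  have "0 < e" unfolding e_def using assms by (subst Min_gr_iff) auto
  moreover have "e \<le> \<bar>b - x\<bar>" if "b \<in> B" "b \<noteq> x" for b
    unfolding e_def using that assms by (intro Min_le) auto
  ultimately show ?thesis by (rule that)
qed

text \<open>No crossing lies before \<open>t0\<close> on the arc, so a finger can follow the edge of
  the arc back to its vertex \<open>u\<close> without meeting the new piece, and go a little
  farther. Behind \<open>u\<close> it crosses the preceding edge once or, if \<open>u = 0\<close>,
  nothing of the arc. In the first case the crossing has passed a vertex, which is the progress that
  the induction needs.\<close>

lemma push_step:
  assumes sn: "snake N m c B"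
    and s0: "s0 \<in> {m<..m+1}" and t0: "t0 \<in> {0..m}" and st0: "pr (c s0) = pr (c t0)"
    and least: "\<forall>s\<in>{m<..m+1}. \<forall>t\<in>{0..m}. pr (c s) = pr (c t) \<longrightarrow> t0 \<le> t"
  obtains c' B' where "snake N m c' B'" "\<And>t. t \<notin> {m<..<m+1} \<Longrightarrow> c' t = c t"
    "ambient_isotopic (Some ` c ` {0..<N}) (Some ` c' ` {0..<N})"
    "B' \<inter> {0..m} = B \<inter> {0..m}"
    "meets m c' \<subseteq> meets m c - {s0} \<or>
      (\<exists>s' t'. s' \<in> {m<..m+1} \<and> t' \<in> {0..m} \<and> pr (c' s') = pr (c' t') \<and> t' < t0 \<and>
        meets m c' \<subseteq> insert s' (meets m c - {s0}) \<and> (\<exists>b\<in>B. t' < b \<and> b < t0) \<and>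
        (\<forall>s\<in>{m<..m+1}. \<forall>t\<in>{0..m}. pr (c' s) = pr (c' t) \<longrightarrow> t' \<le> t))"
proof -
  define \<sigma> where "\<sigma> = (\<lambda>t. pr (c t))"
  have cl: "closed_pl N c" and m0: "0 \<le> m" and mN: "m + 1 < N" and co: "cornered B (m + 1) c" and mB: "m \<in> B"
    and injT: "inj_on \<sigma> {0..m}" and injX: "inj_on \<sigma> {m..m+1}" and finC: "finite (meets m c)"
    and cross: "\<And>s t. s \<in> {m<..m+1} \<Longrightarrow> t \<in> {0..m} \<Longrightarrow> \<sigma> s = \<sigma> t \<Longrightarrow> s \<notin> B \<and> t \<notin> B \<and>
      (\<exists>a g. right_vel \<sigma> s a \<and> right_vel \<sigma> t g \<and> cr a g \<noteq> 0)"
    and finR: "finite {s \<in> {m+1<..<N}. \<sigma> s \<in> \<sigma> ` {0..m}}"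
    and BR: "\<And>b s. b \<in> B \<Longrightarrow> b \<le> m \<Longrightarrow> s \<in> {m+1<..<N} \<Longrightarrow> \<sigma> s \<noteq> \<sigma> b"
    and cE: "0 < m \<Longrightarrow> \<exists>e g. left_vel \<sigma> N e \<and> right_vel \<sigma> 0 g \<and> cr e g \<noteq> 0"
    using sn unfolding snake_def \<sigma>_def cornered_def by auto
  have finB: "finite B" and B0: "0 \<in> B" "m + 1 \<in> B" "B \<subseteq> {0..m+1}"
    and Blin: "\<And>p q. 0 \<le> p \<Longrightarrow> p \<le> q \<Longrightarrow> q \<le> m + 1 \<Longrightarrow> {p<..<q} \<inter> B = {} \<Longrightarrow> lin p q c"
    and Bcor: "\<And>b. b \<in> B \<Longrightarrow> 0 < b \<Longrightarrow> b < m + 1 \<Longrightarrow> \<exists>f g. left_vel \<sigma> b f \<and> right_vel \<sigma> b g \<and> cr f g \<noteq> 0"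
    using co unfolding cornered_def \<sigma>_def by auto
  have plc: "pl 0 N c" and cN: "c 0 = c N" and injc: "inj_on c {0..<N}"
    using cl by (auto simp: closed_pl_def)
  have pl\<sigma>: "pl 0 N \<sigma>" unfolding \<sigma>_def by (rule pl_linear [OF linear_pr plc])
  have \<sigma>N: "\<sigma> N = \<sigma> 0" using cN by (simp add: \<sigma>_def)
  have st: "\<sigma> s0 = \<sigma> t0" using st0 by (simp add: \<sigma>_def)
  have s0B: "s0 \<notin> B" and t0B: "t0 \<notin> B" using cross [OF s0 t0 st] by auto
  have s0': "m < s0" "s0 < m + 1" using s0 s0B B0 by (auto simp: less_le)
  have t0': "0 < t0" "t0 < m" using t0 t0B B0 mB by (auto simp: less_le)
  obtain \<rho> where \<rho>: "0 < \<rho>" "\<And>b. b \<in> B \<Longrightarrow> \<rho> \<le> \<bar>b - s0\<bar>"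
    using finite_gap [OF finB, of s0] s0B by metis
  have \<rho>m: "m \<le> s0 - \<rho>" "s0 + \<rho> \<le> m + 1" using \<rho>(2) [OF mB] \<rho>(2) [OF B0(2)] s0' by auto
  obtain A where A: "\<And>x. \<bar>x\<bar> \<le> \<rho> \<Longrightarrow> c (s0 + x) = c s0 + x *\<^sub>R A"
  proof -
    have "lin (s0 - \<rho>) (s0 + \<rho>) c"
    proof (rule Blin)
      show "{s0 - \<rho><..<s0 + \<rho>} \<inter> B = {}" using \<rho>(2) by (fastforce simp: abs_le_iff)
    qed (use \<rho>m \<rho> m0 in auto)
    then obtain p v where "\<forall>t\<in>{s0 - \<rho>..s0 + \<rho>}. c t = p + t *\<^sub>R v" by (auto simp: lin_def)
    then have "c (s0 + x) = c s0 + x *\<^sub>R v" if "\<bar>x\<bar> \<le> \<rho>" for x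
      using that \<rho>(1) by (simp add: algebra_simps abs_le_iff)
    then show ?thesis using that by blast
  qed
  define u where "u = Max {b \<in> B. b < t0}"
  define v where "v = Min {b \<in> B. t0 < b}"
  have "u \<in> {b \<in> B. b < t0}" unfolding u_def using finB B0 t0' by (intro Max_in) auto
  then have u: "u \<in> B" "u < t0" "0 \<le> u" using B0 by auto
  have "v \<in> {b \<in> B. t0 < b}" unfolding v_def using finB mB t0' by (intro Min_in) auto
  then have v: "v \<in> B" "t0 < v" by auto
  have vm: "v \<le> m" unfolding v_def using finB mB t0' by (intro Min_le) auto
  have uv: "b \<notin> {u<..<v}" if "b \<in> B" for b
  proof
    assume b: "b \<in> {u<..<v}"
    show False
    proof (cases "b < t0")
      case True
      then have "b \<le> u" unfolding u_def using finB that by (intro Max_ge) auto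
      then show ?thesis using b by auto
    next
      case False
      then have "t0 < b" using that t0B by (cases "b = t0") auto
      then have "v \<le> b" unfolding v_def using finB that by (intro Min_le) auto
      then show ?thesis using b by auto
    qed
  qed
  obtain G where G: "\<And>t. u \<le> t \<Longrightarrow> t \<le> v \<Longrightarrow> c t = c t0 + (t - t0) *\<^sub>R G"
  proof -
    have "lin u v c" by (rule Blin) (use u v vm uv in auto)
    then obtain p w where "\<forall>t\<in>{u..v}. c t = p + t *\<^sub>R w" by (auto simp: lin_def)
    then have "c t = c t0 + (t - t0) *\<^sub>R w" if "u \<le> t" "t \<le> v" for t
      using that u v by (simp add: algebra_simps)
    then show ?thesis using that by blast
  qed
  define a where "a = pr A"
  define g where "g = pr G"
  define len where "len = t0 - u"
  have len: "0 < len" using u by (simp add: len_def)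
  have \<sigma>A: "\<sigma> (s0 + x) = \<sigma> s0 + x *\<^sub>R a" if "\<bar>x\<bar> \<le> \<rho>" for x
    using A [OF that] by (simp add: \<sigma>_def a_def pr_add pr_scale)
  have \<sigma>G: "\<sigma> t = \<sigma> t0 + (t - t0) *\<^sub>R g" if "u \<le> t" "t \<le> v" for t
    using G [OF that] by (simp add: \<sigma>_def g_def pr_add pr_scale)
  have \<sigma>u: "\<sigma> u = \<sigma> t0 - len *\<^sub>R g" using \<sigma>G [of u] u v by (simp add: len_def algebra_simps)
  have va: "right_vel \<sigma> s0 a" unfolding right_vel_def using \<rho> \<sigma>A by (intro exI [of _ \<rho>]) auto
  have vgu: "right_vel \<sigma> t g" if "u \<le> t" "t < v" for t
    unfolding right_vel_def
  proof (intro exI [of _ "v - t"] conjI ballI)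
    fix x assume "x \<in> {0..v - t}"
    then have 1: "\<sigma> (t + x) = \<sigma> t0 + (t + x - t0) *\<^sub>R g" by (intro \<sigma>G) (use that in auto)
    have 2: "\<sigma> t = \<sigma> t0 + (t - t0) *\<^sub>R g" by (intro \<sigma>G) (use that in auto)
    show "\<sigma> (t + x) = \<sigma> t + x *\<^sub>R g" unfolding 1 2 by (simp add: algebra_simps)
  qed (use that in simp)
  have vg: "right_vel \<sigma> t0 g" using vgu u v by simp
  have ag: "cr a g \<noteq> 0"
    using cross [OF s0 t0 st] right_vel_unique va vg by metis
  have g0: "g \<noteq> 0" using cr_nonzero_imp ag by blast
  have injX': "s = t" if "\<sigma> s = \<sigma> t" "s \<in> {m..m+1}" "t \<in> {m..m+1}" for s t
    using inj_onD [OF injX] that by blast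
  have injT': "s = t" if "\<sigma> s = \<sigma> t" "s \<in> {0..m}" "t \<in> {0..m}" for s t
    using inj_onD [OF injT] that by blast
  have least': "t0 \<le> t" if "\<sigma> s = \<sigma> t" "s \<in> {m<..m+1}" "t \<in> {0..m}" for s t
    using least that by (simp add: \<sigma>_def)
  txt \<open>Just beyond the vertex \<open>\<sigma> u\<close>, the line through the edge of \<open>T\<close> is free from the diagram.\<close>
  have "\<exists>\<epsilon> f. 0 < \<epsilon> \<and> (0 < u \<longrightarrow> \<epsilon> \<le> u \<and> cr f g \<noteq> 0 \<and> {u - \<epsilon><..<u} \<inter> B = {} \<and>
      (\<forall>x. 0 \<le> x \<and> x \<le> \<epsilon> \<longrightarrow> \<sigma> (u - x) = \<sigma> u - x *\<^sub>R f)) \<and>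
      (u = 0 \<longrightarrow> \<epsilon> < N - (m + 1) \<and> cr f g \<noteq> 0 \<and> (\<forall>x. 0 \<le> x \<and> x \<le> \<epsilon> \<longrightarrow> \<sigma> (N - x) = \<sigma> u - x *\<^sub>R f))"
  proof (cases "0 < u")
    case True
    have "u < m + 1" using u t0' by auto
    then obtain f g' where fg: "left_vel \<sigma> u f" "right_vel \<sigma> u g'" "cr f g' \<noteq> 0" using Bcor u True by blast
    have "right_vel \<sigma> u g" using vgu u v by simp
    then have "g' = g" using fg(2) right_vel_unique by blast
    obtain e1 where e1: "0 < e1" "\<And>b. b \<in> B \<Longrightarrow> b \<noteq> u \<Longrightarrow> e1 \<le> \<bar>b - u\<bar>"
      using finite_gap [OF finB] by blast
    obtain e where e: "0 < e" "e \<le> min e1 u" "\<And>x. 0 \<le> x \<Longrightarrow> x \<le> e \<Longrightarrow> \<sigma> (u - x) = \<sigma> u - x *\<^sub>R f"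
      using left_velE [OF fg(1), of "min e1 u"] e1 True by auto
    have "{u - e<..<u} \<inter> B = {}" using e1(2) e(2) by fastforce
    then show ?thesis using True e fg(3) \<open>g' = g\<close> by (intro exI [of _ e] exI [of _ f]) auto
  next
    case False
    then have u0: "u = 0" using u by simp
    have "0 < m" using t0' by auto
    then obtain f g' where fg: "left_vel \<sigma> N f" "right_vel \<sigma> 0 g'" "cr f g' \<noteq> 0" using cE by blast
    have "right_vel \<sigma> 0 g" using vgu [of 0] u v u0 by simp
    then have "g' = g" using fg(2) right_vel_unique by blast
    obtain e where e: "0 < e" "e \<le> (N - (m + 1)) / 2" "\<And>x. 0 \<le> x \<Longrightarrow> x \<le> e \<Longrightarrow> \<sigma> (N - x) = \<sigma> N - x *\<^sub>R f"
      using left_velE [OF fg(1), of "(N - (m + 1)) / 2"] mN by auto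
    then show ?thesis using u0 fg(3) \<open>g' = g\<close> mN \<sigma>N by (intro exI [of _ e] exI [of _ f]) auto
  qed
  then obtain \<epsilon> f where \<epsilon>: "0 < \<epsilon>" and fg: "cr f g \<noteq> 0"
    and \<epsilon>1: "0 < u \<Longrightarrow> \<epsilon> \<le> u" "0 < u \<Longrightarrow> {u - \<epsilon><..<u} \<inter> B = {}"
      "\<And>x. 0 < u \<Longrightarrow> 0 \<le> x \<Longrightarrow> x \<le> \<epsilon> \<Longrightarrow> \<sigma> (u - x) = \<sigma> u - x *\<^sub>R f"
    and \<epsilon>2: "u = 0 \<Longrightarrow> \<epsilon> < N - (m + 1)" "\<And>x. u = 0 \<Longrightarrow> 0 \<le> x \<Longrightarrow> x \<le> \<epsilon> \<Longrightarrow> \<sigma> (N - x) = \<sigma> u - x *\<^sub>R f"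
    using u(3) by (cases "u = 0") auto
  \<comment> \<open>The times on the two edges meeting at \<open>\<sigma> u\<close>, on the incoming
    one only up to \<open>\<epsilon>\<close>. They are read cyclically: for \<open>u = 0\<close> the
    incoming edge is the closing one. The values \<open>-1\<close> and \<open>N + 1\<close> make the
    set open around \<open>0\<close> and \<open>N\<close>.\<close>
  define near where "near = (if 0 < u then {u - \<epsilon><..<v} else {-1<..<v} \<union> {N - \<epsilon><..<N + 1})"
  have far: "\<sigma> t \<noteq> \<sigma> u" if t: "t \<in> {0..N} - near" for t
  proof
    assume eq: "\<sigma> t = \<sigma> u"
    consider "t \<in> {0..m}" | "t \<in> {m<..m+1}" | "t \<in> {m+1<..<N}" | "t = N" using t by fastforce
    then show False
    proof cases
      case 1
      then have "t = u" using injT' [OF eq] u t0 by auto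
      then show False using t u v \<epsilon> by (auto simp: near_def split: if_splits)
    next
      case 2
      then show False using cross [OF 2 _ eq] u t0' by auto
    next
      case 3
      then show False using BR [OF u(1) _ 3] eq u t0' by auto
    next
      case 4
      then have "\<sigma> 0 = \<sigma> u" using eq \<sigma>N by simp
      then have "u = 0" using injT' [of 0 u] u t0' by auto
      then show False using t 4 \<epsilon> by (auto simp: near_def)
    qed
  qed
  have "closed (\<sigma> ` ({0..N} - near))"
    by (intro compact_imp_closed compact_continuous_image continuous_on_subset [OF pl_continuous_on [OF pl\<sigma>]]
        compact_diff) (auto simp: near_def)
  then obtain d where d: "0 < d" "ball (\<sigma> u) d \<inter> \<sigma> ` ({0..N} - near) = {}"
  proof -
    assume c1: "closed (\<sigma> ` ({0..N} - near))"
    have "\<sigma> u \<in> - (\<sigma> ` ({0..N} - near))" using far by force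
    moreover have "open (- (\<sigma> ` ({0..N} - near)))" using c1 by (simp add: open_Compl)
    ultimately obtain d where "0 < d" "ball (\<sigma> u) d \<subseteq> - (\<sigma> ` ({0..N} - near))"
      by (meson openE)
    then show ?thesis using that [of d] by auto
  qed
  \<comment> \<open>Half the radius of the free ball in units of \<open>g\<close>. Prolonged by at
    most \<open>\<eta>\<close> beyond \<open>\<sigma> u\<close>, the edge stays away from everything
    far by the choice of the ball, and from the two edges at \<open>\<sigma> u\<close> because they
    form a corner.\<close>
  define \<eta> where "\<eta> = d / (2 * norm g)"
  have \<eta>: "0 < \<eta>" using d g0 by (simp add: \<eta>_def)
  have beyond: "\<sigma> t \<noteq> \<sigma> u - y *\<^sub>R g" if y: "0 < y" "y \<le> \<eta>" and t: "0 \<le> t" "t < N" for t y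
  proof
    assume eq: "\<sigma> t = \<sigma> u - y *\<^sub>R g"
    have "norm (y *\<^sub>R g) \<le> \<eta> * norm g" using y by (simp add: mult_right_mono)
    also have "\<dots> < d" using d g0 by (simp add: \<eta>_def)
    finally have "\<sigma> t \<in> ball (\<sigma> u) d" using eq by (simp add: dist_norm)
    then have tn: "t \<in> near" using d(2) t by fastforce
    show False
    proof (cases "u \<le> t \<and> t \<le> v")
      case True
      then have "(t - u + y) *\<^sub>R g = 0" using eq \<sigma>G [of t] \<sigma>u by (simp add: algebra_simps len_def)
      then show False using g0 True y by simp
    next
      case False
      have "\<exists>x. 0 \<le> x \<and> \<sigma> t = \<sigma> u - x *\<^sub>R f"
      proof (cases "0 < u")
        case True
        then have "u - \<epsilon> < t" "t < u" using tn False by (auto simp: near_def)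
        then show ?thesis using \<epsilon>1(3) [OF True, of "u - t"] by (intro exI [of _ "u - t"]) auto
      next
        case u0: False
        then have "N - \<epsilon> < t" "u = 0" using tn False u t by (auto simp: near_def)
        then show ?thesis using \<epsilon>2(2) [of "N - t"] t by (intro exI [of _ "N - t"]) auto
      qed
      then obtain x where "\<sigma> t = \<sigma> u - x *\<^sub>R f" by blast
      then have "x *\<^sub>R f + (- y) *\<^sub>R g = 0" using eq by (simp add: algebra_simps)
      from cr_indep(2) [OF fg this] show False using y by simp
    qed
  qed
  \<comment> \<open>The height of the new piece relative to the arc at the crossing; its sign tells
    which of them is on top.\<close>
  define \<Delta> where "\<Delta> = c s0 $ 1 - c t0 $ 1"
  have cs0: "c s0 = c t0 + axis 1 \<Delta>" unfolding \<Delta>_def by (rule pr_eq_imp [OF st0])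
  have \<Delta>0: "\<Delta> \<noteq> 0"
  proof
    assume "\<Delta> = 0"
    then have "c s0 = c t0" using cs0 by (simp add: axis_def vec_eq_iff)
    then have "s0 = t0" using inj_onD [OF injc] s0' t0' mN by auto
    then show False using s0' t0' by simp
  qed
  \<comment> \<open>Following \<open>G\<close> in space would keep the height above the edge of the
    arc equal to \<open>\<Delta>\<close>. The additional \<open>k * \<Delta>\<close> with
    \<open>k \<ge> 0\<close> only enlarges this difference, so \<open>k\<close> is a free parameter
    for avoiding the rest of the knot.\<close>
  define DD where "DD = (\<lambda>k. (- (len + \<eta>)) *\<^sub>R G + axis 1 (k * \<Delta>))"
  have prDD: "pr (DD k) = (- (len + \<eta>)) *\<^sub>R g" for k
    by (simp add: DD_def g_def pr_add pr_scale) (simp add: pr_def axis_def complex_eq_iff)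
  have DD1: "DD k $ 1 = - (len + \<eta>) * G $ 1 + k * \<Delta>" for k by (simp add: DD_def axis_def)
  define F where "F = {s \<in> {m+1<..<N}. \<sigma> s \<in> \<sigma> ` {0..m}}"
  \<comment> \<open>Each \<open>t\<close> in \<open>F\<close> spoils at most one \<open>k\<close>:
    the projection determines \<open>l\<close>, which is nonzero, and then the height determines
    \<open>k\<close>. Hence some \<open>k\<close> in \<open>{0..1}\<close> suits all of
    them.\<close>
  define bad where "bad = (\<lambda>t. {k. \<exists>l. c s0 + l *\<^sub>R DD k = c t})"
  have "finite (bad t)" if t: "t \<in> F" for t
  proof -
    have tN: "0 \<le> t" "t < N" "t \<noteq> s0" using t m0 s0' by (auto simp: F_def)
    have "k = k'" if k: "k \<in> bad t" "k' \<in> bad t" for k k'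
    proof -
      obtain l l' where l: "c s0 + l *\<^sub>R DD k = c t" "c s0 + l' *\<^sub>R DD k' = c t" using k by (auto simp: bad_def)
      have "pr (l *\<^sub>R DD k) = pr (l' *\<^sub>R DD k')" using l by (metis add_left_cancel)
      then have "l = l' \<or> - len = \<eta>" using g0 by (auto simp: pr_scale prDD)
      then have ll: "l' = l" using len \<eta> by auto
      have "l \<noteq> 0"
      proof
        assume "l = 0"
        then have "c s0 = c t" using l by simp
        then show False using inj_onD [OF injc] s0' mN m0 tN by auto
      qed
      moreover have "l *\<^sub>R DD k = l *\<^sub>R DD k'" using l ll by (metis add_left_cancel)
      ultimately have "DD k $ 1 = DD k' $ 1" by simp
      then show ?thesis using \<Delta>0 by (simp add: DD1)
    qed
    then show ?thesis by (metis finite.simps finite_insert finite_subset insertI1 singletonI subsetI subset_singletonD ex_in_conv)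
  qed
  then have "finite (\<Union>t\<in>F. bad t)" using finR by (auto simp: F_def)
  then have "\<not> {0..1} \<subseteq> (\<Union>t\<in>F. bad t)" using infinite_Icc [of 0 "1::real"] finite_subset by (metis zero_less_one)
  then obtain k where "k \<in> {0..1}" "k \<notin> (\<Union>t\<in>F. bad t)" by blast
  then have k: "0 \<le> k" "\<And>t. t \<in> F \<Longrightarrow> k \<notin> bad t" by auto
  define D where "D = DD k"
  define dd where "dd = (- (len + \<eta>)) *\<^sub>R g"
  have prD: "pr D = dd" by (simp add: D_def prDD dd_def)
  \<comment> \<open>The axis of the finger is at its root, beyond the vertex, or over a point of the
    edge strictly before \<open>t0\<close>.\<close>
  have Jpos: "l = 0 \<or> l * (len + \<eta>) > len \<or> (\<exists>t1. u \<le> t1 \<and> t1 < t0 \<and> \<sigma> s0 + l *\<^sub>R dd = \<sigma> t1 \<and> t1 = t0 - l * (len + \<eta>))"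
    if "0 \<le> l" for l
  proof (cases "l = 0 \<or> l * (len + \<eta>) > len")
    case False
    have "0 \<le> l * (len + \<eta>)" using that len \<eta> by simp
    then have "\<sigma> (t0 - l * (len + \<eta>)) = \<sigma> t0 + (t0 - l * (len + \<eta>) - t0) *\<^sub>R g"
      using False v by (intro \<sigma>G) (auto simp: len_def)
    then have "\<sigma> s0 + l *\<^sub>R dd = \<sigma> (t0 - l * (len + \<eta>))"
      unfolding dd_def st by (simp add: scaleR_left.minus scaleR_left_diff_distrib algebra_simps)
    moreover have "0 < l * (len + \<eta>)" using False that len \<eta> by simp
    ultimately show ?thesis using False by (auto simp: len_def)
  qed auto
  have Jbeyond: "\<sigma> s0 + l *\<^sub>R dd \<noteq> \<sigma> t"
    if "l * (len + \<eta>) > len" "l \<le> 1" "0 \<le> t" "t < N" for l t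
  proof -
    have "l * (len + \<eta>) \<le> 1 * (len + \<eta>)" using that len \<eta> by (intro mult_right_mono) auto
    then have "\<sigma> t \<noteq> \<sigma> u - (l * (len + \<eta>) - len) *\<^sub>R g" using that by (intro beyond) auto
    then show ?thesis by (simp add: st dd_def \<sigma>u algebra_simps)
  qed
  \<comment> \<open>Minimality of \<open>t0\<close> enters here: meeting the new piece over the edge
    would be a crossing with an earlier time on the arc.\<close>
  have J2: "\<sigma> s0 + l *\<^sub>R dd \<noteq> \<sigma> t" if l: "0 \<le> l" "l \<le> 1" and t: "m \<le> t" "t \<le> m + 1" "t \<noteq> s0" for l t
  proof
    assume eq: "\<sigma> s0 + l *\<^sub>R dd = \<sigma> t"
    have "0 \<le> t" "t < N" using t m0 mN by auto
    consider "l = 0" | "l * (len + \<eta>) > len" | t1 where "u \<le> t1" "t1 < t0" "\<sigma> t = \<sigma> t1"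
      using Jpos [OF l(1)] eq by auto
    then show False
    proof cases
      case 1
      then show False using eq injX' [of s0 t] t s0' by auto
    next
      case 2
      then show False using Jbeyond [OF 2 l(2) \<open>0 \<le> t\<close> \<open>t < N\<close>] eq by simp
    next
      case 3
      show False
      proof (cases "t = m")
        case True
        then show False using injT' [OF 3(3)] 3 u t0' by auto
      next
        case False
        then show False using least' [OF 3(3)] 3 u t0' t by auto
      qed
    qed
  qed
  \<comment> \<open>Over the arc the heights differ by \<open>(1 + l * k) * \<Delta>\<close>; every
    other coincidence is excluded in the projection already or by the choice of
    \<open>k\<close>.\<close>
  have J3: "c s0 + l *\<^sub>R D \<noteq> c t" if l: "0 \<le> l" "l \<le> 1" and t: "0 \<le> t" "t < N" "t \<noteq> s0" for l t
  proof
    assume eq: "c s0 + l *\<^sub>R D = c t"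
    then have eq2: "\<sigma> s0 + l *\<^sub>R dd = \<sigma> t" unfolding \<sigma>_def prD [symmetric] by (metis pr_add pr_scale)
    have nm: "\<not> (m \<le> t \<and> t \<le> m + 1)" using J2 [OF l _ _ t(3)] eq2 by blast
    consider "l = 0" | "l * (len + \<eta>) > len" | t1 where "u \<le> t1" "t1 < t0" "\<sigma> t = \<sigma> t1" "t1 = t0 - l * (len + \<eta>)"
      using Jpos [OF l(1)] eq2 by auto
    then show False
    proof cases
      case 1
      then show False using eq inj_onD [OF injc, of s0 t] t s0' m0 mN by auto
    next
      case 2
      then show False using Jbeyond [OF 2 l(2) t(1,2)] eq2 by simp
    next
      case 3
      show False
      proof (cases "t \<le> m")
        case True
        then have tt: "t = t1" using injT' [OF 3(3)] 3 u t0' t by auto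
        have "c t = c t0 + (t - t0) *\<^sub>R G" using G [of t] 3 v tt by auto
        then have "c t $ 1 = c t0 $ 1 - l * (len + \<eta>) * G $ 1" using 3(4) tt by simp
        moreover have "c t $ 1 = c s0 $ 1 + l * (- (len + \<eta>) * G $ 1 + k * \<Delta>)"
          using eq DD1 [of k] by (metis D_def vector_add_component vector_scaleR_component real_scaleR_def)
        ultimately have "\<Delta> * (1 + l * k) = 0" by (simp add: \<Delta>_def algebra_simps)
        moreover have "1 + l * k > 0" using l k(1) by (simp add: add_pos_nonneg)
        ultimately show False using \<Delta>0 by simp
      next
        case False
        then have "t \<in> F" using nm t 3 u t0' by (auto simp: F_def)
        then show False using k(2) eq by (auto simp: bad_def D_def)
      qed
    qed
  qed
  have indepD: "x = 0" if "x *\<^sub>R A + y *\<^sub>R D = 0" for x y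
  proof -
    have "pr (x *\<^sub>R A + y *\<^sub>R D) = 0" using that by (simp add: pr_def complex_eq_iff)
    then have "x *\<^sub>R a + (- (y * (len + \<eta>))) *\<^sub>R g = 0" by (simp add: pr_add pr_scale prD a_def dd_def algebra_simps)
    then show ?thesis by (rule cr_indep(1) [OF ag])
  qed
  have indep2: "x = 0" if "x *\<^sub>R a + y *\<^sub>R dd = 0" for x y
  proof -
    have "x *\<^sub>R a + (- (y * (len + \<eta>))) *\<^sub>R g = 0" using that by (simp add: dd_def algebra_simps)
    then show ?thesis by (rule cr_indep(1) [OF ag])
  qed
  obtain r0 where r0: "0 < r0" "r0 \<le> \<rho> / 2"
    "\<And>r. 0 < r \<Longrightarrow> r \<le> r0 \<Longrightarrow> closed_pl N (\<lambda>t. c t + tent r (t - s0) *\<^sub>R D)"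
    "\<And>r. 0 < r \<Longrightarrow> r \<le> r0 \<Longrightarrow> 
      ambient_isotopic (Some ` c ` {0..<N}) (Some ` (\<lambda>t. c t + tent r (t - s0) *\<^sub>R D) ` {0..<N})"
  proof (rule finger_isotopy [OF cl, of "\<rho>/2" s0 A D])
    show "0 < \<rho>/2" "0 < s0 - \<rho>/2" "s0 + \<rho>/2 < N" using \<rho> \<rho>m m0 mN by auto
    show "c (s0 + x) = c s0 + x *\<^sub>R A" if "\<bar>x\<bar> \<le> \<rho>/2" for x using A that \<rho> by auto
  qed (use indepD J3 in auto)
  \<comment> \<open>The projection of the finger has to stay simple as well. So its width is also
    bounded by the distance to the remainder of the new piece and, through \<open>ZT\<close>, to the
    arc away from the edges at \<open>\<sigma> u\<close>.\<close>
  define ZX where "ZX = \<sigma> ` ({m..m+1} - {s0 - \<rho><..<s0 + \<rho>})"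
  have cont\<sigma>: "continuous_on {p..q} \<sigma>" if "0 \<le> p" "q \<le> N" for p q
    using pl_continuous_on [OF pl_subset [OF pl\<sigma> that]] .
  have clX: "closed ZX" unfolding ZX_def
    by (intro compact_imp_closed compact_continuous_image continuous_on_subset [OF cont\<sigma> [of m "m+1"]] compact_diff)
      (use m0 mN in auto)
  have avX: "\<sigma> s0 + l *\<^sub>R dd \<notin> ZX" if "0 \<le> l" "l \<le> 1" for l
  proof
    assume "\<sigma> s0 + l *\<^sub>R dd \<in> ZX"
    then obtain t where "m \<le> t" "t \<le> m + 1" "t \<noteq> s0" "\<sigma> s0 + l *\<^sub>R dd = \<sigma> t"
      using \<rho>(1) by (auto simp: ZX_def)
    then show False using J2 [OF that, of t] by blast
  qed
  obtain r1 where r1: "0 < r1" "\<And>x l. \<bar>x\<bar> \<le> r1 \<Longrightarrow> 0 \<le> l \<Longrightarrow> l \<le> 1 \<Longrightarrow> \<sigma> s0 + x *\<^sub>R a + l *\<^sub>R dd \<notin> ZX"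
    using thin_segment_avoids [OF clX avX] by blast
  define ZT where "ZT = \<sigma> ` ({0..m} - {(if 0 < u then u - \<epsilon> else -1)<..<v})"
  have clT: "closed ZT" unfolding ZT_def
    by (intro compact_imp_closed compact_continuous_image continuous_on_subset [OF cont\<sigma> [of 0 m]] compact_diff)
      (use m0 mN in auto)
  have avT: "\<sigma> s0 + l *\<^sub>R dd \<notin> ZT" if l: "0 \<le> l" "l \<le> 1" for l
  proof
    assume "\<sigma> s0 + l *\<^sub>R dd \<in> ZT"
    then obtain t where t: "t \<in> {0..m}" "t \<notin> {(if 0 < u then u - \<epsilon> else -1)<..<v}" "\<sigma> s0 + l *\<^sub>R dd = \<sigma> t"
      by (auto simp: ZT_def)
    have tuv: "\<not> (u \<le> t \<and> t \<le> t0)" using t(2) v u \<epsilon> by (auto split: if_splits)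
    consider "l = 0" | "l * (len + \<eta>) > len" | t1 where "u \<le> t1" "t1 < t0" "\<sigma> t = \<sigma> t1"
      using Jpos [OF l(1)] t(3) by auto
    then show False
    proof cases
      case 1
      then have "\<sigma> t = \<sigma> t0" using t(3) st by simp
      then have "t = t0" using injT' t(1) t0 by blast
      then show False using tuv u by auto
    next
      case 2
      then show False using Jbeyond [OF 2 l(2), of t] t(1,3) mN by auto
    next
      case 3
      then have "t1 \<in> {0..m}" using u t0' by auto
      then have "t = t1" using injT' [OF 3(3) t(1)] by blast
      then show False using 3(1,2) tuv by auto
    qed
  qed
  obtain r2 where r2: "0 < r2" "\<And>x l. \<bar>x\<bar> \<le> r2 \<Longrightarrow> 0 \<le> l \<Longrightarrow> l \<le> 1 \<Longrightarrow> \<sigma> s0 + x *\<^sub>R a + l *\<^sub>R dd \<notin> ZT"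
    using thin_segment_avoids [OF clT avT] by blast
  define \<alpha> where "\<alpha> = cr f g / cr a g"
  define \<beta> where "\<beta> = cr a f / cr a g"
  have f: "f = \<alpha> *\<^sub>R a + \<beta> *\<^sub>R g" unfolding \<alpha>_def \<beta>_def by (rule cr_decompose [OF ag])
  have \<alpha>0: "\<alpha> \<noteq> 0" using fg ag by (simp add: \<alpha>_def)
  obtain r4 where r4: "0 < r4" "\<And>s. s \<in> meets m c \<Longrightarrow> s \<noteq> s0 \<Longrightarrow> r4 \<le> \<bar>s - s0\<bar>"
    using finite_gap [OF finC] by blast
  \<comment> \<open>Half of the threshold below which the finger is so narrow that it meets the
    incoming edge at a time less than \<open>\<epsilon>\<close> before \<open>u\<close>, where this
    edge is known to be straight.\<close>
  define r3 where "r3 = \<epsilon> * len * \<bar>\<alpha>\<bar> / (2 * (\<eta> + \<epsilon> * \<bar>\<beta>\<bar>))"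
  have den: "0 < \<eta> + \<epsilon> * \<bar>\<beta>\<bar>" using \<eta> \<epsilon> by (simp add: add_pos_nonneg)
  have r3: "0 < r3" using \<epsilon> len \<alpha>0 den by (simp add: r3_def)
  \<comment> \<open>The bound by \<open>r4\<close> keeps all other crossings of the new piece
    outside the finger.\<close>
  define r where "r = min (min r0 r1) (min (min r2 r3) (r4 / 2))"
  have r: "0 < r" "r \<le> r0" "r \<le> r1" "r \<le> r2" "r \<le> r3" "r < r4"
    using r0 r1 r2 r3 r4 by (auto simp: r_def min_less_iff_disj)
  have r\<rho>: "r < \<rho>" using r r0 \<rho> by auto
  have r3': "r * (\<eta> + \<epsilon> * \<bar>\<beta>\<bar>) < \<epsilon> * len * \<bar>\<alpha>\<bar>"
  proof -
    have "r * (\<eta> + \<epsilon> * \<bar>\<beta>\<bar>) \<le> r3 * (\<eta> + \<epsilon> * \<bar>\<beta>\<bar>)" using r(5) den by (intro mult_right_mono) auto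
    also have "\<dots> = \<epsilon> * len * \<bar>\<alpha>\<bar> / 2" unfolding r3_def using den by (simp add: field_simps)
    also have "\<dots> < \<epsilon> * len * \<bar>\<alpha>\<bar>" using \<epsilon> len \<alpha>0 by simp
    finally show ?thesis .
  qed
  define c' where "c' = (\<lambda>t. c t + tent r (t - s0) *\<^sub>R D)"
  define \<sigma>' where "\<sigma>' = (\<lambda>t. pr (c' t))"
  define B' where "B' = B \<union> {s0 - r, s0, s0 + r}"
  have same: "c' t = c t" if "r \<le> \<bar>t - s0\<bar>" for t using that r by (simp add: c'_def tent_eq_0)
  have same\<sigma>: "\<sigma>' t = \<sigma> t" if "r \<le> \<bar>t - s0\<bar>" for t using same [OF that] by (simp add: \<sigma>'_def \<sigma>_def)
  have \<sigma>': "\<sigma>' t = \<sigma> t + tent r (t - s0) *\<^sub>R dd" for t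
    by (simp add: \<sigma>'_def c'_def pr_add pr_scale prD \<sigma>_def)
  have \<sigma>'_eq: "\<sigma>' = (\<lambda>t. \<sigma> t + tent r (t - s0) *\<^sub>R dd)" using \<sigma>' by auto
  have sT: "\<sigma>' t = \<sigma> t" if "t \<le> m" for t using same\<sigma> that \<rho>m r\<rho> by auto
  have sR: "\<sigma>' t = \<sigma> t" if "m + 1 \<le> t" for t using same\<sigma> that \<rho>m r\<rho> by auto
  have cl': "closed_pl N c'" unfolding c'_def using r r0(3) by auto
  have injT2: "inj_on \<sigma>' {0..m}"
    using injT by (rule inj_on_cong [THEN iffD1, rotated]) (simp add: sT)
  have injX2: "inj_on \<sigma>' {m..m+1}"
  proof -
    have "inj_on (\<lambda>t. \<sigma> t + (1 * tent r (t - s0)) *\<^sub>R dd) {m..m+1}"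
    proof (rule finger_inj_on [OF injX r(1), of \<rho> s0 a dd ZX 1])
      show "\<sigma> t \<in> ZX" if "t \<in> {m..m+1}" "\<rho> \<le> \<bar>t - s0\<bar>" for t
        using that by (auto simp: ZX_def abs_if split: if_splits)
    qed (use r\<rho> \<sigma>A indep2 r1(2) r in auto)
    then show ?thesis unfolding \<sigma>'_eq by simp
  qed
  txt \<open>The new crossing near \<open>\<sigma> u\<close>, if there is one, solves a linear system.\<close>
  define \<kappa> where "\<kappa> = \<beta> + (len + \<eta>) * \<bar>\<alpha>\<bar> / r"
  define y where "y = \<eta> / \<kappa>"
  have "r * (\<eta> + \<epsilon> * \<bar>\<beta>\<bar>) = r * \<eta> + r * \<bar>\<beta>\<bar> * \<epsilon>" "\<epsilon> * len * \<bar>\<alpha>\<bar> = len * \<bar>\<alpha>\<bar> * \<epsilon>"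
    by (auto simp: algebra_simps)
  moreover have "0 < r * \<eta>" using r \<eta> by simp
  ultimately have "r * \<bar>\<beta>\<bar> * \<epsilon> < len * \<bar>\<alpha>\<bar> * \<epsilon>" using r3' by linarith
  then have r\<beta>: "r * \<bar>\<beta>\<bar> < len * \<bar>\<alpha>\<bar>" using \<epsilon> by simp
  have "- (r * \<beta>) \<le> r * \<bar>\<beta>\<bar>" using r by (metis abs_ge_minus_self abs_mult abs_of_pos)
  then have r\<beta>': "0 < r * \<beta> + len * \<bar>\<alpha>\<bar>" using r\<beta> by linarith
  have r\<kappa>: "r * \<kappa> = r * \<beta> + len * \<bar>\<alpha>\<bar> + \<eta> * \<bar>\<alpha>\<bar>" using r(1) by (simp add: \<kappa>_def field_simps)
  have "0 < r * \<kappa>" unfolding r\<kappa> using r\<beta>' \<eta> \<alpha>0 by (simp add: add_pos_nonneg)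
  then have \<kappa>: "0 < \<kappa>" using r by (simp add: zero_less_mult_iff)
  have y0: "0 < y" using \<eta> \<kappa> by (simp add: y_def)
  have y\<epsilon>: "y < \<epsilon>"
  proof -
    have "\<epsilon> * - (r * \<beta>) \<le> \<epsilon> * (r * \<bar>\<beta>\<bar>)" using \<open>- (r * \<beta>) \<le> r * \<bar>\<beta>\<bar>\<close> \<epsilon> by (intro mult_left_mono) auto
    then have "r * \<eta> < \<epsilon> * (r * \<beta> + len * \<bar>\<alpha>\<bar>)" using r3' by (simp add: algebra_simps)
    also have "\<dots> \<le> \<epsilon> * (r * \<kappa>)" unfolding r\<kappa> using \<epsilon> \<eta> by (intro mult_left_mono) auto
    finally have "r * \<eta> < r * (\<epsilon> * \<kappa>)" by (simp add: algebra_simps)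
    then have "\<eta> < \<epsilon> * \<kappa>" using r by simp
    then show ?thesis using \<kappa> by (simp add: y_def field_simps)
  qed
  have yr: "\<bar>\<alpha>\<bar> * y < r"
  proof -
    have "\<bar>\<alpha>\<bar> * \<eta> < r * \<kappa>" unfolding r\<kappa> using r\<beta>' by (simp add: algebra_simps)
    then show ?thesis using \<kappa> by (simp add: y_def field_simps)
  qed
  have yeq: "y * \<kappa> = \<eta>" using \<kappa> by (simp add: y_def)
  \<comment> \<open>Coefficients of \<open>a\<close> and \<open>g\<close> are compared. On the edge
    from \<open>u\<close> to \<open>v\<close> only the tip could solve the equations, but the tip
    lies beyond \<open>u\<close>; on the incoming edge the solution is unique.\<close>
  have main: "0 < u \<and> s = s0 - \<alpha> * y \<and> t = u - y"
    if s: "s \<in> {m<..m+1}" "\<bar>s - s0\<bar> < r" and t: "t \<in> {0..m}" and eq: "\<sigma>' s = \<sigma> t" for s t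
  proof -
    define x where "x = s - s0"
    define \<tau> where "\<tau> = tent r x"
    have \<tau>: "0 \<le> \<tau>" "\<tau> \<le> 1" using tent_nonneg tent_le_1 r by (auto simp: \<tau>_def)
    have x: "\<bar>x\<bar> < r" "s = s0 + x" using s by (auto simp: x_def)
    have e1: "\<sigma> s0 + x *\<^sub>R a + \<tau> *\<^sub>R dd = \<sigma> t"
      using eq \<sigma>A [of x] x r\<rho> by (simp add: \<sigma>' \<tau>_def)
    have "\<sigma> t \<notin> ZT" using r2(2) [of x \<tau>] x r \<tau> e1 by auto
    then have tn: "t \<in> {(if 0 < u then u - \<epsilon> else -1)<..<v}" using t by (auto simp: ZT_def)
    have "\<not> u \<le> t"
    proof
      assume "u \<le> t"
      then have "\<sigma> t = \<sigma> t0 + (t - t0) *\<^sub>R g" using \<sigma>G [of t] tn by auto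
      then have "\<sigma> t0 + (x *\<^sub>R a + \<tau> *\<^sub>R dd) = \<sigma> t0 + (t - t0) *\<^sub>R g" using e1 st by (simp add: add.assoc)
      then have "x *\<^sub>R a + \<tau> *\<^sub>R dd = (t - t0) *\<^sub>R g" by (simp only: add_left_cancel)
      then have "x *\<^sub>R a + (- (\<tau> * (len + \<eta>)) - (t - t0)) *\<^sub>R g = 0"
        by (simp add: dd_def algebra_simps)
      note * = cr_indep [OF ag this]
      then have "\<tau> = 1" by (simp add: \<tau>_def)
      then have "t = u - \<eta>" using *(2) by (simp add: len_def)
      then show False using \<open>u \<le> t\<close> \<eta> by simp
    qed
    then have u0: "0 < u" "u - \<epsilon> < t" "t < u" using tn t by (auto split: if_splits)
    define z where "z = u - t"
    have z: "0 < z" "z \<le> \<epsilon>" "t = u - z" using u0 by (auto simp: z_def)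
    have "\<sigma> t = \<sigma> u - z *\<^sub>R f" using \<epsilon>1(3) [OF u0(1), of z] z by simp
    then have "\<sigma> t0 + (x *\<^sub>R a + \<tau> *\<^sub>R dd) = \<sigma> t0 + (- (len *\<^sub>R g) - z *\<^sub>R f)"
      using e1 st \<sigma>u by (simp add: add.assoc)
    then have "x *\<^sub>R a + \<tau> *\<^sub>R dd = - (len *\<^sub>R g) - z *\<^sub>R (\<alpha> *\<^sub>R a + \<beta> *\<^sub>R g)"
      unfolding f [symmetric] by (simp only: add_left_cancel)
    then have "(x + z * \<alpha>) *\<^sub>R a + (len + z * \<beta> - \<tau> * (len + \<eta>)) *\<^sub>R g = 0"
      by (simp add: dd_def algebra_simps)
    note * = cr_indep [OF ag this]
    then have xz: "x = - \<alpha> * z" by (simp add: algebra_simps)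
    then have "\<bar>x\<bar> = \<bar>\<alpha>\<bar> * z" using z by (simp add: abs_mult)
    then have "\<tau> = 1 - \<bar>\<alpha>\<bar> * z / r" using x r by (simp add: \<tau>_def tent_eq)
    then have "len + z * \<beta> = len + \<eta> - \<bar>\<alpha>\<bar> * z / r * (len + \<eta>)" using *(2) by (simp add: left_diff_distrib)
    then have "z * \<kappa> = \<eta>" unfolding \<kappa>_def by (simp add: algebra_simps)
    then have "z = y" using \<kappa> by (simp add: y_def field_simps)
    then show ?thesis using u0 x xz z by simp
  qed
  have old: "s \<in> meets m c \<and> s \<noteq> s0" if s: "s \<in> {m<..m+1}" "\<not> \<bar>s - s0\<bar> < r" and t: "t \<in> {0..m}" and eq: "\<sigma>' s = \<sigma> t" for s t
    using s t eq same\<sigma> [of s] r by (auto simp: meets_def \<sigma>_def)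
  have meets': "meets m c' = {s \<in> {m<..m+1}. \<exists>t\<in>{0..m}. \<sigma>' s = \<sigma> t}"
  proof -
    have "pr (c' s) = pr (c' t) \<longleftrightarrow> \<sigma>' s = \<sigma> t" if "t \<in> {0..m}" for s t
      using sT [of t] that by (simp add: \<sigma>'_def)
    then show ?thesis unfolding meets_def by blast
  qed
  have msub: "meets m c' \<subseteq> insert (s0 - \<alpha> * y) (meets m c - {s0})"
    unfolding meets' using main old by blast
  have msub0: "meets m c' \<subseteq> meets m c - {s0}" if "u = 0"
    unfolding meets' using main old that by blast
  have new: "\<sigma>' (s0 - \<alpha> * y) = \<sigma> (u - y)" if "0 < u"
  proof -
    have "\<bar>- \<alpha> * y\<bar> < r" using yr y0 by (simp add: abs_mult)
    then have "tent r (- \<alpha> * y) = 1 - \<bar>\<alpha>\<bar> * y / r" using r y0 by (simp add: tent_eq abs_mult)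
    then have 1: "\<sigma>' (s0 - \<alpha> * y) = \<sigma> s0 + (- \<alpha> * y) *\<^sub>R a + (1 - \<bar>\<alpha>\<bar> * y / r) *\<^sub>R dd"
      using \<sigma>A [of "- \<alpha> * y"] \<open>\<bar>- \<alpha> * y\<bar> < r\<close> r\<rho> by (simp add: \<sigma>')
    have "len + y * \<beta> = (1 - \<bar>\<alpha>\<bar> * y / r) * (len + \<eta>)"
      using yeq by (simp add: \<kappa>_def algebra_simps)
    then have 2: "(1 - \<bar>\<alpha>\<bar> * y / r) *\<^sub>R dd = (- (len + y * \<beta>)) *\<^sub>R g"
      unfolding dd_def scaleR_scaleR by (simp only: mult_minus_right)
    have "\<sigma> (u - y) = \<sigma> t0 - len *\<^sub>R g - y *\<^sub>R (\<alpha> *\<^sub>R a + \<beta> *\<^sub>R g)"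
      using \<epsilon>1(3) [OF that, of y] y0 y\<epsilon> \<sigma>u f by simp
    then show ?thesis unfolding 1 2 st by (simp add: algebra_simps)
  qed
  have rv\<sigma>: "right_vel \<sigma> t a" if "s0 - \<rho> \<le> t" "t < s0 + \<rho>" for t
    unfolding right_vel_def
  proof (intro exI [of _ "s0 + \<rho> - t"] conjI ballI)
    fix x assume x: "x \<in> {0..s0 + \<rho> - t}"
    have 1: "\<sigma> t = \<sigma> s0 + (t - s0) *\<^sub>R a"
      using \<sigma>A [of "t - s0"] that by (simp add: abs_le_iff)
    have 2: "\<sigma> (t + x) = \<sigma> s0 + (t + x - s0) *\<^sub>R a"
      using \<sigma>A [of "t + x - s0"] that x by (simp add: abs_le_iff)
    show "\<sigma> (t + x) = \<sigma> t + x *\<^sub>R a" unfolding 1 2 by (simp add: algebra_simps)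
  qed (use that in simp)
  have lv\<sigma>: "left_vel \<sigma> t a" if "s0 - \<rho> < t" "t \<le> s0 + \<rho>" for t
    unfolding left_vel_def
  proof (intro exI [of _ "t - (s0 - \<rho>)"] conjI ballI)
    fix x assume x: "x \<in> {0..t - (s0 - \<rho>)}"
    have 1: "\<sigma> t = \<sigma> s0 + (t - s0) *\<^sub>R a"
      using \<sigma>A [of "t - s0"] that by (simp add: abs_le_iff)
    have 2: "\<sigma> (t - x) = \<sigma> s0 + (t - x - s0) *\<^sub>R a"
      using \<sigma>A [of "t - x - s0"] that x by (simp add: abs_le_iff)
    show "\<sigma> (t - x) = \<sigma> t - x *\<^sub>R a" unfolding 1 2 by (simp add: algebra_simps)
  qed (use that in simp)
  have lin_dd: "linear (\<lambda>x. x *\<^sub>R dd)" by (auto simp: linear_iff algebra_simps)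
  note rvt = right_vel_linear [OF lin_dd right_vel_tent(1) [OF r(1)]]
    right_vel_linear [OF lin_dd right_vel_tent(2) [OF r(1)]] right_vel_linear [OF lin_dd right_vel_tent(3) [OF r(1)]]
  note lvt = left_vel_linear [OF lin_dd left_vel_tent(1) [OF r(1)]]
    left_vel_linear [OF lin_dd left_vel_tent(2) [OF r(1)]] left_vel_linear [OF lin_dd left_vel_tent(3) [OF r(1)]]
  \<comment> \<open>The tent moves the curve by \<open>dd\<close> within time \<open>r\<close>, so
    the flanks of the finger have the velocities \<open>a - K g\<close> and
    \<open>a + K g\<close>.\<close>
  define K where "K = (len + \<eta>) / r"
  have K: "0 < K" using len \<eta> r by (simp add: K_def)
  have Kdd: "(1 / r) *\<^sub>R dd = (- K) *\<^sub>R g" "(- 1 / r) *\<^sub>R dd = K *\<^sub>R g"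
    unfolding dd_def scaleR_minus_left by (auto simp: K_def)
  have rv1: "right_vel \<sigma>' t (a + (- K) *\<^sub>R g)" if "s0 - r \<le> t" "t < s0" for t
    unfolding \<sigma>'_eq Kdd(1) [symmetric] using that r\<rho> \<rho> by (intro right_vel_add rv\<sigma> rvt) auto
  have rv2: "right_vel \<sigma>' t (a + K *\<^sub>R g)" if "s0 \<le> t" "t < s0 + r" for t
    unfolding \<sigma>'_eq Kdd(2) [symmetric] using that r\<rho> \<rho> by (intro right_vel_add rv\<sigma> rvt) auto
  have rv3: "right_vel \<sigma>' (s0 + r) (a + 0 *\<^sub>R dd)"
    unfolding \<sigma>'_eq using r r\<rho> \<rho> by (intro right_vel_add rv\<sigma> rvt) auto
  have lv1: "left_vel \<sigma>' t (a + (- K) *\<^sub>R g)" if "s0 - r < t" "t \<le> s0" for t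
    unfolding \<sigma>'_eq Kdd(1) [symmetric] using that r\<rho> \<rho> by (intro left_vel_add lv\<sigma> lvt) auto
  have lv2: "left_vel \<sigma>' t (a + K *\<^sub>R g)" if "s0 < t" "t \<le> s0 + r" for t
    unfolding \<sigma>'_eq Kdd(2) [symmetric] using that r\<rho> \<rho> by (intro left_vel_add lv\<sigma> lvt) auto
  have lv3: "left_vel \<sigma>' (s0 - r) (a + 0 *\<^sub>R dd)"
    unfolding \<sigma>'_eq using r r\<rho> \<rho> by (intro left_vel_add lv\<sigma> lvt) auto
  have out_r: "right_vel \<sigma>' t w" if "right_vel \<sigma> t w" "r < \<bar>t - s0\<bar>" for t w
  proof (rule right_vel_cong [OF that(1)])
    show "t < t + (\<bar>t - s0\<bar> - r)" using that by simp
    show "\<sigma>' x = \<sigma> x" if "t \<le> x" "x \<le> t + (\<bar>t - s0\<bar> - r)" for x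
      using that \<open>r < \<bar>t - s0\<bar>\<close> r by (intro same\<sigma>) (auto simp: abs_if split: if_splits)
  qed
  have out_l: "left_vel \<sigma>' t w" if "left_vel \<sigma> t w" "r < \<bar>t - s0\<bar>" for t w
  proof (rule left_vel_cong [OF that(1)])
    show "t - (\<bar>t - s0\<bar> - r) < t" using that by simp
    show "\<sigma>' x = \<sigma> x" if "t - (\<bar>t - s0\<bar> - r) \<le> x" "x \<le> t" for x
      using that \<open>r < \<bar>t - s0\<bar>\<close> r by (intro same\<sigma>) (auto simp: abs_if split: if_splits)
  qed
  have B'm: "B' \<inter> {0..m} = B \<inter> {0..m}" using \<rho>m r\<rho> r by (auto simp: B'_def)
  have co': "cornered B' (m + 1) c'"
    unfolding cornered_def
  proof (intro conjI allI impI ballI)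
    show "finite B'" "{0, m + 1} \<subseteq> B'" using finB B0 by (auto simp: B'_def)
    show "B' \<subseteq> {0..m + 1}" using B0 \<rho>m r\<rho> r m0 by (auto simp: B'_def)
    fix p q assume "0 \<le> p \<and> p \<le> q \<and> q \<le> m + 1 \<and> {p<..<q} \<inter> B' = {}"
    then have pq: "0 \<le> p" "p \<le> q" "q \<le> m + 1" "{p<..<q} \<inter> B = {}" "{p<..<q} \<inter> {s0 - r, s0, s0 + r} = {}"
      by (auto simp: B'_def)
    have "linear (\<lambda>x. x *\<^sub>R D)" by (auto simp: linear_iff algebra_simps)
    then show "lin p q c'"
      unfolding c'_def by (intro lin_add Blin pq lin_linear [of "\<lambda>x. x *\<^sub>R D"] lin_tent r(1))
  next
    fix b assume "b \<in> B'" "0 < b \<and> b < m + 1"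
    then consider "b \<in> B" "0 < b" "b < m + 1" | "b = s0 - r" | "b = s0" | "b = s0 + r" by (auto simp: B'_def)
    then have "\<exists>f g. left_vel \<sigma>' b f \<and> right_vel \<sigma>' b g \<and> cr f g \<noteq> 0"
    proof cases
      case 1
      then obtain f g where "left_vel \<sigma> b f" "right_vel \<sigma> b g" "cr f g \<noteq> 0" using Bcor by blast
      moreover have "r < \<bar>b - s0\<bar>" using \<rho>(2) [OF 1(1)] r\<rho> by linarith
      ultimately show ?thesis using out_l out_r by blast
    next
      case 2
      have "cr (a + 0 *\<^sub>R dd) (a + (- K) *\<^sub>R g) \<noteq> 0" using ag K by (simp add: cr_def algebra_simps)
      moreover have "right_vel \<sigma>' b (a + (- K) *\<^sub>R g)" using rv1 [of b] 2 r(1) by simp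
      ultimately show ?thesis using lv3 unfolding 2 by blast
    next
      case 3
      have "cr (a + (- K) *\<^sub>R g) (a + K *\<^sub>R g) = 2 * K * cr a g" by (simp add: cr_def algebra_simps)
      then have "cr (a + (- K) *\<^sub>R g) (a + K *\<^sub>R g) \<noteq> 0" using ag K by simp
      moreover have "left_vel \<sigma>' b (a + (- K) *\<^sub>R g)" using lv1 [of b] 3 r(1) by simp
      moreover have "right_vel \<sigma>' b (a + K *\<^sub>R g)" using rv2 [of b] 3 r(1) by simp
      ultimately show ?thesis by blast
    next
      case 4
      have "cr (a + K *\<^sub>R g) (a + 0 *\<^sub>R dd) \<noteq> 0" using ag K by (simp add: cr_def algebra_simps)
      moreover have "left_vel \<sigma>' b (a + K *\<^sub>R g)" using lv2 [of b] 4 r(1) by simp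
      ultimately show ?thesis using rv3 unfolding 4 by blast
    qed
    then show "\<exists>f g. left_vel (\<lambda>t. pr (c' t)) b f \<and> right_vel (\<lambda>t. pr (c' t)) b g \<and> cr f g \<noteq> 0"
      by (simp add: \<sigma>'_def)
  qed
  have cross': "s \<notin> B' \<and> t \<notin> B' \<and> (\<exists>a g. right_vel \<sigma>' s a \<and> right_vel \<sigma>' t g \<and> cr a g \<noteq> 0)"
    if s: "s \<in> {m<..m+1}" and t: "t \<in> {0..m}" and eq: "\<sigma>' s = \<sigma>' t" for s t
  proof (cases "\<bar>s - s0\<bar> < r")
    case True
    have eq': "\<sigma>' s = \<sigma> t" using eq sT t by auto
    have u0: "0 < u" and sy: "s = s0 - \<alpha> * y" and ty: "t = u - y" using main [OF s True t eq'] by auto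
    have "t \<in> {u - \<epsilon><..<u}" using y0 y\<epsilon> ty by simp
    then have "t \<notin> B" using \<epsilon>1(2) [OF u0] by blast
    then have "t \<notin> B'" using B'm t by blast
    moreover have "s \<notin> B'"
    proof -
      have "s \<notin> B" using \<rho>(2) [of s] True r\<rho> by auto
      moreover have "s \<noteq> s0" using sy \<alpha>0 y0 by auto
      ultimately show ?thesis using True r by (auto simp: B'_def)
    qed
    moreover have "right_vel \<sigma>' t f"
    proof (rule right_vel_cong [of \<sigma> _ _ u])
      show "right_vel \<sigma> t f" unfolding right_vel_def
      proof (intro exI [of _ y] conjI ballI)
        fix x assume x: "x \<in> {0..y}"
        have 1: "\<sigma> (u - y) = \<sigma> u - y *\<^sub>R f" using \<epsilon>1(3) [OF u0, of y] y\<epsilon> y0 by simp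
        have 2: "\<sigma> (u - (y - x)) = \<sigma> u - (y - x) *\<^sub>R f" using \<epsilon>1(3) [OF u0, of "y - x"] y\<epsilon> x by simp
        have 3: "t + x = u - (y - x)" using ty by simp
        show "\<sigma> (t + x) = \<sigma> t + x *\<^sub>R f" unfolding 3 2 unfolding ty 1 by (simp add: algebra_simps)
      qed (use y0 in simp)
    qed (use ty y0 u t0' sT in auto)
    \<comment> \<open>The sign of \<open>\<alpha>\<close> selects the flank that is crossed, and for
      both flanks \<open>cr_comb\<close> yields \<open>\<kappa> * cr a g\<close>; so transversality
      is inherited from the old crossing.\<close>
    moreover have "\<exists>w. right_vel \<sigma>' s w \<and> cr w f \<noteq> 0"
    proof (cases "0 < \<alpha>")
      case True
      then have "s < s0" "s0 - r \<le> s" using sy yr y0 by auto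
      moreover have "cr (a + (- K) *\<^sub>R g) f = \<kappa> * cr a g"
        unfolding f cr_comb using True r by (simp add: \<kappa>_def K_def)
      ultimately show ?thesis using rv1 [of s] \<kappa> ag by (intro exI [of _ "a + (- K) *\<^sub>R g"]) simp
    next
      case False
      then have "\<alpha> < 0" using \<alpha>0 by simp
      then have "s0 \<le> s" "s < s0 + r" using sy yr y0 by (auto simp: mult_nonpos_nonneg)
      moreover have "cr (a + K *\<^sub>R g) f = \<kappa> * cr a g"
        unfolding f cr_comb using \<open>\<alpha> < 0\<close> r by (simp add: \<kappa>_def K_def)
      ultimately show ?thesis using rv2 [of s] \<kappa> ag by (intro exI [of _ "a + K *\<^sub>R g"]) simp
    qed
    ultimately show ?thesis by blast
  next
    case False
    have eq': "\<sigma>' s = \<sigma> t" using eq sT t by auto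
    have sm: "s \<in> meets m c" "s \<noteq> s0" using old [OF s False t eq'] by auto
    have rs: "r < \<bar>s - s0\<bar>" using r4(2) [OF sm] r by linarith
    then have "\<sigma> s = \<sigma> t" using eq' same\<sigma> [of s] by simp
    note * = cross [OF s t this]
    then obtain a' g' where "right_vel \<sigma> s a'" "right_vel \<sigma> t g'" "cr a' g' \<noteq> 0" by blast
    moreover have "r < \<bar>t - s0\<bar>" using t \<rho>m r\<rho> by auto
    moreover have "s \<notin> B'" using * rs r by (auto simp: B'_def)
    moreover have "t \<notin> B'" using * t B'm by blast
    ultimately show ?thesis using out_r rs by blast
  qed
  have finR': "{s \<in> {m+1<..<N}. \<sigma>' s \<in> \<sigma>' ` {0..m}} = {s \<in> {m+1<..<N}. \<sigma> s \<in> \<sigma> ` {0..m}}"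
  proof -
    have "\<sigma>' ` {0..m} = \<sigma> ` {0..m}" using sT by auto
    then show ?thesis using sR by auto
  qed
  have BR': "\<sigma>' s \<noteq> \<sigma>' b" if "b \<in> B' \<inter> {0..m}" "s \<in> {m+1<..<N}" for b s
  proof -
    have "b \<in> B \<inter> {0..m}" using that B'm by simp
    then show ?thesis using BR [of b s] that sT [of b] sR [of s] by auto
  qed
  have cE': "\<exists>e g. left_vel \<sigma>' N e \<and> right_vel \<sigma>' 0 g \<and> cr e g \<noteq> 0" if "0 < m"
  proof -
    have "r < \<bar>N - s0\<bar>" "r < \<bar>0 - s0\<bar>" using \<rho>m r\<rho> mN m0 by auto
    then show ?thesis using cE [OF that] out_l out_r by blast
  qed
  have finC': "finite (meets m c')" using msub finC by (meson finite_Diff finite_insert finite_subset)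
  have P: "pr (c' s) = \<sigma>' s" for s by (simp add: \<sigma>'_def)
  have sn': "snake N m c' B'"
    unfolding snake_def P
  proof (intro conjI ballI impI)
    show "m \<in> B'" using mB by (simp add: B'_def)
    show "finite {s \<in> {m+1<..<N}. \<sigma>' s \<in> \<sigma>' ` {0..m}}" unfolding finR' by (rule finR)
    show "s \<notin> B'" "t \<notin> B'" "\<exists>a g. right_vel \<sigma>' s a \<and> right_vel \<sigma>' t g \<and> cr a g \<noteq> 0"
      if "s \<in> {m<..m+1}" "t \<in> {0..m}" "\<sigma>' s = \<sigma>' t" for s t
      using cross' [OF that] by blast+
    show "\<sigma>' s \<noteq> \<sigma>' b" if "b \<in> B' \<inter> {0..m}" "s \<in> {m+1<..<N}" for b s by (rule BR' [OF that])
    show "\<exists>e g. left_vel \<sigma>' N e \<and> right_vel \<sigma>' 0 g \<and> cr e g \<noteq> 0" if "0 < m" by (rule cE' [OF that])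
  qed (rule cl' m0 mN co' injT2 injX2 finC')+
  \<comment> \<open>All surviving crossings have times at least \<open>t0\<close> on the arc, so the
    new one at \<open>u - y\<close> is the first.\<close>
  have least2: "u - y \<le> t" if "0 < u" "s \<in> {m<..m+1}" "t \<in> {0..m}" "\<sigma>' s = \<sigma> t" for s t
  proof (cases "\<bar>s - s0\<bar> < r")
    case True
    then show ?thesis using main [of s t] that by auto
  next
    case False
    then have "\<sigma> s = \<sigma> t" using same\<sigma> [of s] that by simp
    then show ?thesis using least' that u y0 by fastforce
  qed
  show ?thesis
  proof (rule that [OF sn' _ _ B'm])
    show "c' t = c t" if "t \<notin> {m<..<m + 1}" for t
      using that \<rho>m r\<rho> by (intro same) auto
    show "ambient_isotopic (Some ` c ` {0..<N}) (Some ` c' ` {0..<N})"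
      unfolding c'_def using r r0(4) by auto
    show "meets m c' \<subseteq> meets m c - {s0} \<or>
      (\<exists>s' t'. s' \<in> {m<..m+1} \<and> t' \<in> {0..m} \<and> pr (c' s') = pr (c' t') \<and> t' < t0 \<and>
        meets m c' \<subseteq> insert s' (meets m c - {s0}) \<and> (\<exists>b\<in>B. t' < b \<and> b < t0) \<and>
        (\<forall>s\<in>{m<..m+1}. \<forall>t\<in>{0..m}. pr (c' s) = pr (c' t) \<longrightarrow> t' \<le> t))"
    proof (cases "0 < u")
      case False
      then show ?thesis using msub0 u by auto
    next
      case True
      have t': "u - y \<in> {0..m}" using y0 y\<epsilon> \<epsilon>1(1) [OF True] u t0' by auto
      have "\<bar>\<alpha> * y\<bar> < r" using yr y0 by (simp add: abs_mult)
      then have s': "s0 - \<alpha> * y \<in> {m<..m+1}" using \<rho>m r\<rho> by (auto simp: abs_less_iff)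
      have eq: "pr (c' (s0 - \<alpha> * y)) = pr (c' (u - y))"
        using new [OF True] sT [of "u - y"] t' by (simp add: \<sigma>'_def)
      have "\<forall>s\<in>{m<..m+1}. \<forall>t\<in>{0..m}. pr (c' s) = pr (c' t) \<longrightarrow> u - y \<le> t"
        using least2 [OF True] sT by (auto simp: \<sigma>'_def)
      then show ?thesis using s' t' eq msub u y0
        by (intro disjI2 exI [of _ "s0 - \<alpha> * y"] exI [of _ "u - y"] conjI bexI [of _ u] msub) simp_all
    qed
  qed
qed

section \<open>Termination of the pushing\<close>

lemma ambient_isotopic_refl: "ambient_isotopic (Some ` A) (Some ` A)"
  using ambient_isotopic_id_plus_contraction [of "\<lambda>_. 0" A] by (simp add: image_image)

lemma least_meeting:
  assumes inj: "inj_on (\<lambda>t. pr (c t)) {0..m}" and fin: "finite (meets m c)" and ne: "meets m c \<noteq> {}"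
  obtains s0 t0 where "s0 \<in> {m<..m+1}" "t0 \<in> {0..m}" "pr (c s0) = pr (c t0)"
    "\<forall>s\<in>{m<..m+1}. \<forall>t\<in>{0..m}. pr (c s) = pr (c t) \<longrightarrow> t0 \<le> t"
proof -
  define T where "T = {t \<in> {0..m}. \<exists>s\<in>{m<..m+1}. pr (c s) = pr (c t)}"
  have "T \<subseteq> (\<lambda>s. inv_into {0..m} (\<lambda>t. pr (c t)) (pr (c s))) ` meets m c"
  proof
    fix t assume "t \<in> T"
    then obtain s where s: "s \<in> {m<..m+1}" "pr (c s) = pr (c t)" and t: "t \<in> {0..m}" by (auto simp: T_def)
    have "inv_into {0..m} (\<lambda>t. pr (c t)) (pr (c s)) = t" using inv_into_f_f [OF inj t] s(2) by simp
    moreover have "s \<in> meets m c" using s t by (auto simp: meets_def)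
    ultimately show "t \<in> (\<lambda>s. inv_into {0..m} (\<lambda>t. pr (c t)) (pr (c s))) ` meets m c" by force
  qed
  then have "finite T" using fin finite_surj by blast
  moreover have "T \<noteq> {}" using ne unfolding T_def meets_def by fast
  ultimately have "Min T \<in> T" and le: "\<And>t. t \<in> T \<Longrightarrow> Min T \<le> t" by auto
  then obtain s where "s \<in> {m<..m+1}" "Min T \<in> {0..m}" "pr (c s) = pr (c (Min T))" by (auto simp: T_def)
  moreover have "\<forall>s\<in>{m<..m+1}. \<forall>t\<in>{0..m}. pr (c s) = pr (c t) \<longrightarrow> Min T \<le> t"
    using le unfolding T_def by fast
  ultimately show ?thesis by (rule that)
qed

text \<open>The number of crossings, followed by the number of vertices before the first of them,
  decreases lexicographically. The weight \<open>K + 1\<close> packs both into one number, as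
  \<open>K\<close> bounds the second entry; it is constant because pushing never changes the
  vertices in \<open>{0..m}\<close>.\<close>

lemma snake_clear:
  assumes "snake N m c B"
  obtains c' B' where "snake N m c' B'" "\<And>t. t \<notin> {m<..<m+1} \<Longrightarrow> c' t = c t"
    "ambient_isotopic (Some ` c ` {0..<N}) (Some ` c' ` {0..<N})" "meets m c' = {}"
proof -
  define K where "K = card (B \<inter> {0..m})"
  define Q where "Q = (\<lambda>c. \<exists>c' B'. snake N m c' B' \<and> (\<forall>t. t \<notin> {m<..<m+1} \<longrightarrow> c' t = c t) \<and>
    ambient_isotopic (Some ` c ` {0..<N}) (Some ` c' ` {0..<N}) \<and> meets m c' = {})"
  have Q0: "Q c" if "snake N m c B" "meets m c = {}" for c B
    unfolding Q_def
    by (rule exI [of _ c], rule exI [of _ B]) (simp add: that ambient_isotopic_refl)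
  have step: "Q c" if "Q c'" and eq: "\<And>t. t \<notin> {m<..<m+1} \<Longrightarrow> c' t = c t"
     and iso: "ambient_isotopic (Some ` c ` {0..<N}) (Some ` c' ` {0..<N})" for c c'
  proof -
    obtain e B' where e: "snake N m e B'" "\<forall>t. t \<notin> {m<..<m+1} \<longrightarrow> e t = c' t"
      "ambient_isotopic (Some ` c' ` {0..<N}) (Some ` e ` {0..<N})" "meets m e = {}"
      using \<open>Q c'\<close> unfolding Q_def by blast
    have "\<forall>t. t \<notin> {m<..<m+1} \<longrightarrow> e t = c t" using e(2) eq by simp
    then show ?thesis unfolding Q_def using e(1,4) ambient_isotopic_trans [OF iso e(3)] by blast
  qed
  have main: "Q c"
    if "snake N m c B" "card (B \<inter> {0..m}) = K" "s0 \<in> {m<..m+1}" "t0 \<in> {0..m}" "pr (c s0) = pr (c t0)"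
      "\<forall>s\<in>{m<..m+1}. \<forall>t\<in>{0..m}. pr (c s) = pr (c t) \<longrightarrow> t0 \<le> t"
      "n = card (meets m c) * (K + 1) + card {b \<in> B \<inter> {0..m}. b < t0}" for n c B s0 t0
    using that
  proof (induction n arbitrary: c B s0 t0 rule: less_induct)
    case (less n)
    note sn = less.prems(1) and KB = less.prems(2) and n = less.prems(7)
    have finC: "finite (meets m c)" using sn by (simp add: snake_def)
    have s0: "s0 \<in> meets m c" using less.prems(3-5) by (auto simp: meets_def)
    have finB: "finite (B \<inter> {0..m})" using sn by (simp add: snake_def cornered_def)
    obtain c' B' where c': "snake N m c' B'" "\<And>t. t \<notin> {m<..<m+1} \<Longrightarrow> c' t = c t"
      "ambient_isotopic (Some ` c ` {0..<N}) (Some ` c' ` {0..<N})" and BB: "B' \<inter> {0..m} = B \<inter> {0..m}"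
      and alt: "meets m c' \<subseteq> meets m c - {s0} \<or>
      (\<exists>s' t'. s' \<in> {m<..m+1} \<and> t' \<in> {0..m} \<and> pr (c' s') = pr (c' t') \<and> t' < t0 \<and>
        meets m c' \<subseteq> insert s' (meets m c - {s0}) \<and> (\<exists>b\<in>B. t' < b \<and> b < t0) \<and>
        (\<forall>s\<in>{m<..m+1}. \<forall>t\<in>{0..m}. pr (c' s) = pr (c' t) \<longrightarrow> t' \<le> t))"
      by (rule push_step [OF sn less.prems(3-6)]) (rule that)
    have K': "card (B' \<inter> {0..m}) = K" using BB KB by simp
    from alt have "Q c'"
    proof
      assume sub: "meets m c' \<subseteq> meets m c - {s0}"
      show "Q c'"
      proof (cases "meets m c' = {}")
        case True
        then show ?thesis by (rule Q0 [OF c'(1)])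
      next
        case False
        have inj': "inj_on (\<lambda>t. pr (c' t)) {0..m}" and fin': "finite (meets m c')" using c'(1) by (simp_all add: snake_def)
        obtain s t where st: "s \<in> {m<..m+1}" "t \<in> {0..m}" "pr (c' s) = pr (c' t)"
          "\<forall>s\<in>{m<..m+1}. \<forall>u\<in>{0..m}. pr (c' s) = pr (c' u) \<longrightarrow> t \<le> u"
          by (rule least_meeting [OF inj' fin' False]) (rule that)
        have "card (meets m c') < card (meets m c)"
          using sub s0 finC by (intro psubset_card_mono) auto
        then have "card (meets m c') * (K + 1) + (K + 1) \<le> card (meets m c) * (K + 1)"
          by (metis Suc_leI add.commute mult_Suc mult_le_mono1)
        moreover have "card {b \<in> B' \<inter> {0..m}. b < t} \<le> K"
          unfolding KB [symmetric] BB by (rule card_mono [OF finB]) auto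
        ultimately have "card (meets m c') * (K + 1) + card {b \<in> B' \<inter> {0..m}. b < t} < n"
          unfolding n by linarith
        then show ?thesis by (rule less.IH [OF _ c'(1) K' st refl])
      qed
    next
      assume "\<exists>s' t'. s' \<in> {m<..m+1} \<and> t' \<in> {0..m} \<and> pr (c' s') = pr (c' t') \<and> t' < t0 \<and>
        meets m c' \<subseteq> insert s' (meets m c - {s0}) \<and> (\<exists>b\<in>B. t' < b \<and> b < t0) \<and>
        (\<forall>s\<in>{m<..m+1}. \<forall>t\<in>{0..m}. pr (c' s) = pr (c' t) \<longrightarrow> t' \<le> t)"
      then obtain s' t' b where st: "s' \<in> {m<..m+1}" "t' \<in> {0..m}" "pr (c' s') = pr (c' t')"
        "\<forall>s\<in>{m<..m+1}. \<forall>t\<in>{0..m}. pr (c' s) = pr (c' t) \<longrightarrow> t' \<le> t"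
        and sub: "meets m c' \<subseteq> insert s' (meets m c - {s0})" and b: "b \<in> B" "t' < b" "b < t0" by blast
      have "card (meets m c') \<le> card (insert s' (meets m c - {s0}))" using sub finC by (intro card_mono) auto
      also have "\<dots> \<le> Suc (card (meets m c - {s0}))" using finC by (simp add: card_insert_if)
      also have "\<dots> = card (meets m c)" using s0 finC by (metis card_Suc_Diff1)
      finally have "card (meets m c') * (K + 1) \<le> card (meets m c) * (K + 1)" by (rule mult_le_mono1)
      moreover have "card {b \<in> B' \<inter> {0..m}. b < t'} < card {b \<in> B \<inter> {0..m}. b < t0}"
      proof (rule psubset_card_mono)
        have "b \<in> {b \<in> B \<inter> {0..m}. b < t0}" using b st(2) less.prems(4) by auto
        moreover have "b \<notin> {b \<in> B' \<inter> {0..m}. b < t'}" using b by auto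
        moreover have "{b \<in> B' \<inter> {0..m}. b < t'} \<subseteq> {b \<in> B \<inter> {0..m}. b < t0}" using BB b by auto
        ultimately show "{b \<in> B' \<inter> {0..m}. b < t'} \<subset> {b \<in> B \<inter> {0..m}. b < t0}" by blast
        show "finite {b \<in> B \<inter> {0..m}. b < t0}" using finB by (rule rev_finite_subset) auto
      qed
      ultimately have "card (meets m c') * (K + 1) + card {b \<in> B' \<inter> {0..m}. b < t'} < n"
        unfolding n by linarith
      then show "Q c'" by (rule less.IH [OF _ c'(1) K' st refl])
    qed
    then show "Q c" by (rule step [OF _ c'(2,3)])
  qed
  have "Q c"
  proof (cases "meets m c = {}")
    case True
    then show ?thesis by (rule Q0 [OF assms])
  next
    case False
    have "inj_on (\<lambda>t. pr (c t)) {0..m}" "finite (meets m c)" using assms by (simp_all add: snake_def)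
    from least_meeting [OF this False] obtain s0 t0 where "s0 \<in> {m<..m+1}" "t0 \<in> {0..m}" "pr (c s0) = pr (c t0)"
      "\<forall>s\<in>{m<..m+1}. \<forall>t\<in>{0..m}. pr (c s) = pr (c t) \<longrightarrow> t0 \<le> t" by blast
    from main [OF assms K_def [symmetric] this refl] show ?thesis .
  qed
  then show ?thesis using that unfolding Q_def by blast
qed

section \<open>Growing an arc with simple projection\<close>

lemma generic_displacement:
  assumes "finite F" "\<And>k d. (k, d) \<in> F \<Longrightarrow> d \<noteq> 0" "0 < e"
  obtains w where "norm w < e" "\<And>k d. (k, d) \<in> F \<Longrightarrow> cr (k + w) d \<noteq> 0"
proof -
  \<comment> \<open>A parabola: a line contains at most two of its points, so each condition
    excludes at most two values of \<open>x\<close>.\<close>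
  define W where "W = (\<lambda>x::real. Complex x (x\<^sup>2))"
  define bad where "bad = (\<lambda>(k, d). {x. cr (k + W x) d = 0})"
  have "finite (bad z)" if "z \<in> F" for z
  proof -
    obtain k d where z: "z = (k, d)" by fastforce
    then have d: "d \<noteq> 0" using assms(2) that by auto
    have "poly [: cr k d, Im d, - Re d :] x = cr (k + W x) d" for x
      by (simp add: W_def cr_def algebra_simps power2_eq_square)
    moreover have "[: cr k d, Im d, - Re d :] \<noteq> 0" using d by (auto simp: complex_eq_iff)
    ultimately show ?thesis using poly_roots_finite [of "[: cr k d, Im d, - Re d :]"]
      by (simp add: bad_def z)
  qed
  then have "finite (\<Union>z\<in>F. bad z)" using assms(1) by auto
  moreover have "infinite {0<..<min 1 (e/2)}" using assms(3) by simp
  ultimately have "\<not> {0<..<min 1 (e/2)} \<subseteq> (\<Union>z\<in>F. bad z)" using finite_subset by blast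
  then obtain x where x: "x \<in> {0<..<min 1 (e/2)}" "x \<notin> (\<Union>z\<in>F. bad z)" by blast
  have "norm (W x) \<le> \<bar>x\<bar> + \<bar>x\<^sup>2\<bar>" using cmod_le [of "W x"] by (simp add: W_def)
  also have "x\<^sup>2 \<le> x" using x by (simp add: power2_eq_square mult_left_le)
  then have "\<bar>x\<bar> + \<bar>x\<^sup>2\<bar> < e" using x by auto
  finally have "norm (W x) < e" .
  moreover have "cr (k + W x) d \<noteq> 0" if "(k, d) \<in> F" for k d
    using x(2) that by (auto simp: bad_def)
  ultimately show ?thesis by (rule that)
qed

definition lift :: "complex \<Rightarrow> real^3" where
  "lift w = vector [0, Re w, Im w]"

lemma pr_lift [simp]: "pr (lift w) = w"
  by (simp add: lift_def pr_def)

lemma norm_lift: "norm (lift w) \<le> 2 * norm w"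
proof -
  have "norm (lift w) \<le> \<bar>Re w\<bar> + \<bar>Im w\<bar>"
    using norm_le_l1_cart [of "lift w"] by (simp add: sum_3 lift_def)
  also have "\<dots> \<le> 2 * norm w" using abs_Re_le_cmod [of w] abs_Im_le_cmod [of w] by simp
  finally show ?thesis .
qed

lemma lin_eq:
  assumes "lin a b c" "a < b" "a \<le> t" "t \<le> b"
  shows "c t = c a + ((t - a) / (b - a)) *\<^sub>R (c b - c a)"
proof -
  obtain p v where v: "\<And>t. a \<le> t \<Longrightarrow> t \<le> b \<Longrightarrow> c t = p + t *\<^sub>R v"
    using assms(1) by (auto simp: lin_def)
  have ba: "c b - c a = (b - a) *\<^sub>R v" using assms by (simp add: v algebra_simps)
  have "((t - a) / (b - a)) *\<^sub>R (c b - c a) = (t - a) *\<^sub>R v" unfolding ba using assms by simp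
  moreover have "c t = c a + (t - a) *\<^sub>R v" using assms by (simp add: v algebra_simps)
  ultimately show ?thesis by simp
qed

lemma cornered_cong:
  assumes co: "cornered B M c" and same: "\<And>t. t \<le> M \<Longrightarrow> c1 t = c t"
  shows "cornered B M c1"
  unfolding cornered_def
proof (intro conjI allI impI ballI)
  show "finite B" "{0, M} \<subseteq> B" "B \<subseteq> {0..M}" using co by (simp_all add: cornered_def)
  fix p q assume pq: "0 \<le> p \<and> p \<le> q \<and> q \<le> M \<and> {p<..<q} \<inter> B = {}"
  then have "lin p q c" using co by (simp add: cornered_def)
  then show "lin p q c1" by (rule lin_cong) (use pq same in auto)
next
  fix b assume b: "b \<in> B" "0 < b \<and> b < M"
  then obtain f g where fg: "left_vel (\<lambda>t. pr (c t)) b f" "right_vel (\<lambda>t. pr (c t)) b g" "cr f g \<noteq> 0"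
    using co unfolding cornered_def by blast
  have "left_vel (\<lambda>t. pr (c1 t)) b f" by (rule left_vel_cong [OF fg(1), of 0]) (use b same in auto)
  moreover have "right_vel (\<lambda>t. pr (c1 t)) b g" by (rule right_vel_cong [OF fg(2), of M]) (use b same in auto)
  ultimately show "\<exists>f g. left_vel (\<lambda>t. pr (c1 t)) b f \<and> right_vel (\<lambda>t. pr (c1 t)) b g \<and> cr f g \<noteq> 0"
    using fg(3) by blast
qed

lemma cornered_pieceR:
  assumes "cornered B M c" "0 \<le> t" "t < M"
  obtains p q where "p \<in> B" "q \<in> B" "p \<le> t" "t < q" "lin p q c"
proof -
  have B: "finite B" "0 \<in> B" "M \<in> B" "B \<subseteq> {0..M}"
    and lin: "\<And>p q. 0 \<le> p \<and> p \<le> q \<and> q \<le> M \<and> {p<..<q} \<inter> B = {} \<Longrightarrow> lin p q c"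
    using assms(1) by (auto simp: cornered_def)
  define p where "p = Max {b \<in> B. b \<le> t}"
  define q where "q = Min {b \<in> B. t < b}"
  have p: "p \<in> {b \<in> B. b \<le> t}" unfolding p_def using B assms by (intro Max_in) auto
  have q: "q \<in> {b \<in> B. t < b}" unfolding q_def using B assms by (intro Min_in) auto
  have "b \<le> p" if "b \<in> B" "b \<le> t" for b unfolding p_def using B that by (intro Max_ge) auto
  moreover have "q \<le> b" if "b \<in> B" "t < b" for b unfolding q_def using B that by (intro Min_le) auto
  ultimately have "{p<..<q} \<inter> B = {}" by force
  then have "lin p q c" using p q B by (intro lin) auto
  then show ?thesis using p q by (intro that [of p q]) auto
qed

lemma cornered_pieceL:
  assumes "cornered B M c" "0 < t" "t \<le> M"
  obtains p q where "p \<in> B" "q \<in> B" "p < t" "t \<le> q" "lin p q c"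
proof -
  have B: "finite B" "0 \<in> B" "M \<in> B" "B \<subseteq> {0..M}"
    and lin: "\<And>p q. 0 \<le> p \<and> p \<le> q \<and> q \<le> M \<and> {p<..<q} \<inter> B = {} \<Longrightarrow> lin p q c"
    using assms(1) by (auto simp: cornered_def)
  define p where "p = Max {b \<in> B. b < t}"
  define q where "q = Min {b \<in> B. t \<le> b}"
  have p: "p \<in> {b \<in> B. b < t}" unfolding p_def using B assms by (intro Max_in) auto
  have q: "q \<in> {b \<in> B. t \<le> b}" unfolding q_def using B assms by (intro Min_in) auto
  have "b \<le> p" if "b \<in> B" "b < t" for b unfolding p_def using B that by (intro Max_ge) auto
  moreover have "q \<le> b" if "b \<in> B" "t \<le> b" for b unfolding q_def using B that by (intro Min_le) auto
  ultimately have "{p<..<q} \<inter> B = {}" by force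
  then have "lin p q c" using p q B by (intro lin) auto
  then show ?thesis using p q by (intro that [of p q]) auto
qed

text \<open>Time is never rescaled while the arc grows: fingers subdivide only
  \<open>{0..m}\<close>, where \<open>B\<close> records the vertices, and each edge still to come
  keeps its unit interval.\<close>

definition grown :: "nat \<Rightarrow> nat \<Rightarrow> (real \<Rightarrow> real^3) \<Rightarrow> real set \<Rightarrow> bool" where
  "grown n m c B \<longleftrightarrow> closed_pl (real n) c \<and> m < n \<and> (\<forall>j. m \<le> j \<and> j < n \<longrightarrow> lin (real j) (real j + 1) c) \<and>
    cornered B (real m) c \<and> inj_on (\<lambda>t. pr (c t)) {0..real m}"

text \<open>The direction \<open>\<i>\<close> serves to separate the second coordinates of the vertices.\<close>

definition dirs :: "real set \<Rightarrow> (real \<Rightarrow> complex) \<Rightarrow> complex set" where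
  "dirs B \<sigma> = insert \<i> {\<sigma> q - \<sigma> p | p q. p \<in> B \<and> q \<in> B \<and> p \<noteq> q}"

text \<open>The vertices up to \<open>j\<close> have been placed, and every condition involves only
  these, so moving the next vertex destroys none. The closing edge has to wait for the last vertex
  and is viewed from vertex 0, which stays fixed. The families say that edges are transversal to the
  arc, that they miss its vertices, and that their end points after \<open>m\<close> lie off the
  lines through its edges.\<close>

definition generic_edges :: "nat \<Rightarrow> nat \<Rightarrow> real set \<Rightarrow> nat \<Rightarrow> (real \<Rightarrow> complex) \<Rightarrow> bool" where
  "generic_edges n m B j \<sigma> \<longleftrightarrow>
    (\<forall>i. m \<le> i \<and> i < j \<longrightarrow>
      (\<forall>v\<in>dirs B \<sigma>. cr (\<sigma> (real i + 1) - \<sigma> (real i)) v \<noteq> 0) \<and>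
      (\<forall>p\<in>B. \<sigma> p \<noteq> \<sigma> (real i) \<longrightarrow> cr (\<sigma> (real i + 1) - \<sigma> (real i)) (\<sigma> p - \<sigma> (real i)) \<noteq> 0)) \<and>
    (\<forall>i. m < i \<and> i \<le> j \<longrightarrow> (\<forall>p\<in>B. \<forall>v\<in>dirs B \<sigma>. cr (\<sigma> (real i) - \<sigma> p) v \<noteq> 0)) \<and>
    (j = n - 1 \<longrightarrow> 
      (\<forall>v\<in>dirs B \<sigma>. cr (\<sigma> (real j) - \<sigma> 0) v \<noteq> 0) \<and>
      (\<forall>p\<in>B. p \<noteq> 0 \<longrightarrow> cr (\<sigma> (real j) - \<sigma> 0) (\<sigma> p - \<sigma> 0) \<noteq> 0))"

lemma dirs_nonzero: "inj_on \<sigma> B \<Longrightarrow> v \<in> dirs B \<sigma> \<Longrightarrow> v \<noteq> 0"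
  by (auto simp: dirs_def dest: inj_onD)

lemma finite_dirs: assumes "finite B" shows "finite (dirs B \<sigma>)"
proof -
  have "{\<sigma> q - \<sigma> p | p q. p \<in> B \<and> q \<in> B \<and> p \<noteq> q} \<subseteq> (\<lambda>(p, q). \<sigma> q - \<sigma> p) ` (B \<times> B)"
    by auto
  then show ?thesis unfolding dirs_def using assms finite_surj [of "B \<times> B"] by simp
qed

lemma dirs_cong: "(\<And>t. t \<in> B \<Longrightarrow> \<sigma>' t = \<sigma> t) \<Longrightarrow> dirs B \<sigma>' = dirs B \<sigma>"
  unfolding dirs_def by (metis (no_types, lifting))

text \<open>Stated for any plane projection \<open>\<pi>\<close> and any property \<open>Q\<close>
  surviving small moves of single vertices, because it serves three times: for growing the arc, for
  the closing edge, and for the final diagram. A tent of width 1 moves one vertex and fixes the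
  others, and the displacement only has to avoid finitely many lines.\<close>

lemma perturb_vertices:
  assumes cl: "closed_pl (real n) c" and lin: "\<And>i. m \<le> i \<Longrightarrow> i < n \<Longrightarrow> lin (real i) (real i + 1) c"
    and mn: "m + 1 < n" and j: "m \<le> j" "j \<le> n - 1"
    and B: "finite B" "0 \<in> B" "B \<subseteq> {0..real m}" and inj: "inj_on (\<lambda>t. \<pi> (c t)) B"
    and \<pi>: "linear \<pi>" "\<And>w. \<pi> (lf w) = w" "\<And>w. norm (lf w) \<le> 2 * norm w"
    and Q: "Q c" "\<And>c i. Q c \<Longrightarrow> m < i \<Longrightarrow> i < n \<Longrightarrow> \<exists>e>0. \<forall>w. norm w < e \<longrightarrow> Q (\<lambda>t. c t + tent 1 (t - real i) *\<^sub>R w)"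
  shows "\<exists>c'. closed_pl (real n) c' \<and> ambient_isotopic (Some ` c ` {0..<real n}) (Some ` c' ` {0..<real n}) \<and>
    (\<forall>t. t \<le> real m \<or> t \<ge> real n \<longrightarrow> c' t = c t) \<and>
    (\<forall>i. m \<le> i \<and> i < n \<longrightarrow> lin (real i) (real i + 1) c') \<and> Q c' \<and> generic_edges n m B j (\<lambda>t. \<pi> (c' t))"
  using j
proof (induction j rule: dec_induct)
  case base
  have "generic_edges n m B m (\<lambda>t. \<pi> (c t))" using mn by (auto simp: generic_edges_def)
  then show ?case using cl lin Q(1) ambient_isotopic_refl by blast
next
  case (step j)
  obtain c' where c': "closed_pl (real n) c'" and iso: "ambient_isotopic (Some ` c ` {0..<real n}) (Some ` c' ` {0..<real n})"
    and same: "\<And>t. t \<le> real m \<or> t \<ge> real n \<Longrightarrow> c' t = c t"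
    and lin': "\<And>i. m \<le> i \<Longrightarrow> i < n \<Longrightarrow> lin (real i) (real i + 1) c'" and Qc: "Q c'" and gen: "generic_edges n m B j (\<lambda>t. \<pi> (c' t))"
    using step by auto
  have jn: "Suc j < n" "m \<le> j" using step by auto
  define \<sigma> where "\<sigma> = (\<lambda>t. \<pi> (c' t))"
  define V where "V = dirs B \<sigma>"
  have sameB: "c' t = c t" if "t \<in> B" for t using B that same by auto
  have injB: "inj_on \<sigma> B"
    unfolding \<sigma>_def using inj by (rule inj_on_cong [THEN iffD1, rotated]) (simp add: sameB)
  have V0: "v \<noteq> 0" if "v \<in> V" for v using dirs_nonzero [OF injB] that by (simp add: V_def)
  have finV: "finite V" unfolding V_def by (rule finite_dirs [OF B(1)])
  define J where "J = real (Suc j)"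
  \<comment> \<open>The conditions on the vertex at time \<open>J\<close> as pairs for
    \<open>generic_displacement\<close>; the last two families concern the closing edge.\<close>
  define F where "F = (\<lambda>v. (\<sigma> J - \<sigma> (real j), v)) ` V \<union>
     (\<lambda>p. (\<sigma> J - \<sigma> (real j), \<sigma> p - \<sigma> (real j))) ` {p \<in> B. \<sigma> p \<noteq> \<sigma> (real j)} \<union>
     (\<lambda>(p, v). (\<sigma> J - \<sigma> p, v)) ` (B \<times> V) \<union>
     (\<lambda>v. (\<sigma> J - \<sigma> 0, v)) ` V \<union> (\<lambda>p. (\<sigma> J - \<sigma> 0, \<sigma> p - \<sigma> 0)) ` (B - {0})"
  have "finite F" unfolding F_def using finV B by simp
  moreover have "d \<noteq> 0" if "(k, d) \<in> F" for k d
  proof -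
    have "p = 0" if "p \<in> B" "\<sigma> p = \<sigma> 0" for p using inj_onD [OF injB, of p 0] that B by auto
    then show ?thesis using that V0 unfolding F_def by auto
  qed
  moreover define h where "h = (\<lambda>t. tent 1 (t - J))"
  have h: "pl 0 (real n) h" "h 0 = h (real n)"
    using jn by (auto simp: h_def J_def pl_tent tent_eq_0)
  obtain e where e: "0 < e" "\<And>w. norm w < e \<Longrightarrow> closed_pl (real n) (\<lambda>t. c' t + h t *\<^sub>R w)"
    "\<And>w. norm w < e \<Longrightarrow> ambient_isotopic (Some ` c' ` {0..<real n}) (Some ` (\<lambda>t. c' t + h t *\<^sub>R w) ` {0..<real n})"
    using bump_perturbation [OF c' h] by blast
  obtain e' where e': "0 < e'" "\<And>w. norm w < e' \<Longrightarrow> Q (\<lambda>t. c' t + h t *\<^sub>R w)"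
    using Q(2) [OF Qc, of "Suc j"] jn unfolding h_def J_def by auto
  moreover have "0 < min e e' / 2" using e e' by simp
  ultimately obtain w where w: "norm w < min e e' / 2" "\<And>k d. (k, d) \<in> F \<Longrightarrow> cr (k + w) d \<noteq> 0"
    using generic_displacement [of F "min e e' / 2"] by blast
  define c2 where "c2 = (\<lambda>t. c' t + h t *\<^sub>R lf w)"
  have lfe: "norm (lf w) < e" "norm (lf w) < e'" using \<pi>(3) [of w] w(1) by auto
  then have cl2: "closed_pl (real n) c2" 
    and iso2: "ambient_isotopic (Some ` c' ` {0..<real n}) (Some ` c2 ` {0..<real n})"
    using e(2,3) lfe unfolding c2_def by auto
  have Q2: "Q c2" unfolding c2_def by (rule e'(2) [OF lfe(2)])
  have h0: "h t = 0" if "1 \<le> \<bar>t - J\<bar>" for t using that by (simp add: h_def tent_eq_0)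
  have s2: "c2 t = c' t" if "t \<le> real j \<or> real (Suc j) + 1 \<le> t" for t
  proof -
    have "h t = 0" using that by (intro h0) (auto simp: J_def)
    then show ?thesis by (simp add: c2_def)
  qed
  have s2J: "\<pi> (c2 J) = \<sigma> J + w" by (simp add: c2_def h_def \<sigma>_def linear_add [OF \<pi>(1)] \<pi>(2))
  have s2i: "\<pi> (c2 (real i)) = \<sigma> (real i)" if "i \<le> j" for i using s2 [of "real i"] that by (simp add: \<sigma>_def)
  have s20: "\<pi> (c2 0) = \<sigma> 0" using s2 [of 0] by (simp add: \<sigma>_def)
  have s2B: "\<pi> (c2 p) = \<sigma> p" "c2 p = c' p" if "p \<in> B" for p using s2 [of p] that B jn by (auto simp: \<sigma>_def)
  have V2: "dirs B (\<lambda>t. \<pi> (c2 t)) = V" unfolding V_def by (rule dirs_cong) (rule s2B(1))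
  have Jj: "real j + 1 = J" by (simp add: J_def)
  have ej: "\<pi> (c2 (real j + 1)) - \<pi> (c2 (real j)) = (\<sigma> J - \<sigma> (real j)) + w"
    unfolding Jj s2J s2i [OF order_refl] by simp
  have eB: "\<pi> (c2 J) - \<pi> (c2 p) = (\<sigma> J - \<sigma> p) + w" if "p \<in> B" for p
    unfolding s2J s2B(1) [OF that] by simp
  have e0: "\<pi> (c2 J) - \<pi> (c2 0) = (\<sigma> J - \<sigma> 0) + w"
    unfolding s2J s20 by simp
  have gen2: "generic_edges n m B (Suc j) (\<lambda>t. \<pi> (c2 t))"
    unfolding generic_edges_def V2
  proof (intro conjI allI impI ballI)
    fix i v assume i: "m \<le> i \<and> i < Suc j" and v: "v \<in> V"
    show "cr (\<pi> (c2 (real i + 1)) - \<pi> (c2 (real i))) v \<noteq> 0"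
    proof (cases "i = j")
      case True
      have "(\<sigma> J - \<sigma> (real j), v) \<in> F" using v by (auto simp: F_def)
      then show ?thesis unfolding True ej by (rule w(2))
    next
      case False
      then have "i < j" using i by simp
      then have "cr (\<pi> (c' (real i + 1)) - \<pi> (c' (real i))) v \<noteq> 0"
        using gen i v unfolding generic_edges_def V_def \<sigma>_def by blast
      moreover have "c2 (real i + 1) = c' (real i + 1)" "c2 (real i) = c' (real i)" using \<open>i < j\<close> by (auto intro!: s2)
      ultimately show ?thesis by simp
    qed
  next
    fix i p assume i: "m \<le> i \<and> i < Suc j" and p: "p \<in> B" "\<pi> (c2 p) \<noteq> \<pi> (c2 (real i))"
    show "cr (\<pi> (c2 (real i + 1)) - \<pi> (c2 (real i))) (\<pi> (c2 p) - \<pi> (c2 (real i))) \<noteq> 0"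
    proof (cases "i = j")
      case True
      then have "(\<sigma> J - \<sigma> (real j), \<sigma> p - \<sigma> (real j)) \<in> F" using p s2B s2i by (auto simp: F_def)
      then show ?thesis unfolding True ej unfolding s2B(1) [OF p(1)] s2i [OF order_refl] by (rule w(2))
    next
      case False
      then have ij: "i < j" using i by simp
      have eq: "c2 (real i + 1) = c' (real i + 1)" "c2 (real i) = c' (real i)" "c2 p = c' p"
        using ij s2B(2) [OF p(1)] by (auto intro!: s2)
      show ?thesis using gen i ij p unfolding generic_edges_def eq by blast
    qed
  next
    fix i p v assume i: "m < i \<and> i \<le> Suc j" and p: "p \<in> B" and v: "v \<in> V"
    show "cr (\<pi> (c2 (real i)) - \<pi> (c2 p)) v \<noteq> 0"
    proof (cases "i = Suc j")
      case True
      have "(\<sigma> J - \<sigma> p, v) \<in> F" using p v by (auto simp: F_def)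
      then show ?thesis unfolding True J_def [symmetric] eB [OF p] by (rule w(2))
    next
      case False
      then have "cr (\<pi> (c' (real i)) - \<pi> (c' p)) v \<noteq> 0"
        using gen i v p unfolding generic_edges_def V_def \<sigma>_def by (metis le_SucE)
      moreover have "c2 (real i) = c' (real i)" using False i by (auto intro!: s2)
      ultimately show ?thesis by (simp add: s2B(2) [OF p])
    qed
  next
    fix v assume v: "v \<in> V"
    have "(\<sigma> J - \<sigma> 0, v) \<in> F" using v by (auto simp: F_def)
    then show "cr (\<pi> (c2 (real (Suc j))) - \<pi> (c2 0)) v \<noteq> 0"
      unfolding J_def [symmetric] e0 by (rule w(2))
  next
    fix p assume p: "p \<in> B" "p \<noteq> 0"
    have "(\<sigma> J - \<sigma> 0, \<sigma> p - \<sigma> 0) \<in> F" using p by (auto simp: F_def)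
    then show "cr (\<pi> (c2 (real (Suc j))) - \<pi> (c2 0)) (\<pi> (c2 p) - \<pi> (c2 0)) \<noteq> 0"
      unfolding J_def [symmetric] e0 unfolding s2B(1) [OF p(1)] s20 by (rule w(2))
  qed
  have lin2: "lin (real i) (real i + 1) c2" if i: "m \<le> i" "i < n" for i
    unfolding c2_def
  proof (rule lin_add [OF lin' [OF i]])
    have "{real i<..<real i + 1} \<inter> {J - 1, J, J + 1} = {}"
    proof -
      have "x \<notin> {real i<..<real i + 1}" if "x = real k" for x and k :: nat using that by auto
      from this [of "J - 1" j] this [of J "Suc j"] this [of "J + 1" "Suc (Suc j)"] show ?thesis
        by (auto simp: J_def)
    qed
    then have "lin (real i) (real i + 1) h" unfolding h_def by (intro lin_tent) auto
    then show "lin (real i) (real i + 1) (\<lambda>t. h t *\<^sub>R lf w)"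
      by (intro lin_linear [of "\<lambda>x. x *\<^sub>R lf w"]) (auto simp: linear_iff algebra_simps)
  qed
  have "c2 t = c t" if "t \<le> real m \<or> t \<ge> real n" for t
    using s2 [of t] same [OF that] that jn by auto
  then show ?case
    using cl2 ambient_isotopic_trans [OF iso iso2] lin2 Q2 gen2 by blast
qed

text \<open>Finitely many lines cover the arc, which turns statements about the arc into determinant
  conditions as in \<open>generic_edges\<close>.\<close>

lemma on_arc_dirs:
  assumes co: "cornered B M c" and t: "0 \<le> t" "t \<le> M"
  shows "\<exists>p\<in>B. \<exists>v\<in>dirs B (\<lambda>t. pr (c t)). cr (pr (c t) - pr (c p)) v = 0"
proof (cases "t = M")
  case True
  have "M \<in> B" using co by (simp add: cornered_def)
  moreover have "\<i> \<in> dirs B (\<lambda>t. pr (c t))" by (simp add: dirs_def)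
  ultimately show ?thesis using True by (intro bexI [of _ M] bexI [of _ \<i>]) (auto simp: cr_def)
next
  case False
  then have "t < M" using t by simp
  then obtain p q where pq: "p \<in> B" "q \<in> B" "p \<le> t" "t < q" "lin p q c"
    using cornered_pieceR [OF co t(1)] by blast
  have "lin p q (\<lambda>t. pr (c t))" by (rule lin_linear [OF linear_pr pq(5)])
  then have "pr (c t) - pr (c p) = ((t - p) / (q - p)) *\<^sub>R (pr (c q) - pr (c p))"
    using lin_eq [of p q _ t] pq by fastforce
  then have "cr (pr (c t) - pr (c p)) (pr (c q) - pr (c p)) = 0" by (simp add: cr_scale)
  moreover have "pr (c q) - pr (c p) \<in> dirs B (\<lambda>t. pr (c t))" using pq unfolding dirs_def by force
  ultimately show ?thesis using pq by blast
qed

lemma finite_line_meets_arc: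
  assumes co: "cornered B M c" and d: "\<And>v. v \<in> dirs B (\<lambda>t. pr (c t)) \<Longrightarrow> cr d v \<noteq> 0"
  shows "finite {x::real. k + x *\<^sub>R d \<in> (\<lambda>t. pr (c t)) ` {0..M}}"
proof -
  let ?V = "dirs B (\<lambda>t. pr (c t))"
  have B: "finite B" using co by (simp add: cornered_def)
  have one: "finite {x. cr (k + x *\<^sub>R d - pr (c p)) v = 0}" if v: "v \<in> ?V" for p v
  proof -
    have "cr (k + x *\<^sub>R d - pr (c p)) v = cr (k - pr (c p)) v + x * cr d v" for x
      by (simp add: cr_def algebra_simps)
    moreover have "{x. cr (k - pr (c p)) v + x * cr d v = 0} \<subseteq> {- cr (k - pr (c p)) v / cr d v}"
      using d [OF v] by (auto simp: field_simps)
    ultimately show ?thesis by (simp add: finite_subset)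
  qed
  have "{x. k + x *\<^sub>R d \<in> (\<lambda>t. pr (c t)) ` {0..M}} \<subseteq>
    (\<Union>p\<in>B. \<Union>v\<in>?V. {x. cr (k + x *\<^sub>R d - pr (c p)) v = 0})"
  proof
    fix x assume "x \<in> {x. k + x *\<^sub>R d \<in> (\<lambda>t. pr (c t)) ` {0..M}}"
    then obtain t where t: "0 \<le> t" "t \<le> M" "k + x *\<^sub>R d = pr (c t)" by auto
    obtain p v where "p \<in> B" "v \<in> ?V" "cr (pr (c t) - pr (c p)) v = 0" using on_arc_dirs [OF co t(1,2)] by blast
    then show "x \<in> (\<Union>p\<in>B. \<Union>v\<in>?V. {x. cr (k + x *\<^sub>R d - pr (c p)) v = 0})" unfolding t(3) [symmetric] by blast
  qed
  then show ?thesis by (rule finite_subset) (use B finite_dirs [OF B] one in auto)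
qed

text \<open>The closing edge is minus the vector from vertex 0 to the last vertex, so the conditions
  viewed from vertex 0 make it transversal too. Crossings are then isolated, and each vertex is kept
  off the edges by a determinant seen from one end of the edge.\<close>

lemma snake_of_generic_edges:
  assumes cl: "closed_pl (real n) c" and mn: "m + 1 < n"
    and lin: "\<And>i. m \<le> i \<Longrightarrow> i < n \<Longrightarrow> lin (real i) (real i + 1) c"
    and co: "cornered B (real m) c" and inj: "inj_on (\<lambda>t. pr (c t)) {0..real m}"
    and gen: "generic_edges n m B (n - 1) (\<lambda>t. pr (c t))"
  shows "snake (real n) (real m) c (insert (real m + 1) B)"
proof -
  define \<sigma> where "\<sigma> = (\<lambda>t. pr (c t))"
  define V where "V = dirs B \<sigma>"
  define e where "e = (\<lambda>i. \<sigma> (real i + 1) - \<sigma> (real i))"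
  have B: "finite B" "0 \<in> B" "real m \<in> B" "B \<subseteq> {0..real m}"
    and Blin: "\<And>p q. 0 \<le> p \<and> p \<le> q \<and> q \<le> real m \<and> {p<..<q} \<inter> B = {} \<Longrightarrow> lin p q c"
    and Bcor: "\<And>b. b \<in> B \<Longrightarrow> 0 < b \<and> b < real m \<Longrightarrow> \<exists>f g. left_vel \<sigma> b f \<and> right_vel \<sigma> b g \<and> cr f g \<noteq> 0"
    using co unfolding cornered_def \<sigma>_def by auto
  have iV: "\<i> \<in> V" by (simp add: V_def dirs_def)
  have \<sigma>n: "\<sigma> (real n) = \<sigma> 0" using cl by (simp add: \<sigma>_def closed_pl_def)
  have G1: "cr (e i) v \<noteq> 0" if "m \<le> i" "i < n - 1" "v \<in> V" for i v
    using gen that unfolding generic_edges_def V_def e_def \<sigma>_def by blast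
  have G2: "cr (e i) (\<sigma> p - \<sigma> (real i)) \<noteq> 0" if "m \<le> i" "i < n - 1" "p \<in> B" "\<sigma> p \<noteq> \<sigma> (real i)" for i p
    using gen that unfolding generic_edges_def e_def \<sigma>_def by blast
  have H: "cr (\<sigma> (real i) - \<sigma> p) v \<noteq> 0" if "m < i" "i \<le> n - 1" "p \<in> B" "v \<in> V" for i p v
    using gen that unfolding generic_edges_def V_def \<sigma>_def by blast
  have last: "e (n - 1) = - (\<sigma> (real (n - 1)) - \<sigma> 0)"
    using \<sigma>n mn by (simp add: e_def of_nat_diff)
  have cr_minus: "cr (- a) b = - cr a b" for a b by (simp add: cr_def)
  have L1: "cr (e (n - 1)) v \<noteq> 0" if "v \<in> V" for v
  proof -
    have "cr (\<sigma> (real (n - 1)) - \<sigma> 0) v \<noteq> 0"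
      using gen that unfolding generic_edges_def V_def \<sigma>_def by blast
    then show ?thesis unfolding last cr_minus by simp
  qed
  have L2: "cr (e (n - 1)) (\<sigma> p - \<sigma> 0) \<noteq> 0" if "p \<in> B" "p \<noteq> 0" for p
  proof -
    have "cr (\<sigma> (real (n - 1)) - \<sigma> 0) (\<sigma> p - \<sigma> 0) \<noteq> 0"
      using gen that unfolding generic_edges_def \<sigma>_def by blast
    then show ?thesis unfolding last cr_minus by simp
  qed
  have eV: "cr (e i) v \<noteq> 0" if "m \<le> i" "i < n" "v \<in> V" for i v
    using G1 [of i v] L1 [of v] that by (cases "i = n - 1") auto
  have e0: "e i \<noteq> 0" if "m \<le> i" "i < n" for i
    using eV [OF that iV] by (auto simp: cr_def)
  have edge: "\<sigma> s = \<sigma> (real i) + (s - real i) *\<^sub>R e i" 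
    if i: "m \<le> i" "i < n" and s: "real i \<le> s" "s \<le> real i + 1" for i s
  proof -
    have "lin (real i) (real i + 1) \<sigma>" unfolding \<sigma>_def by (rule lin_linear [OF linear_pr lin [OF i]])
    from lin_eq [OF this _ s] show ?thesis by (simp add: e_def)
  qed
  have velR: "\<exists>g. right_vel \<sigma> t g \<and> (\<exists>v\<in>V. \<exists>k. k \<noteq> 0 \<and> g = k *\<^sub>R v)" if t: "0 \<le> t" "t < real m" for t
  proof -
    obtain p q where pq: "p \<in> B" "q \<in> B" "p \<le> t" "t < q" "lin p q c" by (rule cornered_pieceR [OF co t])
    have "lin p q \<sigma>" unfolding \<sigma>_def by (rule lin_linear [OF linear_pr pq(5)])
    then have "right_vel \<sigma> t ((\<sigma> q - \<sigma> p) /\<^sub>R (q - p))" using pq by (intro lin_right_vel) auto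
    moreover have "\<sigma> q - \<sigma> p \<in> V" using pq unfolding V_def dirs_def \<sigma>_def by force
    moreover have "inverse (q - p) \<noteq> 0" using pq by simp
    ultimately show ?thesis by blast
  qed
  have velL: "\<exists>g. left_vel \<sigma> t g \<and> (\<exists>v\<in>V. \<exists>k. k \<noteq> 0 \<and> g = k *\<^sub>R v)" if t: "0 < t" "t \<le> real m" for t
  proof -
    obtain p q where pq: "p \<in> B" "q \<in> B" "p < t" "t \<le> q" "lin p q c" by (rule cornered_pieceL [OF co t])
    have "lin p q \<sigma>" unfolding \<sigma>_def by (rule lin_linear [OF linear_pr pq(5)])
    then have "left_vel \<sigma> t ((\<sigma> q - \<sigma> p) /\<^sub>R (q - p))" using pq by (intro lin_left_vel) auto
    moreover have "\<sigma> q - \<sigma> p \<in> V" using pq unfolding V_def dirs_def \<sigma>_def by force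
    moreover have "inverse (q - p) \<noteq> 0" using pq by simp
    ultimately show ?thesis by blast
  qed
  have onT: "\<exists>p\<in>B. \<exists>v\<in>V. cr (\<sigma> t - \<sigma> p) v = 0" if t: "0 \<le> t" "t \<le> real m" for t
    using on_arc_dirs [OF co t] unfolding V_def \<sigma>_def .
  have fin_edge: "finite {s \<in> {real i..real i + 1}. \<sigma> s \<in> \<sigma> ` {0..real m}}" if i: "m \<le> i" "i < n" for i
  proof -
    have "finite {x. (\<sigma> (real i) - real i *\<^sub>R e i) + x *\<^sub>R e i \<in> \<sigma> ` {0..real m}}"
      using finite_line_meets_arc [OF co, of "e i"] eV [OF i] unfolding V_def \<sigma>_def by blast
    then show ?thesis
    proof (rule rev_finite_subset)
      show "{s \<in> {real i..real i + 1}. \<sigma> s \<in> \<sigma> ` {0..real m}}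
        \<subseteq> {x. (\<sigma> (real i) - real i *\<^sub>R e i) + x *\<^sub>R e i \<in> \<sigma> ` {0..real m}}"
      proof
        fix s assume s: "s \<in> {s \<in> {real i..real i + 1}. \<sigma> s \<in> \<sigma> ` {0..real m}}"
        then have "\<sigma> s = (\<sigma> (real i) - real i *\<^sub>R e i) + s *\<^sub>R e i"
          using edge [OF i, of s] by (simp add: algebra_simps)
        then show "s \<in> {x. (\<sigma> (real i) - real i *\<^sub>R e i) + x *\<^sub>R e i \<in> \<sigma> ` {0..real m}}"
          using s by simp
      qed
    qed
  qed
  define M where "M = insert (real m + 1) B"
  have rm: "\<sigma> s = \<sigma> (real m) + (s - real m) *\<^sub>R e m" if "real m \<le> s" "s \<le> real m + 1" for s
    using edge [of m s] that mn by simp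
  have em0: "e m \<noteq> 0" using e0 mn by simp
  have rvm: "right_vel \<sigma> s (e m)" if s: "real m \<le> s" "s < real m + 1" for s
    unfolding right_vel_def
  proof (intro exI [of _ "real m + 1 - s"] conjI ballI)
    fix x assume x: "x \<in> {0..real m + 1 - s}"
    have 1: "\<sigma> s = \<sigma> (real m) + (s - real m) *\<^sub>R e m" by (rule rm) (use s in auto)
    have 2: "\<sigma> (s + x) = \<sigma> (real m) + (s + x - real m) *\<^sub>R e m" by (rule rm) (use s x in auto)
    show "\<sigma> (s + x) = \<sigma> s + x *\<^sub>R e m" unfolding 1 2 by (simp add: algebra_simps)
  qed (use s in simp)
  have co': "cornered M (real m + 1) c"
    unfolding cornered_def
  proof (intro conjI allI impI ballI)
    show "finite M" "{0, real m + 1} \<subseteq> M" "M \<subseteq> {0..real m + 1}" using B by (auto simp: M_def)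
    fix p q assume pq: "0 \<le> p \<and> p \<le> q \<and> q \<le> real m + 1 \<and> {p<..<q} \<inter> M = {}"
    have "real m \<notin> {p<..<q}" using pq B by (auto simp: M_def)
    then consider "q \<le> real m" | "real m \<le> p" by fastforce
    then show "lin p q c"
    proof cases
      case 1
      then show ?thesis using pq by (intro Blin) (auto simp: M_def)
    next
      case 2
      then show ?thesis using pq mn by (intro lin_subset [OF lin [of m]]) auto
    qed
  next
    fix b assume b: "b \<in> M" "0 < b \<and> b < real m + 1"
    then have bB: "b \<in> B" "0 < b" "b \<le> real m" using B by (auto simp: M_def)
    have "\<exists>f g. left_vel \<sigma> b f \<and> right_vel \<sigma> b g \<and> cr f g \<noteq> 0"
    proof (cases "b < real m")
      case True
      then show ?thesis using Bcor bB by auto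
    next
      case False
      then have bm: "b = real m" using bB by simp
      obtain g v k where g: "left_vel \<sigma> b g" "v \<in> V" "k \<noteq> 0" "g = k *\<^sub>R v" using velL bB by blast
      have "cr g (e m) \<noteq> 0" using eV [of m v] g mn cr_swap [of "e m" v] by (simp add: cr_scale)
      then show ?thesis using g(1) rvm [of b] bm by auto
    qed
    then show "\<exists>f g. left_vel (\<lambda>t. pr (c t)) b f \<and> right_vel (\<lambda>t. pr (c t)) b g \<and> cr f g \<noteq> 0"
      by (simp add: \<sigma>_def)
  qed
  have cross: "s \<notin> M \<and> t \<notin> M \<and> (\<exists>a g. right_vel \<sigma> s a \<and> right_vel \<sigma> t g \<and> cr a g \<noteq> 0)"
    if s: "s \<in> {real m<..real m + 1}" and t: "t \<in> {0..real m}" and eq: "\<sigma> s = \<sigma> t" for s t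
  proof -
    have tm: "t \<noteq> real m"
    proof
      assume "t = real m"
      then have "(s - real m) *\<^sub>R e m = 0" using rm [of s] s eq by simp
      then show False using em0 s by simp
    qed
    have "t \<notin> B"
    proof
      assume tB: "t \<in> B"
      have "\<sigma> t \<noteq> \<sigma> (real m)" using inj_onD [OF inj, of t "real m"] tm t by (auto simp: \<sigma>_def)
      then have "cr (e m) (\<sigma> t - \<sigma> (real m)) \<noteq> 0" using G2 [of m t] tB mn by simp
      moreover have "\<sigma> t - \<sigma> (real m) = (s - real m) *\<^sub>R e m" using rm [of s] s eq by simp
      ultimately show False by (simp add: cr_scale)
    qed
    moreover have "s \<noteq> real m + 1"
    proof
      assume "s = real m + 1"
      then have "\<sigma> t = \<sigma> (real (m + 1))" using eq by (simp add: add.commute)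
      moreover obtain p v where "p \<in> B" "v \<in> V" "cr (\<sigma> t - \<sigma> p) v = 0" using onT [of t] t by auto
      moreover have "m + 1 \<le> n - 1" using mn by simp
      ultimately show False using H [of "m + 1" p v] by simp
    qed
    moreover have "s \<notin> B" using s B by auto
    moreover obtain g v k where g: "right_vel \<sigma> t g" "v \<in> V" "k \<noteq> 0" "g = k *\<^sub>R v"
      using velR [of t] t tm by auto
    moreover have "right_vel \<sigma> s (e m)" using rvm s \<open>s \<noteq> real m + 1\<close> by simp
    moreover have "cr (e m) g \<noteq> 0" using eV [of m v] mn g by (simp add: cr_scale)
    moreover have "t \<noteq> real m + 1" using t by simp
    ultimately show ?thesis unfolding M_def by blast
  qed
  have finX: "finite (meets (real m) c)"
  proof -
    have "meets (real m) c \<subseteq> {s \<in> {real m..real m + 1}. \<sigma> s \<in> \<sigma> ` {0..real m}}"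
      by (auto simp: meets_def \<sigma>_def)
    then show ?thesis using fin_edge [of m] mn by (simp add: finite_subset)
  qed
  have floor: "\<exists>i. m + 1 \<le> i \<and> i < n \<and> real i \<le> s \<and> s < real i + 1" if s: "s \<in> {real m + 1<..<real n}" for s
  proof -
    have 1: "int m + 1 \<le> \<lfloor>s\<rfloor>" "\<lfloor>s\<rfloor> < int n" using s by (auto simp: le_floor_iff floor_less_iff)
    then have "real (nat \<lfloor>s\<rfloor>) = of_int \<lfloor>s\<rfloor>" by simp
    then show ?thesis using 1 s by (intro exI [of _ "nat \<lfloor>s\<rfloor>"]) (auto simp: nat_less_iff le_nat_iff)
  qed
  have finR: "finite {s \<in> {real m + 1<..<real n}. \<sigma> s \<in> \<sigma> ` {0..real m}}"
  proof (rule finite_subset)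
    show "{s \<in> {real m + 1<..<real n}. \<sigma> s \<in> \<sigma> ` {0..real m}} \<subseteq>
      (\<Union>i\<in>{m..<n}. {s \<in> {real i..real i + 1}. \<sigma> s \<in> \<sigma> ` {0..real m}})"
    proof
      fix s assume s: "s \<in> {s \<in> {real m + 1<..<real n}. \<sigma> s \<in> \<sigma> ` {0..real m}}"
      then obtain i where "m + 1 \<le> i" "i < n" "real i \<le> s" "s < real i + 1" using floor by blast
      then show "s \<in> (\<Union>i\<in>{m..<n}. {s \<in> {real i..real i + 1}. \<sigma> s \<in> \<sigma> ` {0..real m}})"
        using s by (intro UN_I [of i]) auto
    qed
    show "finite (\<Union>i\<in>{m..<n}. {s \<in> {real i..real i + 1}. \<sigma> s \<in> \<sigma> ` {0..real m}})"
      using fin_edge by auto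
  qed
  \<comment> \<open>Otherwise \<open>b\<close> would lie on the line of the edge \<open>i\<close>.
    Seen from the start of the edge this contradicts \<open>G2\<close>; for the closing edge, seen
    from vertex 0, it contradicts \<open>L2\<close>.\<close>
  have BR: "\<sigma> s \<noteq> \<sigma> b" if b: "b \<in> M \<inter> {0..real m}" and s: "s \<in> {real m + 1<..<real n}" for b s
  proof
    assume eq: "\<sigma> s = \<sigma> b"
    have bB: "b \<in> B" using b by (auto simp: M_def)
    obtain i where i: "m + 1 \<le> i" "i < n" "real i \<le> s" "s < real i + 1" using floor [OF s] by blast
    have \<sigma>s: "\<sigma> s = \<sigma> (real i) + (s - real i) *\<^sub>R e i" using edge [of i s] i by simp
    have "m < i" "i \<le> n - 1" using i by auto
    then have "cr (\<sigma> (real i) - \<sigma> b) \<i> \<noteq> 0" using bB iV by (rule H)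
    then have ib: "\<sigma> (real i) \<noteq> \<sigma> b" by (auto simp: cr_def)
    have b2: "\<sigma> b - \<sigma> (real i) = (s - real i) *\<^sub>R e i" unfolding eq [symmetric] \<sigma>s by simp
    show False
    proof (cases "i = n - 1")
      case False
      then have "m \<le> i" "i < n - 1" using i by auto
      then have "cr (e i) (\<sigma> b - \<sigma> (real i)) \<noteq> 0" using bB ib [symmetric] by (rule G2)
      then show False unfolding b2 by (simp add: cr_scale)
    next
      case True
      have "\<sigma> (real i) = \<sigma> 0 - e i" using last True by simp
      then have b3: "\<sigma> b - \<sigma> 0 = (s - real i - 1) *\<^sub>R e i" using b2 by (simp add: algebra_simps)
      show False
      proof (cases "b = 0")
        case True
        then show False using b3 e0 [of i] i by simp
      next
        case False
        then have "cr (e i) (\<sigma> b - \<sigma> 0) \<noteq> 0" using L2 [of b] bB \<open>i = n - 1\<close> by simp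
        then show False unfolding b3 by (simp add: cr_scale)
      qed
    qed
  qed
  have cE: "\<exists>f g. left_vel \<sigma> (real n) f \<and> right_vel \<sigma> 0 g \<and> cr f g \<noteq> 0" if m0: "0 < real m"
  proof -
    obtain g v k where g: "right_vel \<sigma> 0 g" "v \<in> V" "k \<noteq> 0" "g = k *\<^sub>R v" using velR [of 0] m0 by auto
    have r1: "real (n - 1) + 1 = real n" using mn by simp
    have "left_vel \<sigma> (real n) (e (n - 1))"
      unfolding left_vel_def
    proof (intro exI [of _ 1] conjI ballI)
      fix x :: real assume x: "x \<in> {0..1}"
      have 1: "\<sigma> (real n - x) = \<sigma> (real (n - 1)) + (real n - x - real (n - 1)) *\<^sub>R e (n - 1)"
        using x mn r1 by (intro edge) auto
      have 2: "\<sigma> (real n) = \<sigma> (real (n - 1)) + (real n - real (n - 1)) *\<^sub>R e (n - 1)"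
        using mn r1 by (intro edge) auto
      show "\<sigma> (real n - x) = \<sigma> (real n) - x *\<^sub>R e (n - 1)" unfolding 1 2 by (simp add: algebra_simps)
    qed simp
    moreover have "cr (e (n - 1)) g \<noteq> 0" using g eV [of "n - 1" v] mn by (simp add: cr_scale)
    ultimately show ?thesis using g(1) by blast
  qed
  have injX: "inj_on \<sigma> {real m..real m + 1}"
  proof (rule inj_onI)
    fix s t assume "s \<in> {real m..real m + 1}" "t \<in> {real m..real m + 1}" "\<sigma> s = \<sigma> t"
    then have "(s - real m) *\<^sub>R e m = (t - real m) *\<^sub>R e m" using rm [of s] rm [of t] by simp
    then show "s = t" using em0 by simp
  qed
  have P: "pr (c s) = \<sigma> s" for s by (simp add: \<sigma>_def)
  have "real m + 1 < real n" using mn by simp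
  have inj': "inj_on \<sigma> {0..real m}" using inj by (simp add: \<sigma>_def)
  show ?thesis
    unfolding snake_def P M_def [symmetric]
  proof (intro conjI ballI impI)
    show "real m \<in> M" using B by (simp add: M_def)
    show "s \<notin> M" "t \<notin> M" "\<exists>a g. right_vel \<sigma> s a \<and> right_vel \<sigma> t g \<and> cr a g \<noteq> 0"
      if "s \<in> {real m<..real m+1}" "t \<in> {0..real m}" "\<sigma> s = \<sigma> t" for s t
      using cross [OF that] by blast+
    show "\<sigma> s \<noteq> \<sigma> b" if "b \<in> M \<inter> {0..real m}" "s \<in> {real m+1<..<real n}" for b s by (rule BR [OF that])
    show "\<exists>e g. left_vel \<sigma> (real n) e \<and> right_vel \<sigma> 0 g \<and> cr e g \<noteq> 0" if "0 < real m" by (rule cE [OF that])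
    show "0 \<le> real m" by simp
  qed (rule cl \<open>real m + 1 < real n\<close> co' inj' injX finX finR)+
qed

text \<open>Clearing changes the curve only inside \<open>{m<..<m+1}\<close>, so the arc with simple
  projection becomes one unit longer and the later edges stay linear. The direction
  \<open>\<i>\<close> among the generic conditions yields the claim on second coordinates, which
  makes that coordinate strictly monotone along the closing edge in the end.\<close>

lemma grow:
  assumes g: "grown n m c B" and mn: "m + 1 < n"
  obtains c' B' where "grown n (Suc m) c' B'"
    "ambient_isotopic (Some ` c ` {0..<real n}) (Some ` c' ` {0..<real n})"
    "c' (real (n - 1)) $ 2 \<noteq> c' (real n) $ 2"
proof -
  obtain c1 where c1: "closed_pl (real n) c1" and iso: "ambient_isotopic (Some ` c ` {0..<real n}) (Some ` c1 ` {0..<real n})"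
    and same: "\<And>t. t \<le> real m \<or> t \<ge> real n \<Longrightarrow> c1 t = c t"
    and lin1: "\<And>i. m \<le> i \<Longrightarrow> i < n \<Longrightarrow> lin (real i) (real i + 1) c1" and gen: "generic_edges n m B (n - 1) (\<lambda>t. pr (c1 t))"
  proof -
    have g': "closed_pl (real n) c" "finite B" "0 \<in> B" "B \<subseteq> {0..real m}" "inj_on (\<lambda>t. pr (c t)) B"
      "\<And>i. m \<le> i \<Longrightarrow> i < n \<Longrightarrow> lin (real i) (real i + 1) c"
      using g inj_on_subset by (auto simp: grown_def cornered_def)
    have "m \<le> n - 1" using mn by simp
    then show ?thesis
      using perturb_vertices [OF g'(1,6) mn _ order_refl g'(2-5) linear_pr pr_lift norm_lift, of "\<lambda>_. True"] that
        zero_less_one by blast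
  qed
  have co: "cornered B (real m) c" and inj: "inj_on (\<lambda>t. pr (c t)) {0..real m}" using g by (auto simp: grown_def)
  have B: "B \<subseteq> {0..real m}" using co by (simp add: cornered_def)
  have inj1: "inj_on (\<lambda>t. pr (c1 t)) {0..real m}"
    using inj by (rule inj_on_cong [THEN iffD1, rotated]) (simp add: same)
  have co1: "cornered B (real m) c1" by (rule cornered_cong [OF co]) (simp add: same)
  have "snake (real n) (real m) c1 (insert (real m + 1) B)"
    by (rule snake_of_generic_edges [OF c1 mn lin1 co1 inj1 gen])
  then obtain c2 B2 where sn2: "snake (real n) (real m) c2 B2" and same2: "\<And>t. t \<notin> {real m<..<real m + 1} \<Longrightarrow> c2 t = c1 t"
    and iso2: "ambient_isotopic (Some ` c1 ` {0..<real n}) (Some ` c2 ` {0..<real n})" and no: "meets (real m) c2 = {}"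
    by (rule snake_clear) (rule that)
  have sn: "closed_pl (real n) c2" "cornered B2 (real m + 1) c2"
      "inj_on (\<lambda>t. pr (c2 t)) {0..real m}" "inj_on (\<lambda>t. pr (c2 t)) {real m..real m + 1}"
    using sn2 by (simp_all add: snake_def)
  have no': "pr (c2 s) \<noteq> pr (c2 t)" if "s \<in> {real m<..real m + 1}" "t \<in> {0..real m}" for s t
    using no that by (auto simp: meets_def)
  have inj2: "inj_on (\<lambda>t. pr (c2 t)) {0..real m + 1}"
  proof (rule inj_onI)
    fix s t assume st: "s \<in> {0..real m + 1}" "t \<in> {0..real m + 1}" "pr (c2 s) = pr (c2 t)"
    consider "s \<le> real m" "t \<le> real m" | "real m < s" "t \<le> real m" | "s \<le> real m" "real m < t" | "real m < s" "real m < t"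
      by linarith
    then show "s = t"
    proof cases
      case 1
      then show ?thesis using st inj_onD [OF sn(3)] by auto
    next
      case 2
      then show ?thesis using st no' [of s t] by auto
    next
      case 3
      then show ?thesis using st no' [of t s] by auto
    next
      case 4
      then show ?thesis using st inj_onD [OF sn(4)] by auto
    qed
  qed
  have lin2: "lin (real j) (real j + 1) c2" if "Suc m \<le> j" "j < n" for j
  proof (rule lin_cong)
    show "lin (real j) (real j + 1) c1" using lin1 that by simp
    show "c2 t = c1 t" if "real j \<le> t" "t \<le> real j + 1" for t
      using same2 [of t] that \<open>Suc m \<le> j\<close> by auto
  qed
  have Sm: "real (Suc m) = real m + 1" by simp
  have "grown n (Suc m) c2 B2"
    unfolding grown_def Sm using sn inj2 lin2 mn by auto
  moreover have "ambient_isotopic (Some ` c ` {0..<real n}) (Some ` c2 ` {0..<real n})"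
    by (rule ambient_isotopic_trans [OF iso iso2])
  moreover have "c2 (real (n - 1)) $ 2 \<noteq> c2 (real n) $ 2"
  proof -
    have "real (n - 1) \<notin> {real m<..<real m + 1}" "real n \<notin> {real m<..<real m + 1}" using mn by auto
    then have eq: "c2 (real (n - 1)) = c1 (real (n - 1))" "c2 (real n) = c1 (real n)" using same2 by blast+
    have "c1 (real n) = c1 0" using c1 by (simp add: closed_pl_def)
    moreover have "cr (pr (c1 (real (n - 1))) - pr (c1 0)) \<i> \<noteq> 0"
      using gen unfolding generic_edges_def dirs_def by auto
    ultimately show ?thesis unfolding eq by (auto simp: cr_def pr_def)
  qed
  ultimately show ?thesis by (rule that)
qed

section \<open>Flattening\<close>

lemma fully_grown:
  assumes g: "grown n 0 c {0}" and n: "3 \<le> n"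
  obtains c' B where "grown n (n - 1) c' B" "ambient_isotopic (Some ` c ` {0..<real n}) (Some ` c' ` {0..<real n})"
    "c' (real (n - 1)) $ 2 \<noteq> c' (real n) $ 2"
proof -
  have "\<exists>c' B. grown n (Suc m) c' B \<and> ambient_isotopic (Some ` c ` {0..<real n}) (Some ` c' ` {0..<real n}) \<and>
      c' (real (n - 1)) $ 2 \<noteq> c' (real n) $ 2" if "Suc m < n" for m
    using that
  proof (induction m)
    case 0
    then have "0 + 1 < n" by simp
    then obtain c' B' where "grown n (Suc 0) c' B'"
      "ambient_isotopic (Some ` c ` {0..<real n}) (Some ` c' ` {0..<real n})" "c' (real (n - 1)) $ 2 \<noteq> c' (real n) $ 2"
      by (rule grow [OF g])
    then show ?case by blast
  next
    case (Suc m)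
    then obtain c1 B1 where 1: "grown n (Suc m) c1 B1" "ambient_isotopic (Some ` c ` {0..<real n}) (Some ` c1 ` {0..<real n})"
      by auto
    have "Suc m + 1 < n" using Suc by simp
    then obtain c' B' where "grown n (Suc (Suc m)) c' B'"
      "ambient_isotopic (Some ` c1 ` {0..<real n}) (Some ` c' ` {0..<real n})" "c' (real (n - 1)) $ 2 \<noteq> c' (real n) $ 2"
      by (rule grow [OF 1(1)])
    then show ?case using ambient_isotopic_trans [OF 1(2)] by blast
  qed
  from this [of "n - 2"] show ?thesis using that n by (auto simp: Suc_diff_Suc numeral_2_eq_2)
qed

lemma closed_pl_reparametrise:
  fixes \<phi> :: "real \<Rightarrow> real"
  assumes c: "closed_pl N c" and \<phi>: "pl 0 K \<phi>" "strict_mono_on {0..K} \<phi>" "\<phi> 0 = 0" "\<phi> K = N" and K: "0 < K"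
  shows "closed_pl K (\<lambda>t. c (\<phi> t))" "(\<lambda>t. c (\<phi> t)) ` {0..<K} = c ` {0..<N}"
proof -
  have range: "\<phi> t \<in> {0..N}" if "0 \<le> t" "t \<le> K" for t
    using strict_mono_on_leD [OF \<phi>(2), of 0 t] strict_mono_on_leD [OF \<phi>(2), of t K] that \<phi> by auto
  have lt: "\<phi> t < N" if "0 \<le> t" "t < K" for t
    using strict_mono_onD [OF \<phi>(2), of t K] that \<phi> by auto
  have inj: "inj_on \<phi> {0..<K}"
    by (rule inj_on_subset [OF strict_mono_on_imp_inj_on [OF \<phi>(2)]]) auto
  have img: "\<phi> ` {0..<K} = {0..<N}"
  proof
    show "\<phi> ` {0..<K} \<subseteq> {0..<N}" using range lt by fastforce
    show "{0..<N} \<subseteq> \<phi> ` {0..<K}"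
    proof
      fix y assume y: "y \<in> {0..<N}"
      then obtain t where "0 \<le> t" "t \<le> K" "\<phi> t = y"
        using IVT' [of \<phi> 0 y K] pl_continuous_on [OF \<phi>(1)] \<phi> K by auto
      then show "y \<in> \<phi> ` {0..<K}" using y \<phi>(4) by (intro image_eqI [of _ _ t]) (auto simp: less_le)
    qed
  qed
  have "pl 0 K (\<lambda>t. c (\<phi> t))"
    by (rule pl_compose [OF \<phi>(1) range]) (use c in \<open>auto simp: closed_pl_def\<close>)
  moreover have "inj_on (\<lambda>t. c (\<phi> t)) {0..<K}"
    using comp_inj_on [OF inj, of c] c img by (simp add: closed_pl_def o_def)
  ultimately show "closed_pl K (\<lambda>t. c (\<phi> t))" using c \<phi> K by (simp add: closed_pl_def)
  show "(\<lambda>t. c (\<phi> t)) ` {0..<K} = c ` {0..<N}" using img by (metis image_image)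
qed

section \<open>Prescribing heights at the crossings\<close>

lemma interpolation:
  fixes v :: "real \<Rightarrow> real"
  assumes MN: "0 < M" "M < N" and S: "finite S" "S \<subseteq> {M<..<N}" and v: "\<And>s. s \<in> S \<Longrightarrow> 0 < v s \<and> v s < M"
  shows "\<exists>X. pl M N X \<and> X M = M \<and> X N = 0 \<and> (\<forall>s\<in>S. X s = v s) \<and> (\<forall>t\<in>{M<..<N}. 0 < X t \<and> X t < M)"
  using S v
proof (induction rule: finite_induct)
  case empty
  define X where "X = (\<lambda>t. M * N / (N - M) + t *\<^sub>R (- M / (N - M)))"
  have X: "X t = M * ((N - t) / (N - M))" for t
    by (simp add: X_def diff_divide_distrib right_diff_distrib mult.commute)
  have "lin M N X" unfolding lin_def X_def by blast
  then have "pl M N X" by (rule lin_imp_pl)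
  moreover have "0 < X t \<and> X t < M" if "t \<in> {M<..<N}" for t
    using that MN unfolding X by (simp add: field_simps)
  moreover have "X M = M" "X N = 0" using MN by (simp_all add: X)
  ultimately show ?case by blast
next
  case (insert s S)
  then obtain X where X: "pl M N X" "X M = M" "X N = 0" "\<And>s. s \<in> S \<Longrightarrow> X s = v s"
    "\<And>t. t \<in> {M<..<N} \<Longrightarrow> 0 < X t \<and> X t < M" by auto
  obtain L where L: "0 \<le> L" "\<And>a b. a \<in> {M..N} \<Longrightarrow> b \<in> {M..N} \<Longrightarrow> norm (X a - X b) \<le> L * \<bar>a - b\<bar>"
    using pl_Lipschitz [OF X(1)] MN by auto
  have fS: "finite (S \<union> {M, N})" using insert by simp
  obtain r1 where r1: "0 < r1" "\<And>b. b \<in> S \<union> {M, N} \<Longrightarrow> b \<noteq> s \<Longrightarrow> r1 \<le> \<bar>b - s\<bar>"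
    by (rule finite_gap [OF fS, of s]) (rule that)
  have s: "M < s" "s < N" and vs: "0 < v s" "v s < M" using insert by auto
  have Xs: "0 < X s" "X s < M" using X(5) [of s] s by auto
  \<comment> \<open>The margin that both the old and the prescribed value keep from \<open>0\<close>
    and \<open>M\<close>. The width \<open>r\<close> makes \<open>X\<close> drift by less than this
    on the support of the tent, so mixtures of the two values remain strictly inside.\<close>
  define \<delta> where "\<delta> = min (min (v s) (X s)) (min (M - v s) (M - X s))"
  have \<delta>: "0 < \<delta>" using vs Xs by (simp add: \<delta>_def)
  define r where "r = min r1 (\<delta> / (2 * (L + 1)))"
  have r: "0 < r" "r \<le> r1" using r1 \<delta> L by (auto simp: r_def)
  have "L * r \<le> L * (\<delta> / (2 * (L + 1)))" using L by (intro mult_left_mono) (auto simp: r_def)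
  also have "\<dots> < \<delta>" using L \<delta> by (simp add: field_simps add_strict_increasing)
  finally have Lr: "L * r < \<delta>" .
  define Y where "Y = (\<lambda>t. X t + tent r (t - s) *\<^sub>R (v s - X s))"
  have Y0: "Y t = X t" if "t \<in> S \<union> {M, N}" for t
  proof -
    have "t \<noteq> s" using that insert s by auto
    then have "r \<le> \<bar>t - s\<bar>" using r1(2) [OF that] r by simp
    then show ?thesis using r by (simp add: Y_def tent_eq_0)
  qed
  have "pl M N Y" unfolding Y_def by (intro pl_add X pl_scaleR_left pl_tent r)
  moreover have "Y M = M" "Y N = 0" "\<forall>t\<in>insert s S. Y t = v t"
    using Y0 X(2-4) by (auto simp: Y_def)
  moreover have "0 < Y t \<and> Y t < M" if t: "t \<in> {M<..<N}" for t
  proof (cases "r \<le> \<bar>t - s\<bar>")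
    case True
    then show ?thesis using X(5) [OF t] r by (simp add: Y_def tent_eq_0)
  next
    case False
    define \<tau> where "\<tau> = tent r (t - s)"
    have \<tau>: "0 \<le> \<tau>" "\<tau> \<le> 1" using r by (simp_all add: \<tau>_def tent_nonneg tent_le_1)
    have "\<bar>X t - X s\<bar> \<le> L * \<bar>t - s\<bar>" using L(2) [of t s] t s by simp
    also have "\<dots> \<le> L * r" using False L by (intro mult_left_mono) auto
    finally have d: "\<bar>X t - X s\<bar> < \<delta>" using Lr by simp
    define lo where "lo = min (v s) (X s)"
    define hi where "hi = max (v s) (X s)"
    have "\<delta> \<le> lo" "hi + \<delta> \<le> M" by (auto simp: \<delta>_def lo_def hi_def)
    have "(1 - \<tau>) * lo + \<tau> * lo \<le> (1 - \<tau>) * X s + \<tau> * v s"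
      using \<tau> by (intro add_mono mult_left_mono) (auto simp: lo_def)
    then have a: "lo \<le> (1 - \<tau>) * X s + \<tau> * v s" by (simp add: algebra_simps)
    have "(1 - \<tau>) * X s + \<tau> * v s \<le> (1 - \<tau>) * hi + \<tau> * hi"
      using \<tau> by (intro add_mono mult_left_mono) (auto simp: hi_def)
    then have b: "(1 - \<tau>) * X s + \<tau> * v s \<le> hi" by (simp add: algebra_simps)
    have "Y t = ((1 - \<tau>) * X s + \<tau> * v s) + (X t - X s)" by (simp add: Y_def \<tau>_def algebra_simps)
    then show ?thesis using a b d \<open>\<delta> \<le> lo\<close> \<open>hi + \<delta> \<le> M\<close> by linarith
  qed
  ultimately show ?case by blast
qed

text \<open>After \<open>M\<close> the curve returns from the end of the straight segment to its
  beginning. Its confinement between the two ends in the first coordinate is what makes the position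
  contained.\<close>

definition flat :: "real \<Rightarrow> real \<Rightarrow> (real \<Rightarrow> real^3) \<Rightarrow> bool" where
  "flat N M c \<longleftrightarrow> closed_pl N c \<and> 0 < M \<and> M < N \<and> (\<forall>t\<in>{0..M}. c t $ 1 = t \<and> c t $ 2 = 0) \<and>
    (\<forall>t\<in>{M<..<N}. 0 < c t $ 1 \<and> c t $ 1 < M) \<and> inj_on (\<lambda>t. shadow (c t)) {M..N}"

lemma shadow_eq_iff: "shadow v = shadow w \<longleftrightarrow> v $ 1 = w $ 1 \<and> v $ 2 = w $ 2"
  by (auto simp: shadow_def vec_eq_iff forall_2)

lemma linear_nth: "linear (\<lambda>v :: real^3. v $ i)"
  by (rule linearI) auto

lemma axis_nth: "(axis i x :: real^3) $ j = (if j = i then x else 0)"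
  by (simp add: axis_def)

text \<open>First the first coordinate is moved to \<open>X\<close>, preserving its order at each coincidence of the
  other two coordinates; then the first sub-arc is sheared into the plane where the second
  coordinate vanishes.\<close>

lemma flatten:
  assumes cl: "closed_pl N c" and MN: "0 < M" "M < N"
    and T: "inj_on (\<lambda>t. pr (c t)) {0..M}" and E: "inj_on (\<lambda>t. c t $ 2) {M..N}"
    and fin: "finite {s \<in> {M<..<N}. pr (c s) \<in> (\<lambda>t. pr (c t)) ` {0..M}}"
  obtains c' where "flat N M c'" "ambient_isotopic (Some ` c ` {0..<N}) (Some ` c' ` {0..<N})"
proof -
  define S where "S = {s \<in> {M<..<N}. pr (c s) \<in> (\<lambda>t. pr (c t)) ` {0..M}}"
  have plc: "pl 0 N c" and c0N: "c 0 = c N" and injc: "inj_on c {0..<N}" using cl by (auto simp: closed_pl_def)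
  have "\<exists>\<tau>. \<forall>s\<in>S. \<tau> s \<in> {0..M} \<and> pr (c s) = pr (c (\<tau> s))"
    by (rule bchoice) (auto simp: S_def)
  then obtain \<tau> where \<tau>: "\<And>s. s \<in> S \<Longrightarrow> \<tau> s \<in> {0..M}" "\<And>s. s \<in> S \<Longrightarrow> pr (c s) = pr (c (\<tau> s))" by blast
  have \<tau>': "0 < \<tau> s \<and> \<tau> s < M" if s: "s \<in> S" for s
  proof -
    have sM: "M < s" "s < N" using s by (auto simp: S_def)
    have "c s $ 2 \<noteq> c M $ 2" "c s $ 2 \<noteq> c N $ 2" using inj_onD [OF E, of s M] inj_onD [OF E, of s N] sM by auto
    moreover have "c s $ 2 = c (\<tau> s) $ 2" using \<tau>(2) [OF s] by (simp add: pr_def)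
    ultimately have "\<tau> s \<noteq> M" "\<tau> s \<noteq> 0" using c0N by auto
    then show ?thesis using \<tau>(1) [OF s] by auto
  qed
  \<comment> \<open>At its time \<open>\<tau> s\<close> the arc gets the height
    \<open>\<tau> s\<close>. The new height of the other branch is halfway from there to
    \<open>M\<close> or to \<open>0\<close>, on the side on which it passed the arc before.\<close>
  define v where "v = (\<lambda>s. if c (\<tau> s) $ 1 < c s $ 1 then (\<tau> s + M) / 2 else \<tau> s / 2)"
  have v: "0 < v s \<and> v s < M" if "s \<in> S" for s using \<tau>' [OF that] by (auto simp: v_def)
  have S: "finite S" "S \<subseteq> {M<..<N}" using fin by (auto simp: S_def)
  from interpolation [OF MN S, of v] v obtain Y where Y: "pl M N Y" "Y M = M" "Y N = 0" "\<And>s. s \<in> S \<Longrightarrow> Y s = v s"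
    "\<And>t. t \<in> {M<..<N} \<Longrightarrow> 0 < Y t \<and> Y t < M" by blast
  define X where "X = (\<lambda>t. if t \<le> M then t else Y t)"
  have XT: "X t = t" if "t \<le> M" for t using that by (simp add: X_def)
  have XE: "X t = Y t" if "M \<le> t" for t using that Y by (auto simp: X_def)
  have plX: "pl 0 N X"
  proof (rule pl_trans)
    show "pl 0 M X" by (rule pl_cong [OF pl_ident]) (rule XT)
    show "pl M N X" by (rule pl_cong [OF Y(1)]) (rule XE)
  qed
  have X0N: "X 0 = 0" "X N = 0" using MN Y XT [of 0] XE [of N] by auto
  have Xin: "X t \<in> {0..M}" if "0 \<le> t" "t \<le> N" for t
    using that Y(2,3) Y(5) [of t] MN by (cases "t = N") (auto simp: X_def)
  have XE': "0 < X t \<and> X t < M" if "M < t" "t < N" for t using Y(5) [of t] that by (simp add: X_def)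
  \<comment> \<open>Of two points with the same projection one belongs to the arc and the other
    comes after it, since both parts project injectively; for such a pair \<open>v\<close> preserves
    the order of heights.\<close>
  have coincide: "0 < (c s $ 1 - c t $ 1) * (X s - X t)"
    if st: "t \<in> {0..<N}" "s \<in> {0..<N}" "pr (c s) = pr (c t)" "t < s" for s t
  proof -
    have 2: "c s $ 2 = c t $ 2" using st(3) by (simp add: pr_def)
    have sM: "M < s" using inj_onD [OF T, of s t] st by (force simp: not_less)
    have tM: "t < M" using inj_onD [OF E, of s t] st 2 by (force simp: not_less)
    have sS: "s \<in> S" using st sM tM by (auto simp: S_def)
    have "\<tau> s = t" using inj_onD [OF T, of "\<tau> s" t] \<tau> [OF sS] st tM by auto
    moreover have "c s $ 1 \<noteq> c t $ 1"
    proof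
      assume "c s $ 1 = c t $ 1"
      then have "c s = c t" using pr_eq_imp [OF st(3)] by (simp add: axis_def vec_eq_iff)
      then show False using inj_onD [OF injc, of s t] st by auto
    qed
    moreover have "X s = v s" "X t = t" using XE [of s] Y(4) [OF sS] sM XT [of t] tM by auto
    ultimately show ?thesis using \<tau>' [OF sS] by (auto simp: v_def zero_less_mult_iff)
  qed
  define d where "d = (\<lambda>t. axis 1 (X t - c t $ 1) :: real^3)"
  define c1 where "c1 = (\<lambda>t. c t + d t)"
  have d123: "d t $ 1 = X t - c t $ 1" "d t $ 2 = 0" "d t $ 3 = 0" for t by (simp_all add: d_def axis_nth)
  have c1: "c1 t $ 1 = X t" "c1 t $ 2 = c t $ 2" for t by (simp_all add: c1_def d123)
  have "linear (\<lambda>x :: real. axis 1 x :: real^3)"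
    by (rule linearI) (auto simp: axis_def vec_eq_iff)
  then have pld: "pl 0 N d" unfolding d_def
    by (rule pl_linear) (intro pl_diff plX pl_linear [OF linear_nth plc])
  have cl1: "closed_pl N (\<lambda>t. c t + \<theta> *\<^sub>R d t)" if \<theta>: "0 \<le> \<theta>" "\<theta> \<le> 1" for \<theta>
  proof -
    have "False" if st: "t \<in> {0..<N}" "s \<in> {0..<N}" "c s + \<theta> *\<^sub>R d s = c t + \<theta> *\<^sub>R d t" "t < s" for s t
    proof -
      have nth: "c s $ i + \<theta> * d s $ i = c t $ i + \<theta> * d t $ i" for i
        using arg_cong [OF st(3), of "\<lambda>v. v $ i"] by simp
      have "pr (c s) = pr (c t)" using nth [of 2] nth [of 3] by (simp add: pr_def d123)
      then have p: "0 < (c s $ 1 - c t $ 1) * (X s - X t)" using coincide st by blast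
      have "(1 - \<theta>) * (c s $ 1 - c t $ 1) + \<theta> * (X s - X t) = 0"
        using nth [of 1] by (simp add: d123 algebra_simps)
      \<comment> \<open>After multiplication by the old height difference both summands are
        nonnegative, and they cannot vanish together because \<open>p\<close> excludes a zero
        difference.\<close>
      then have z: "(1 - \<theta>) * (c s $ 1 - c t $ 1)\<^sup>2 + \<theta> * ((c s $ 1 - c t $ 1) * (X s - X t)) = 0"
        by algebra
      have nn: "0 \<le> (1 - \<theta>) * (c s $ 1 - c t $ 1)\<^sup>2" "0 \<le> \<theta> * ((c s $ 1 - c t $ 1) * (X s - X t))"
        by (rule mult_nonneg_nonneg; use \<theta> p in \<open>simp add: less_imp_le\<close>)+
      then have "\<theta> * ((c s $ 1 - c t $ 1) * (X s - X t)) = 0" "(1 - \<theta>) * (c s $ 1 - c t $ 1)\<^sup>2 = 0" using z by linarith+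
      then show False using p by auto
    qed
    then have "inj_on (\<lambda>t. c t + \<theta> *\<^sub>R d t) {0..<N}"
      unfolding inj_on_def by (metis linorder_neqE_linordered_idom)
    moreover have "pl 0 N (\<lambda>t. c t + \<theta> *\<^sub>R d t)"
      by (intro pl_add plc pl_linear [OF _ pld]) (auto simp: linear_iff algebra_simps)
    moreover have "d 0 = d N" using c0N X0N by (simp add: d_def)
    ultimately show ?thesis using MN c0N by (simp add: closed_pl_def)
  qed
  have iso1: "ambient_isotopic (Some ` c ` {0..<N}) (Some ` c1 ` {0..<N})"
    unfolding c1_def by (rule closed_pl_linear_isotopy [OF cl1 pld])
  have clc1: "closed_pl N c1" using cl1 [of 1] by (simp add: c1_def)
  \<comment> \<open>The arc passes the height \<open>X t\<close> at time \<open>X t\<close>, so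
    \<open>c (X t) $ 2\<close> is its second coordinate there. On the arc itself
    \<open>X t = t\<close>, and the second coordinate is cancelled.\<close>
  define e where "e = (\<lambda>t. axis 2 (- (c (X t) $ 2)) :: real^3)"
  define c2 where "c2 = (\<lambda>t. c1 t + e t)"
  have e123: "e t $ 1 = 0" "e t $ 2 = - (c (X t) $ 2)" "e t $ 3 = 0" for t by (simp_all add: e_def axis_nth)
  have "linear (\<lambda>x :: real. axis 2 x :: real^3)"
    by (rule linearI) (auto simp: axis_def vec_eq_iff)
  then have ple: "pl 0 N e" unfolding e_def
  proof (rule pl_linear)
    have "pl 0 M (\<lambda>t. - (c t $ 2))"
      using MN by (intro pl_uminus pl_linear [OF linear_nth] pl_subset [OF plc]) auto
    from pl_compose [OF plX Xin this] show "pl 0 N (\<lambda>t. - (c (X t) $ 2))" by simp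
  qed
  \<comment> \<open>The shift depends only on the first coordinate, which it preserves; so points
    cannot collide for any \<theta>.\<close>
  have cl2: "closed_pl N (\<lambda>t. c1 t + \<theta> *\<^sub>R e t)" for \<theta>
  proof -
    have "inj_on (\<lambda>t. c1 t + \<theta> *\<^sub>R e t) {0..<N}"
    proof (rule inj_onI)
      fix s t assume st: "s \<in> {0..<N}" "t \<in> {0..<N}" "c1 s + \<theta> *\<^sub>R e s = c1 t + \<theta> *\<^sub>R e t"
      have nth: "c1 s $ i + \<theta> * e s $ i = c1 t $ i + \<theta> * e t $ i" for i
        using arg_cong [OF st(3), of "\<lambda>v. v $ i"] by simp
      have X: "X s = X t" using nth [of 1] by (simp add: e123 c1)
      have "c1 s = c1 t"
        using nth [of 1] nth [of 2] nth [of 3] by (simp add: vec_eq_iff forall_3 e123 X)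
      then show "s = t" using clc1 st by (auto simp: closed_pl_def dest: inj_onD)
    qed
    moreover have "pl 0 N (\<lambda>t. c1 t + \<theta> *\<^sub>R e t)" using clc1
      by (intro pl_add pl_linear [OF _ ple]) (auto simp: linear_iff algebra_simps closed_pl_def)
    moreover have "e 0 = e N" using X0N by (simp add: e_def)
    ultimately show ?thesis using clc1 by (simp add: closed_pl_def)
  qed
  have iso2: "ambient_isotopic (Some ` c1 ` {0..<N}) (Some ` c2 ` {0..<N})"
    unfolding c2_def by (rule closed_pl_linear_isotopy [OF cl2 ple])
  have c2: "c2 t $ 1 = X t" "c2 t $ 2 = c t $ 2 - c (X t) $ 2" for t by (simp_all add: c2_def c1 e123)
  have "flat N M c2"
    unfolding flat_def
  proof (intro conjI ballI)
    show "closed_pl N c2" using cl2 [of 1] by (simp add: c2_def)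
    show "0 < c2 t $ 1" "c2 t $ 1 < M" if "t \<in> {M<..<N}" for t using XE' [of t] that by (auto simp: c2)
    show "c2 t $ 1 = t" "c2 t $ 2 = 0" if "t \<in> {0..M}" for t using XT [of t] that by (auto simp: c2)
    \<comment> \<open>Equal heights mean equal shifts, so equality of the new second coordinates
      carries over to the old ones, which are injective by \<open>E\<close>.\<close>
    show "inj_on (\<lambda>t. shadow (c2 t)) {M..N}"
    proof (rule inj_onI)
      fix s t assume st: "s \<in> {M..N}" "t \<in> {M..N}" "shadow (c2 s) = shadow (c2 t)"
      then have "c s $ 2 = c t $ 2" by (auto simp: shadow_eq_iff c2)
      then show "s = t" using inj_onD [OF E] st by blast
    qed
  qed (use MN in auto)
  then show ?thesis using ambient_isotopic_trans [OF iso1 iso2] by (rule that)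
qed

text \<open>Fingers of the last growth step may run parallel to the closing edge, whose ends both
  belong to the arc and have to stay. So it is stretched to two units of time and given a middle
  vertex at time \<open>m + 1\<close>. \<open>Q\<close> keeps the second coordinate monotone over
  both halves while this vertex is made generic.\<close>

lemma flatten_grown:
  assumes g: "grown n (n - 1) c B" and n: "2 \<le> n" and c2: "c (real (n - 1)) $ 2 \<noteq> c (real n) $ 2"
  obtains N M c' where "flat N M c'" "ambient_isotopic (Some ` c ` {0..<real n}) (Some ` c' ` {0..<N})"
proof -
  define m where "m = n - 1"
  have nm: "n = Suc m" "0 < m" using n by (auto simp: m_def)
  have cl: "closed_pl (real m + 1) c" and Elin: "lin (real m) (real m + 1) c"
    and co: "cornered B (real m) c" and inj: "inj_on (\<lambda>t. pr (c t)) {0..real m}"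
    using g unfolding grown_def m_def [symmetric] nm(1) by (auto simp: add.commute)
  define \<phi> where "\<phi> = (\<lambda>t. if t \<le> real m then t else (t + real m) / 2)"
  define K where "K = real m + 2"
  define c0 where "c0 = (\<lambda>t. c (\<phi> t))"
  define D where "D = c (real m + 1) - c (real m)"
  have D2: "D $ 2 \<noteq> 0" using c2 unfolding m_def [symmetric] nm(1) by (simp add: D_def add.commute)
  have "pl 0 K \<phi>"
  proof (rule pl_trans)
    show "pl 0 (real m) \<phi>" by (rule pl_cong [OF pl_ident]) (simp add: \<phi>_def)
    have "lin (real m) K (\<lambda>t. real m / 2 + t *\<^sub>R (1/2))" unfolding lin_def by blast
    then show "pl (real m) K \<phi>" by (rule pl_cong [OF lin_imp_pl]) (auto simp: \<phi>_def field_simps)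
  qed
  moreover have "strict_mono_on {0..K} \<phi>"
    by (rule strict_mono_onI) (auto simp: \<phi>_def)
  moreover have "\<phi> 0 = 0" "\<phi> K = real m + 1" "0 < K" by (auto simp: \<phi>_def K_def field_simps)
  ultimately have cl0: "closed_pl K c0" and img: "c0 ` {0..<K} = c ` {0..<real m + 1}"
    unfolding c0_def using closed_pl_reparametrise [OF cl] by auto
  have c0E: "c0 t = (c (real m) - (real m / 2) *\<^sub>R D) + t *\<^sub>R (D /\<^sub>R 2)" if "real m \<le> t" "t \<le> K" for t
  proof -
    have "\<phi> t = real m + (t - real m) / 2" using that by (auto simp: \<phi>_def field_simps)
    moreover have "real m \<le> \<phi> t" "\<phi> t \<le> real m + 1" using that by (auto simp: \<phi>_def K_def)
    ultimately have "c (\<phi> t) = c (real m) + ((t - real m) / 2) *\<^sub>R D"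
      using lin_eq [OF Elin, of "\<phi> t"] by (simp add: D_def)
    then show ?thesis by (simp add: c0_def algebra_simps diff_divide_distrib)
  qed
  have linE: "lin (real m) K c0" unfolding lin_def by (intro exI ballI, rule c0E) auto
  have same: "c0 t = c t" if "t \<le> real m" for t using that by (simp add: c0_def \<phi>_def)
  define k where "k = m + 2"
  have Kk: "K = real k" by (simp add: K_def k_def)
  have lin0: "lin (real i) (real i + 1) c0" if "m \<le> i" "i < k" for i
    by (rule lin_subset [OF linE]) (use that in \<open>auto simp: Kk\<close>)
  define Q where "Q = (\<lambda>c :: real \<Rightarrow> real^3.
      0 < (c (real m + 1) $ 2 - c (real m) $ 2) * (c (real m + 2) $ 2 - c (real m + 1) $ 2))"
  have "c0 (real m + 1) $ 2 - c0 (real m) $ 2 = D $ 2 / 2" "c0 (real m + 2) $ 2 - c0 (real m + 1) $ 2 = D $ 2 / 2"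
    by (simp_all add: c0E K_def field_simps)
  then have "Q c0 \<longleftrightarrow> 0 < (D $ 2 / 2) * (D $ 2 / 2)" by (simp only: Q_def)
  then have Q0: "Q c0" using D2 by (auto simp: zero_less_mult_iff linorder_neq_iff)
  have Qstable: "\<exists>e>0. \<forall>w. norm w < e \<longrightarrow> Q (\<lambda>t. c t + tent 1 (t - real i) *\<^sub>R w)"
    if Qc: "Q c" and i: "m < i" "i < k" for c i
  proof -
    have i1: "real i = real m + 1" using i by (auto simp: k_def)
    define x where "x = c (real m + 1) $ 2 - c (real m) $ 2"
    define y where "y = c (real m + 2) $ 2 - c (real m + 1) $ 2"
    have xy: "0 < x * y" using Qc by (simp add: Q_def x_def y_def)
    have "Q (\<lambda>t. c t + tent 1 (t - real i) *\<^sub>R w)" if w: "norm w < min \<bar>x\<bar> \<bar>y\<bar>" for w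
    proof -
      have "\<bar>w $ 2\<bar> < min \<bar>x\<bar> \<bar>y\<bar>" using component_le_norm_cart [of w 2] w by simp
      then have "0 < (x + w $ 2) * (y - w $ 2)" using xy by (auto simp: zero_less_mult_iff)
      moreover have "tent 1 (real m - (real m + 1)) = 0" "tent 1 (real m + 2 - (real m + 1)) = 0"
        by (simp_all add: tent_eq_0)
      ultimately show ?thesis by (simp add: Q_def i1 x_def y_def algebra_simps)
    qed
    moreover have "0 < min \<bar>x\<bar> \<bar>y\<bar>" using xy by auto
    ultimately show ?thesis by blast
  qed
  have inj0: "inj_on (\<lambda>t. pr (c0 t)) {0..real m}"
    using inj by (rule inj_on_cong [THEN iffD1, rotated]) (simp add: same)
  have B: "finite B" "0 \<in> B" "B \<subseteq> {0..real m}" using co by (auto simp: cornered_def)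
  have mk: "m + 1 < k" by (simp add: k_def)
  have "m \<le> k - 1" using mk by simp
  then obtain c1 where cl1: "closed_pl (real k) c1"
    and iso: "ambient_isotopic (Some ` c0 ` {0..<real k}) (Some ` c1 ` {0..<real k})"
    and same1: "\<And>t. t \<le> real m \<or> t \<ge> real k \<Longrightarrow> c1 t = c0 t"
    and lin1: "\<And>i. m \<le> i \<Longrightarrow> i < k \<Longrightarrow> lin (real i) (real i + 1) c1"
    and Q1: "Q c1" and gen: "generic_edges k m B (k - 1) (\<lambda>t. pr (c1 t))"
    using perturb_vertices [OF cl0 [unfolded Kk] lin0 mk _ order_refl B inj_on_subset [OF inj0 B(3)]
        linear_pr pr_lift norm_lift, of Q] Q0 Qstable by blast
  have sameT: "c1 t = c t" if "t \<le> real m" for t using same1 [of t] same [OF that] that by simp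
  have inj1: "inj_on (\<lambda>t. pr (c1 t)) {0..real m}"
    using inj by (rule inj_on_cong [THEN iffD1, rotated]) (simp add: sameT)
  have co1: "cornered B (real m) c1" by (rule cornered_cong [OF co sameT])
  have sn: "snake (real k) (real m) c1 (insert (real m + 1) B)"
    by (rule snake_of_generic_edges [OF cl1 mk lin1 co1 inj1 gen])
  have fin: "finite {s \<in> {real m<..<real k}. pr (c1 s) \<in> (\<lambda>t. pr (c1 t)) ` {0..real m}}"
  proof (rule finite_subset)
    show "{s \<in> {real m<..<real k}. pr (c1 s) \<in> (\<lambda>t. pr (c1 t)) ` {0..real m}} \<subseteq>
      meets (real m) c1 \<union> {s \<in> {real m+1<..<real k}. pr (c1 s) \<in> (\<lambda>t. pr (c1 t)) ` {0..real m}}"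
      unfolding meets_def by force
    show "finite (meets (real m) c1 \<union> {s \<in> {real m+1<..<real k}. pr (c1 s) \<in> (\<lambda>t. pr (c1 t)) ` {0..real m}})"
      using sn by (simp add: snake_def)
  qed
  have "inj_on (\<lambda>t. c1 t $ 2) {real m..real k}"
  proof -
    define x where "x = c1 (real m + 1) $ 2 - c1 (real m) $ 2"
    define y where "y = c1 (real m + 2) $ 2 - c1 (real m + 1) $ 2"
    define a where "a = c1 (real m + 1) $ 2"
    have xy: "0 < x * y" using Q1 by (simp add: Q_def x_def y_def)
    have 1: "c1 t $ 2 = a + (t - (real m + 1)) * x" if "real m \<le> t" "t \<le> real m + 1" for t
      using lin_eq [OF lin_linear [OF linear_nth [of 2] lin1 [of m]] _ that] mk by (simp add: a_def x_def algebra_simps)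
    have 2: "c1 t $ 2 = a + (t - (real m + 1)) * y" if "real m + 1 \<le> t" "t \<le> real k" for t
      using lin_eq [OF lin_linear [OF linear_nth [of 2] lin1 [of "Suc m"]], of t] that
      by (simp add: a_def y_def k_def algebra_simps)
    define f where "f = (\<lambda>t. (t - (real m + 1)) * (if t \<le> real m + 1 then x else y))"
    have f: "c1 t $ 2 = a + f t" if "t \<in> {real m..real k}" for t
      using 1 [of t] 2 [of t] that by (auto simp: f_def)
    have sg: "sgn y = sgn x" "x \<noteq> 0" using xy by (auto simp: zero_less_mult_iff)
    have "sgn x * f s < sgn x * f t" if "s < t" for s t
    proof -
      define p where "p = \<bar>x\<bar>"
      define q where "q = \<bar>y\<bar>"
      have pq: "0 < p" "0 < q" using xy by (auto simp: p_def q_def)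
      have sf: "sgn x * f t = (t - (real m + 1)) * (if t \<le> real m + 1 then p else q)" for t
        unfolding f_def p_def q_def using sg(1) by (auto simp: abs_sgn)
      have "(s - (real m + 1)) * p < (t - (real m + 1)) * p" "(s - (real m + 1)) * q < (t - (real m + 1)) * q"
        using that pq by (auto intro: mult_strict_right_mono)
      moreover have "(s - (real m + 1)) * p \<le> 0" if "s \<le> real m + 1" using that pq by (simp add: mult_nonpos_nonneg)
      moreover have "0 < (t - (real m + 1)) * q" if "real m + 1 < t" using that pq by simp
      ultimately show ?thesis unfolding sf using that by fastforce
    qed
    then have "inj f" by (metis injI linorder_neqE_linordered_idom order_less_irrefl)
    then show ?thesis by (intro inj_onI) (simp add: f inj_eq)
  qed
  moreover have "0 < real m" "real m < real k" using nm by (auto simp: k_def)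
  ultimately obtain c' where "flat (real k) (real m) c'" "ambient_isotopic (Some ` c1 ` {0..<real k}) (Some ` c' ` {0..<real k})"
    using flatten [OF cl1 _ _ inj1 _ fin] by blast
  moreover have "Some ` c ` {0..<real n} = Some ` c0 ` {0..<real k}"
    using img by (simp add: Kk nm add.commute)
  ultimately show ?thesis using that ambient_isotopic_trans [OF iso] by metis
qed

section \<open>Vertices in general position\<close>

text \<open>A change of time that puts all breaks at integers, as the parametrisation by
  \<open>polygon_curve\<close> requires. The induction adds the largest break with one more linear
  unit.\<close>

lemma unit_breakpoints:
  fixes B :: "real set"
  assumes "finite B" "B \<noteq> {}"
  shows "\<exists>k \<phi>. strict_mono_on {0..real k} \<phi> \<and> (\<forall>i<k. lin (real i) (real i + 1) \<phi>) \<and>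
    (\<lambda>i. \<phi> (real i)) ` {..k} = B"
  using assms
proof (induction rule: finite_linorder_max_induct)
  case (insert b A)
  show ?case
  proof (cases "A = {}")
    case True
    then show ?thesis by (intro exI [of _ 0] exI [of _ "\<lambda>_. b"]) (auto simp: strict_mono_on_def)
  next
    case False
    then obtain k \<phi> where mono: "strict_mono_on {0..real k} \<phi>" and lin: "\<And>i. i < k \<Longrightarrow> lin (real i) (real i + 1) \<phi>"
      and img: "(\<lambda>i. \<phi> (real i)) ` {..k} = A" using insert by blast
    have "\<phi> (real k) \<in> A" using img by auto
    then have kb: "\<phi> (real k) < b" using insert by simp
    define d where "d = b - \<phi> (real k)"
    define \<psi> where "\<psi> = (\<lambda>t. if t \<le> real k then \<phi> t else \<phi> (real k) + (t - real k) * d)"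
    have d: "0 < d" using kb by (simp add: d_def)
    have \<psi>1: "\<psi> t = \<phi> t" if "t \<le> real k" for t using that by (simp add: \<psi>_def)
    have \<psi>2: "\<psi> t = \<phi> (real k) + (t - real k) * d" if "real k \<le> t" for t using that by (auto simp: \<psi>_def)
    have "strict_mono_on {0..real (Suc k)} \<psi>"
    proof (rule strict_mono_onI)
      fix s t assume st: "s \<in> {0..real (Suc k)}" "t \<in> {0..real (Suc k)}" "s < t"
      consider "t \<le> real k" | "s \<le> real k" "real k < t" | "real k < s" by linarith
      then show "\<psi> s < \<psi> t"
      proof cases
        case 1
        then show ?thesis using strict_mono_onD [OF mono, of s t] st by (simp add: \<psi>1)
      next
        case 2
        then have "\<phi> s \<le> \<phi> (real k)" using strict_mono_on_leD [OF mono, of s "real k"] st by simp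
        moreover have "0 < (t - real k) * d" using 2 d by simp
        ultimately show ?thesis using 2 by (simp add: \<psi>1 \<psi>2)
      next
        case 3
        then show ?thesis using st d by (simp add: \<psi>2)
      qed
    qed
    moreover have "lin (real i) (real i + 1) \<psi>" if "i < Suc k" for i
    proof (cases "i < k")
      case True
      then show ?thesis by (intro lin_cong [OF lin] \<psi>1) auto
    next
      case False
      then have ik: "i = k" using that by simp
      have "lin (real k) (real k + 1) (\<lambda>t. (\<phi> (real k) - real k * d) + t *\<^sub>R d)" unfolding lin_def by blast
      then show ?thesis unfolding ik by (rule lin_cong) (simp add: \<psi>2 algebra_simps)
    qed
    moreover have "(\<lambda>i. \<psi> (real i)) ` {..Suc k} = insert b A"
    proof -
      have "(\<lambda>i. \<psi> (real i)) ` {..k} = (\<lambda>i. \<phi> (real i)) ` {..k}" by (rule image_cong) (simp_all add: \<psi>1)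
      moreover have "\<psi> (real (Suc k)) = b" by (simp add: \<psi>2 d_def)
      ultimately show ?thesis using img by (simp add: atMost_Suc)
    qed
    ultimately show ?thesis by blast
  qed
qed simp

lemma pl_unit_edges: "(\<And>i. i < n \<Longrightarrow> lin (real i) (real i + 1) c) \<Longrightarrow> pl 0 (real n) c"
proof (induction n)
  case 0
  then show ?case by (simp add: pl_def)
next
  case (Suc n)
  then have "pl 0 (real n) c" "pl (real n) (real n + 1) c" by (auto intro: lin_imp_pl)
  from pl_trans [OF this] show ?case by (simp add: add.commute)
qed

lemma lin_compose:
  fixes \<phi> :: "real \<Rightarrow> real"
  assumes "lin a b \<phi>" "\<And>t. a \<le> t \<Longrightarrow> t \<le> b \<Longrightarrow> \<phi> t \<in> {p..q}" "lin p q c"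
  shows "lin a b (\<lambda>t. c (\<phi> t))"
proof -
  obtain x y where 1: "\<And>t. a \<le> t \<Longrightarrow> t \<le> b \<Longrightarrow> \<phi> t = x + t *\<^sub>R y" using assms(1) by (auto simp: lin_def)
  obtain v w where 2: "\<And>t. p \<le> t \<Longrightarrow> t \<le> q \<Longrightarrow> c t = v + t *\<^sub>R w" using assms(3) by (auto simp: lin_def)
  have "c (\<phi> t) = (v + x *\<^sub>R w) + t *\<^sub>R (y *\<^sub>R w)" if t: "a \<le> t" "t \<le> b" for t
  proof -
    have "c (\<phi> t) = v + \<phi> t *\<^sub>R w" using 2 [of "\<phi> t"] assms(2) [OF t] by simp
    then show ?thesis unfolding 1 [OF t] by (simp add: algebra_simps)
  qed
  then show ?thesis unfolding lin_def
    by (intro exI [of _ "v + x *\<^sub>R w"] exI [of _ "y *\<^sub>R w"]) simp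
qed

text \<open>The version of \<open>flat\<close> with vertices at integer times. Confinement is
  demanded at the vertices only, as edges inherit it by convexity, and \<open>\<mu> + 1 < k\<close>
  provides at least one vertex off the strand.\<close>

definition straightened :: "nat \<Rightarrow> nat \<Rightarrow> (real \<Rightarrow> real^3) \<Rightarrow> bool" where
  "straightened k \<mu> c \<longleftrightarrow> closed_pl (real k) c \<and> 0 < \<mu> \<and> \<mu> + 1 < k \<and>
    (\<forall>i<k. lin (real i) (real i + 1) c) \<and> (\<forall>t\<in>{0..real \<mu>}. c t $ 2 = 0) \<and>
    strict_mono_on {0..real \<mu>} (\<lambda>t. c t $ 1) \<and> inj_on (\<lambda>t. shadow (c t)) {real \<mu>..real k} \<and>
    (\<forall>i. \<mu> < i \<and> i < k \<longrightarrow> c 0 $ 1 < c (real i) $ 1 \<and> c (real i) $ 1 < c (real \<mu>) $ 1)"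

lemma straightened_of_flat:
  assumes "flat N M c"
  shows "\<exists>k \<mu> c'. straightened k \<mu> c' \<and> c' ` {0..<real k} = c ` {0..<N}"
proof -
  have cl: "closed_pl N c" and MN: "0 < M" "M < N"
    and T: "\<And>t. 0 \<le> t \<Longrightarrow> t \<le> M \<Longrightarrow> c t $ 1 = t \<and> c t $ 2 = 0"
    and E: "\<And>t. M < t \<Longrightarrow> t < N \<Longrightarrow> 0 < c t $ 1 \<and> c t $ 1 < M"
    and inj: "inj_on (\<lambda>t. shadow (c t)) {M..N}"
    using assms by (auto simp: flat_def)
  obtain B0 where B0: "finite B0" "{0, N} \<subseteq> B0" "B0 \<subseteq> {0..N}"
    "\<And>p q. 0 \<le> p \<Longrightarrow> p \<le> q \<Longrightarrow> q \<le> N \<Longrightarrow> {p<..<q} \<inter> B0 = {} \<Longrightarrow> lin p q c"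
  proof -
    have "pl 0 N c" "0 \<le> N" using cl by (auto simp: closed_pl_def)
    then show ?thesis by (rule pl_breakpoints) (rule that)
  qed
  \<comment> \<open>The midpoint guarantees a vertex strictly between the end of the strand and the
    return to its beginning.\<close>
  define B where "B = {M, (M + N) / 2} \<union> B0"
  have "finite B" "B \<noteq> {}" using B0 by (auto simp: B_def)
  then obtain k \<phi> where mono: "strict_mono_on {0..real k} \<phi>" and lin\<phi>: "\<And>i. i < k \<Longrightarrow> lin (real i) (real i + 1) \<phi>"
    and img: "(\<lambda>i. \<phi> (real i)) ` {..k} = B" using unit_breakpoints by blast
  have less: "\<phi> s < \<phi> t \<longleftrightarrow> s < t" if "s \<in> {0..real k}" "t \<in> {0..real k}" for s t
    by (rule strict_mono_on_less [OF mono that])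
  have le: "\<phi> s \<le> \<phi> t" if "s \<le> t" "s \<in> {0..real k}" "t \<in> {0..real k}" for s t
    using strict_mono_on_leD [OF mono that(2,3,1)] .
  have B: "B \<subseteq> {0..N}" using B0 MN by (auto simp: B_def)
  have inB: "\<exists>i\<le>k. \<phi> (real i) = b" if "b \<in> B" for b using that img by auto
  have \<phi>B: "\<phi> (real i) \<in> B" if "i \<le> k" for i using that img by auto
  have "{0, N, M, (M + N) / 2} \<subseteq> B" using B0 by (auto simp: B_def)
  then obtain i0 iN \<mu> \<nu> where ix: "i0 \<le> k" "\<phi> (real i0) = 0" "iN \<le> k" "\<phi> (real iN) = N" 
     "\<mu> \<le> k" "\<phi> (real \<mu>) = M" "\<nu> \<le> k" "\<phi> (real \<nu>) = (M + N) / 2"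
    using inB [of 0] inB [of N] inB [of M] inB [of "(M + N) / 2"] by blast
  have \<phi>0: "\<phi> 0 = 0"
    using le [of 0 "real i0"] \<phi>B [of 0] B ix by fastforce
  have \<phi>k: "\<phi> (real k) = N"
    using le [of "real iN" "real k"] \<phi>B [of k] B ix by fastforce
  have "real 0 < real \<mu>" using less [of 0 "real \<mu>"] \<phi>0 MN ix by simp
  moreover have "real \<mu> < real \<nu>" using less [of "real \<mu>" "real \<nu>"] MN ix by simp
  moreover have "real \<nu> < real k" using less [of "real \<nu>" "real k"] \<phi>k MN ix by simp
  ultimately have "0 < \<mu>" "\<mu> < \<nu>" "\<nu> < k" by simp_all
  then have \<mu>: "0 < \<mu>" "\<mu> + 1 < k" by simp_all
  have pl\<phi>: "pl 0 (real k) \<phi>" by (rule pl_unit_edges [OF lin\<phi>])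
  define c' where "c' = (\<lambda>t. c (\<phi> t))"
  have k0: "0 < real k" using \<mu> by simp
  have cl': "closed_pl (real k) c'" and img': "c' ` {0..<real k} = c ` {0..<N}"
    unfolding c'_def by (rule closed_pl_reparametrise [OF cl pl\<phi> mono \<phi>0 \<phi>k k0])+
  have lin': "lin (real i) (real i + 1) c'" if i: "i < k" for i
    unfolding c'_def
  proof (rule lin_compose [OF lin\<phi> [OF i]])
    show "\<phi> t \<in> {\<phi> (real i)..\<phi> (real i + 1)}" if "real i \<le> t" "t \<le> real i + 1" for t
      using le [of "real i" t] le [of t "real i + 1"] that i by auto
    show "lin (\<phi> (real i)) (\<phi> (real i + 1)) c"
    proof (rule B0(4))
      have b: "\<phi> (real i) \<in> B" "\<phi> (real (Suc i)) \<in> B" using \<phi>B [of i] \<phi>B [of "Suc i"] i by auto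
      then show "0 \<le> \<phi> (real i)" "\<phi> (real i + 1) \<le> N" using B by (auto simp: add.commute)
      show "\<phi> (real i) \<le> \<phi> (real i + 1)" using i by (intro le) auto
      show "{\<phi> (real i)<..<\<phi> (real i + 1)} \<inter> B0 = {}"
      proof (rule ccontr)
        assume "{\<phi> (real i)<..<\<phi> (real i + 1)} \<inter> B0 \<noteq> {}"
        then obtain b where "b \<in> {\<phi> (real i)<..<\<phi> (real i + 1)} \<inter> B0" by blast
        then have b: "b \<in> B" "\<phi> (real i) < b" "b < \<phi> (real i + 1)" by (simp_all add: B_def)
        obtain j where "j \<le> k" "\<phi> (real j) = b" using inB [OF b(1)] by blast
        then have j: "j \<le> k" "\<phi> (real i) < \<phi> (real j)" "\<phi> (real j) < \<phi> (real i + 1)"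
          using b by auto
        then have "real i < real j" "real j < real i + 1" using less [of "real i" "real j"] less [of "real j" "real i + 1"] i by auto
        then show False by simp
      qed
    qed
  qed
  have \<phi>T: "0 \<le> \<phi> t" "\<phi> t \<le> M" if "t \<in> {0..real \<mu>}" for t
    using le [of 0 t] le [of t "real \<mu>"] that \<mu> \<phi>0 ix by auto
  have "straightened k \<mu> c'"
    unfolding straightened_def
  proof (intro conjI ballI allI impI)
    show "c' t $ 2 = 0" if "t \<in> {0..real \<mu>}" for t using T [of "\<phi> t"] \<phi>T [OF that] by (simp add: c'_def)
    show "strict_mono_on {0..real \<mu>} (\<lambda>t. c' t $ 1)"
    proof (rule strict_mono_onI)
      fix s t assume st: "s \<in> {0..real \<mu>}" "t \<in> {0..real \<mu>}" "s < t"
      then have "\<phi> s < \<phi> t" using less [of s t] \<mu> by auto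
      then show "c' s $ 1 < c' t $ 1" using T \<phi>T st by (simp add: c'_def)
    qed
    show "inj_on (\<lambda>t. shadow (c' t)) {real \<mu>..real k}"
    proof (rule inj_onI)
      fix s t assume st: "s \<in> {real \<mu>..real k}" "t \<in> {real \<mu>..real k}" "shadow (c' s) = shadow (c' t)"
      have "\<phi> u \<in> {M..N}" if "u \<in> {real \<mu>..real k}" for u
        using le [of "real \<mu>" u] le [of u "real k"] that \<mu> \<phi>k ix by auto
      then have "\<phi> s = \<phi> t" using inj_onD [OF inj, of "\<phi> s" "\<phi> t"] st by (simp add: c'_def)
      then show "s = t" using less [of s t] less [of t s] st by (cases s t rule: linorder_cases) auto
    qed
    fix i assume i: "\<mu> < i \<and> i < k"
    then have "M < \<phi> (real i)" "\<phi> (real i) < N"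
      using less [of "real \<mu>" "real i"] less [of "real i" "real k"] \<phi>k ix by auto
    moreover have "c' 0 $ 1 = 0" "c' (real \<mu>) $ 1 = M" using T [of 0] T [of M] MN ix \<phi>0 by (auto simp: c'_def)
    ultimately show "c' 0 $ 1 < c' (real i) $ 1" "c' (real i) $ 1 < c' (real \<mu>) $ 1" using E by (auto simp: c'_def)
  qed (use cl' \<mu> lin' in auto)
  then show ?thesis using img' by blast
qed

section \<open>General position of the rest relative to the strand\<close>

lemma tent_1_Lipschitz: "\<bar>tent 1 x - tent 1 y\<bar> \<le> \<bar>x - y\<bar>"
  by (auto simp: tent_def)

text \<open>The plane curve is bi-Lipschitz and a tent of width 1 has Lipschitz constant 1, so a
  short \<open>w\<close> cannot close the gap between two points.\<close>

lemma inj_on_shadow_stable: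
  fixes c :: "real \<Rightarrow> real^3"
  assumes c: "pl a b c" "inj_on (\<lambda>t. shadow (c t)) {a..b}" and ab: "a \<le> b"
  shows "\<exists>e>0. \<forall>w. norm w < e \<longrightarrow> inj_on (\<lambda>t. shadow (c t + tent 1 (t - x) *\<^sub>R w)) {a..b}"
proof -
  have lin: "linear shadow" by (rule linearI) (auto simp: shadow_def vec_eq_iff forall_2)
  obtain k where k: "0 < k" "\<And>s t. s \<in> {a..b} \<Longrightarrow> t \<in> {a..b} \<Longrightarrow> k * \<bar>s - t\<bar> \<le> norm (shadow (c s) - shadow (c t))"
    using pl_inj_bilipschitz [OF pl_linear [OF lin c(1)] c(2) ab] by blast
  have "bounded_linear shadow" using lin by (simp add: linear_conv_bounded_linear)
  then obtain L where L: "0 < L" "\<And>v. norm (shadow v) \<le> norm v * L" using bounded_linear.pos_bounded by blast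
  have "inj_on (\<lambda>t. shadow (c t + tent 1 (t - x) *\<^sub>R w)) {a..b}" if w: "norm w < k / L" for w
  proof (rule inj_onI, rule ccontr)
    fix s t assume st: "s \<in> {a..b}" "t \<in> {a..b}" "s \<noteq> t"
      "shadow (c s + tent 1 (s - x) *\<^sub>R w) = shadow (c t + tent 1 (t - x) *\<^sub>R w)"
    have "shadow (c s) + tent 1 (s - x) *\<^sub>R shadow w = shadow (c t) + tent 1 (t - x) *\<^sub>R shadow w"
      using st(4) by (simp add: linear_add [OF lin] linear_scale [OF lin])
    then have "shadow (c s) - shadow (c t) = (tent 1 (t - x) - tent 1 (s - x)) *\<^sub>R shadow w"
      by (simp add: algebra_simps)
    then have "norm (shadow (c s) - shadow (c t)) = \<bar>tent 1 (t - x) - tent 1 (s - x)\<bar> * norm (shadow w)" by simp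
    also have "\<dots> \<le> \<bar>s - t\<bar> * (norm w * L)"
      using tent_1_Lipschitz [of "t - x" "s - x"] L(2) [of w] by (intro mult_mono) auto
    also have "\<dots> < \<bar>s - t\<bar> * k" using w st L by (intro mult_strict_left_mono) (auto simp: field_simps)
    finally show False using k(2) [OF st(1,2)] by (simp add: mult.commute)
  qed
  then show ?thesis using k L by (intro exI [of _ "k / L"]) auto
qed

text \<open>The complex version of \<open>shadow\<close>, for applying
  \<open>perturb_vertices\<close> to the diagram plane.\<close>

definition planar :: "real^3 \<Rightarrow> complex" where
  "planar v = Complex (v $ 1) (v $ 2)"

text \<open>The vertices of the strand stay fixed on one line. A later vertex avoiding the lines
  through them leaves this axis, and edges that miss them meet the strand inside its edges. So no
  crossing occurs at a vertex of either branch.\<close>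

lemma generic_straightened:
  assumes st: "straightened k \<mu> c"
  shows "\<exists>c'. straightened k \<mu> c' \<and> ambient_isotopic (Some ` c ` {0..<real k}) (Some ` c' ` {0..<real k}) \<and>
    finite {s \<in> {real \<mu><..<real k}. c' s $ 2 = 0} \<and>
    (\<forall>s\<in>{real \<mu><..<real k}. c' s $ 2 = 0 \<longrightarrow> s \<notin> \<int> \<and> (\<forall>i\<le>\<mu>. c' (real i) $ 1 \<noteq> c' s $ 1))"
proof -
  have cl: "closed_pl (real k) c" and \<mu>: "0 < \<mu>" "\<mu> + 1 < k"
    and lin: "\<And>i. i < k \<Longrightarrow> lin (real i) (real i + 1) c" and T: "\<And>t. 0 \<le> t \<Longrightarrow> t \<le> real \<mu> \<Longrightarrow> c t $ 2 = 0"
    and mono: "strict_mono_on {0..real \<mu>} (\<lambda>t. c t $ 1)"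
    and inj: "inj_on (\<lambda>t. shadow (c t)) {real \<mu>..real k}"
    and E: "\<And>i. \<mu> < i \<Longrightarrow> i < k \<Longrightarrow> c 0 $ 1 < c (real i) $ 1 \<and> c (real i) $ 1 < c (real \<mu>) $ 1"
    using st by (auto simp: straightened_def)
  \<comment> \<open>What \<open>straightened\<close> demands after the strand and what small moves
    preserve; piecewise linearity is carried along for \<open>inj_on_shadow_stable\<close>.\<close>
  define Q where "Q = (\<lambda>c :: real \<Rightarrow> real^3. pl (real \<mu>) (real k) c \<and> inj_on (\<lambda>t. shadow (c t)) {real \<mu>..real k} \<and>
    (\<forall>i. \<mu> < i \<and> i < k \<longrightarrow> c 0 $ 1 < c (real i) $ 1 \<and> c (real i) $ 1 < c (real \<mu>) $ 1))"
  have Q0: "Q c" using cl inj E by (auto simp: Q_def closed_pl_def intro: pl_subset)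
  have Qstable: "\<exists>e>0. \<forall>w. norm w < e \<longrightarrow> Q (\<lambda>t. c t + tent 1 (t - real i) *\<^sub>R w)"
    if Qc: "Q c" and i: "\<mu> < i" "i < k" for c i
  proof -
    have Qc': "pl (real \<mu>) (real k) c" "inj_on (\<lambda>t. shadow (c t)) {real \<mu>..real k}"
      "\<And>j. \<mu> < j \<Longrightarrow> j < k \<Longrightarrow> c 0 $ 1 < c (real j) $ 1 \<and> c (real j) $ 1 < c (real \<mu>) $ 1"
      using Qc by (auto simp: Q_def)
    have "real \<mu> \<le> real k" using \<mu> by simp
    then obtain e1 where e1: "0 < e1"
      "\<And>w. norm w < e1 \<Longrightarrow> inj_on (\<lambda>t. shadow (c t + tent 1 (t - real i) *\<^sub>R w)) {real \<mu>..real k}"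
      using inj_on_shadow_stable [OF Qc'(1,2), of "real i"] by blast
    define e2 where "e2 = min (c (real i) $ 1 - c 0 $ 1) (c (real \<mu>) $ 1 - c (real i) $ 1)"
    have e2: "0 < e2" using Qc'(3) [OF i] by (simp add: e2_def)
    have "Q (\<lambda>t. c t + tent 1 (t - real i) *\<^sub>R w)" if w: "norm w < min e1 e2" for w
      unfolding Q_def
    proof (intro conjI allI impI)
      show "pl (real \<mu>) (real k) (\<lambda>t. c t + tent 1 (t - real i) *\<^sub>R w)"
        by (intro pl_add Qc' pl_scaleR_left pl_tent) simp
      show "inj_on (\<lambda>t. shadow (c t + tent 1 (t - real i) *\<^sub>R w)) {real \<mu>..real k}" using e1 w by simp
      fix j assume j: "\<mu> < j \<and> j < k"
      have w1: "\<bar>w $ 1\<bar> < e2" using component_le_norm_cart [of w 1] w by simp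
      have tj: "tent 1 (real j - real i) = (if j = i then 1 else 0)" for j by (auto intro!: tent_eq_0)
      have t0: "tent 1 (0 - real i) = 0" "tent 1 (real \<mu> - real i) = 0" using tj [of 0] tj [of \<mu>] i by auto
      show "(c 0 + tent 1 (0 - real i) *\<^sub>R w) $ 1 < (c (real j) + tent 1 (real j - real i) *\<^sub>R w) $ 1"
        "(c (real j) + tent 1 (real j - real i) *\<^sub>R w) $ 1 < (c (real \<mu>) + tent 1 (real \<mu> - real i) *\<^sub>R w) $ 1"
        using Qc'(3) [of j] j w1 unfolding t0 tj by (auto simp: e2_def)
    qed
    then show ?thesis using e1 e2 by (intro exI [of _ "min e1 e2"]) auto
  qed
  define B where "B = real ` {..\<mu>}"
  have B: "finite B" "0 \<in> B" "B \<subseteq> {0..real \<mu>}" by (auto simp: B_def image_iff)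
  have injT: "inj_on (\<lambda>t. c t $ 1) {0..real \<mu>}" by (rule strict_mono_on_imp_inj_on [OF mono])
  have injB: "inj_on (\<lambda>t. planar (c t)) B"
  proof (rule inj_onI)
    fix s t assume st: "s \<in> B" "t \<in> B" "planar (c s) = planar (c t)"
    then have "s \<in> {0..real \<mu>}" "t \<in> {0..real \<mu>}" using B by blast+
    then show "s = t" using inj_onD [OF injT, of s t] st by (simp add: planar_def)
  qed
  define lf where "lf = (\<lambda>w. vector [Re w, Im w, 0] :: real^3)"
  have \<pi>: "linear planar" "\<And>w. planar (lf w) = w" "\<And>w. norm (lf w) \<le> 2 * norm w"
  proof -
    show "linear planar" by (rule linearI) (auto simp: planar_def complex_eq_iff)
    show "planar (lf w) = w" for w by (simp add: planar_def lf_def)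
    show "norm (lf w) \<le> 2 * norm w" for w
    proof -
      have "norm (lf w) \<le> (\<Sum>i\<in>UNIV. \<bar>lf w $ i\<bar>)" by (rule norm_le_l1_cart)
      also have "\<dots> = \<bar>Re w\<bar> + \<bar>Im w\<bar>" by (simp add: sum_3 lf_def)
      finally show ?thesis using abs_Re_le_cmod [of w] abs_Im_le_cmod [of w] by linarith
    qed
  qed
  have "\<mu> \<le> k - 1" using \<mu> by simp
  then obtain c' where cl': "closed_pl (real k) c'"
    and iso: "ambient_isotopic (Some ` c ` {0..<real k}) (Some ` c' ` {0..<real k})"
    and same: "\<And>t. t \<le> real \<mu> \<or> t \<ge> real k \<Longrightarrow> c' t = c t"
    and linE: "\<And>i. \<mu> \<le> i \<Longrightarrow> i < k \<Longrightarrow> lin (real i) (real i + 1) c'"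
    and Q': "Q c'" and gen: "generic_edges k \<mu> B (k - 1) (\<lambda>t. planar (c' t))"
    using perturb_vertices [OF cl lin \<mu>(2) _ order_refl B injB \<pi>, of Q] Q0 Qstable by blast
  define \<sigma> where "\<sigma> = (\<lambda>t. planar (c' t))"
  have sT: "c' t = c t" if "t \<le> real \<mu>" for t using same that by simp
  have lin': "lin (real i) (real i + 1) c'" if "i < k" for i
  proof (cases "\<mu> \<le> i")
    case False
    then show ?thesis using that by (intro lin_cong [OF lin] sT) auto
  qed (use linE that in auto)
  have "straightened k \<mu> c'"
    unfolding straightened_def
  proof (intro conjI ballI allI impI)
    show "strict_mono_on {0..real \<mu>} (\<lambda>t. c' t $ 1)"
      using mono by (auto simp: strict_mono_on_def sT)
  qed (use cl' \<mu> lin' T sT Q' in \<open>auto simp: Q_def\<close>)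
  moreover have Im\<sigma>: "Im (\<sigma> t) = c' t $ 2" "Re (\<sigma> t) = c' t $ 1" for t by (simp_all add: \<sigma>_def planar_def)
  have \<sigma>T: "Im (\<sigma> t) = 0" if "0 \<le> t" "t \<le> real \<mu>" for t using T sT that by (simp add: Im\<sigma>)
  have \<sigma>k: "\<sigma> (real k) = \<sigma> 0" using cl' by (simp add: \<sigma>_def closed_pl_def)
  define e where "e = (\<lambda>i. \<sigma> (real i + 1) - \<sigma> (real i))"
  have edge: "\<sigma> s = \<sigma> (real i) + (s - real i) *\<^sub>R e i" if i: "i < k" and s: "real i \<le> s" "s \<le> real i + 1" for i s
    using lin_eq [OF lin_linear [OF \<pi>(1) lin' [OF i]] _ s] by (simp add: e_def \<sigma>_def)
  have vertex: "Im (\<sigma> (real i)) \<noteq> 0" if i: "\<mu> < i" "i < k" for i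
  proof -
    have "\<sigma> 0 \<noteq> \<sigma> (real \<mu>)"
      using inj_onD [OF injT, of 0 "real \<mu>"] \<mu> sT by (auto simp: \<sigma>_def planar_def)
    have B01: "0 \<in> B" "real \<mu> \<in> B" by (auto simp: B_def image_iff)
    then have "\<sigma> (real \<mu>) - \<sigma> 0 \<in> dirs B \<sigma>" unfolding dirs_def using \<mu> by force
    then have "cr (\<sigma> (real i) - \<sigma> 0) (\<sigma> (real \<mu>) - \<sigma> 0) \<noteq> 0"
      using gen i B01 unfolding generic_edges_def \<sigma>_def by auto
    then show ?thesis using \<sigma>T [of 0] \<sigma>T [of "real \<mu>"] by (auto simp: cr_def)
  qed
  \<comment> \<open>A coincidence would put the strand vertex \<open>b\<close> on the line of an
    edge, which is excluded as seen from the start of that edge or, for the closing edge, from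
    vertex 0.\<close>
  have avoid: "\<sigma> s \<noteq> \<sigma> b" if b: "b \<in> B" and s: "real \<mu> < s" "s < real k" for b s
  proof
    assume eq: "\<sigma> s = \<sigma> b"
    define i where "i = nat \<lfloor>s\<rfloor>"
    have "real i = of_int \<lfloor>s\<rfloor>" using s by (simp add: i_def)
    then have i: "real i \<le> s" "s < real i + 1" "\<mu> \<le> i" "i < k" using s by linarith+
    have b0: "0 \<le> b" "b \<le> real \<mu>" using b B by auto
    have \<sigma>s: "\<sigma> b = \<sigma> (real i) + (s - real i) *\<^sub>R e i" using edge [OF i(4), of s] i eq by simp
    have e0: "e i \<noteq> 0"
    proof
      assume "e i = 0"
      then have z: "\<sigma> (real i + 1) = \<sigma> (real i)" by (simp add: e_def)
      show False
      proof (cases "i = \<mu>")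
        case True
        then show False using vertex [of "Suc \<mu>"] \<sigma>T [of "real \<mu>"] z \<mu> by (simp add: add.commute)
      next
        case False
        then have "Im (\<sigma> (real i)) \<noteq> 0" using vertex i by simp
        moreover have "\<sigma> (real (Suc i)) = \<sigma> (real i)" using z by (simp add: add.commute)
        moreover have "shadow (c' (real (Suc i))) \<noteq> shadow (c' (real i))"
          using inj_onD [of "\<lambda>t. shadow (c' t)" "{real \<mu>..real k}" "real (Suc i)" "real i"] Q' i by (force simp: Q_def)
        ultimately show False by (auto simp: shadow_eq_iff complex_eq_iff Im\<sigma>)
      qed
    qed
    have si: "real \<mu> < real i \<or> real i < s" using s i by auto
    have ne: "\<sigma> b \<noteq> \<sigma> (real i)"
    proof (cases "i = \<mu>")
      case True
      then show ?thesis using \<sigma>s e0 si by auto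
    next
      case False
      then show ?thesis using vertex [of i] \<sigma>T [of b] b0 i by auto
    qed
    show False
    proof (cases "i = k - 1")
      case False
      then have "cr (e i) (\<sigma> b - \<sigma> (real i)) \<noteq> 0"
        using gen i b ne unfolding generic_edges_def e_def \<sigma>_def by auto
      then show False unfolding \<sigma>s by (simp add: cr_scale)
    next
      case True
      have ki: "real i + 1 = real k" using True i by simp
      have ei: "e i = - (\<sigma> (real i) - \<sigma> 0)" using \<sigma>k by (simp add: e_def ki)
      have "b \<noteq> 0"
      proof
        assume "b = 0"
        have "\<sigma> (real i) + e i = \<sigma> b" using ei \<open>b = 0\<close> by simp
        then have "e i = (s - real i) *\<^sub>R e i" unfolding \<sigma>s by (rule add_left_imp_eq)
        then have "(1 - (s - real i)) *\<^sub>R e i = 0" unfolding scaleR_left_diff_distrib [of 1 "s - real i"] by simp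
        then show False using e0 i by simp
      qed
      then have "cr (\<sigma> (real i) - \<sigma> 0) (\<sigma> b - \<sigma> 0) \<noteq> 0"
        using gen b unfolding generic_edges_def True \<sigma>_def by auto
      moreover have "\<sigma> b - \<sigma> 0 = (1 - (s - real i)) *\<^sub>R (\<sigma> (real i) - \<sigma> 0)"
        unfolding \<sigma>s ei by (simp add: algebra_simps)
      ultimately show False by (simp add: cr_scale)
    qed
  qed
  have nonint: "s \<notin> \<int>" if s: "real \<mu> < s" "s < real k" "Im (\<sigma> s) = 0" for s
  proof
    assume "s \<in> \<int>"
    then obtain j where j: "s = of_int j" by (auto simp: Ints_def)
    then have "s = real (nat j)" using s by auto
    then show False using vertex [of "nat j"] s by simp
  qed
  \<comment> \<open>Every edge after the strand has an end off the axis, so its second coordinate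
    has at most one zero, at the quotient given.\<close>
  have fin: "finite {s \<in> {real \<mu><..<real k}. c' s $ 2 = 0}"
  proof (rule finite_subset)
    show "finite ((\<lambda>i. real i - Im (\<sigma> (real i)) / Im (e i)) ` {..k})" by simp
    show "{s \<in> {real \<mu><..<real k}. c' s $ 2 = 0} \<subseteq> (\<lambda>i. real i - Im (\<sigma> (real i)) / Im (e i)) ` {..k}"
    proof
      fix s assume "s \<in> {s \<in> {real \<mu><..<real k}. c' s $ 2 = 0}"
      then have s: "real \<mu> < s" "s < real k" "Im (\<sigma> s) = 0" by (auto simp: Im\<sigma>)
      define i where "i = nat \<lfloor>s\<rfloor>"
      have "real i = of_int \<lfloor>s\<rfloor>" using s by (simp add: i_def)
      then have i: "real i \<le> s" "s < real i + 1" "\<mu> \<le> i" "i < k" using s by linarith+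
      have ims: "Im (\<sigma> (real i)) + (s - real i) * Im (e i) = 0" using edge [OF i(4), of s] i s by simp
      have "Im (e i) \<noteq> 0"
      proof
        assume z: "Im (e i) = 0"
        then have "Im (\<sigma> (real i)) = 0" using ims by simp
        then have "i = \<mu>" using vertex [of i] i by (cases "\<mu> < i") auto
        then have "Im (\<sigma> (real (Suc \<mu>))) = 0" using z \<sigma>T [of "real \<mu>"] by (simp add: e_def add.commute)
        then show False using vertex [of "Suc \<mu>"] \<mu> by simp
      qed
      then have "s = real i - Im (\<sigma> (real i)) / Im (e i)" using ims by (simp add: field_simps)
      then show "s \<in> (\<lambda>i. real i - Im (\<sigma> (real i)) / Im (e i)) ` {..k}" using i by (intro image_eqI [of _ _ i]) auto
    qed
  qed
  moreover have "c' (real i) $ 1 \<noteq> c' s $ 1" if s: "real \<mu> < s" "s < real k" "c' s $ 2 = 0" and i: "i \<le> \<mu>" for s i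
  proof -
    have "\<sigma> s \<noteq> \<sigma> (real i)" using s i by (intro avoid) (auto simp: B_def)
    moreover have "Im (\<sigma> (real i)) = 0" using \<sigma>T i by simp
    ultimately show ?thesis using s by (auto simp: complex_eq_iff Im\<sigma>)
  qed
  moreover have "s \<notin> \<int>" if "real \<mu> < s" "s < real k" "c' s $ 2 = 0" for s using nonint that by (simp add: Im\<sigma>)
  ultimately show ?thesis using iso by (intro exI [of _ c'] conjI ballI impI) auto
qed

section \<open>The straight diagram\<close>

lemma polygon_curve_edge:
  assumes i: "i < length vs" and t: "real i \<le> t" "t \<le> real i + 1"
  shows "polygon_curve vs t = vs ! i + (t - real i) *\<^sub>R (vs ! (Suc i mod length vs) - vs ! i)"
proof (cases "t < real i + 1")
  case True
  then have f: "\<lfloor>t\<rfloor> = int i" using t by (simp add: floor_eq_iff)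
  have fr: "frac t = t - real i" by (simp add: frac_def f)
  have "nat (\<lfloor>t\<rfloor> mod int (length vs)) = i" using i by (simp add: f)
  then show ?thesis unfolding polygon_curve_def Let_def fr by (simp add: algebra_simps)
next
  case False
  \<comment> \<open>At the right end the floor has already jumped to the next edge, which starts at
    the same vertex.\<close>
  then have t1: "t = real (Suc i)" using t by simp
  have "nat (int (Suc i) mod int (length vs)) = Suc i mod length vs" by (simp only: zmod_int [symmetric] nat_int)
  then show ?thesis unfolding t1
    by (simp add: polygon_curve_def frac_def Let_def)
qed

lemma polygon_curve_lin: "i < length vs \<Longrightarrow> lin (real i) (real i + 1) (polygon_curve vs)"
  unfolding lin_def
  by (intro exI [of _ "vs ! i - real i *\<^sub>R (vs ! (Suc i mod length vs) - vs ! i)"]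
      exI [of _ "vs ! (Suc i mod length vs) - vs ! i"])
    (auto simp: polygon_curve_edge algebra_simps)

lemma polygon_curve_period: "polygon_curve vs (real (length vs)) = polygon_curve vs 0"
  by (simp add: polygon_curve_def frac_def)

lemma range_polygon_curve:
  assumes "vs \<noteq> []" shows "range (polygon_curve vs) = polygon_curve vs ` {0..<real (length vs)}"
proof -
  have "polygon_curve vs t \<in> polygon_curve vs ` {0..<real (length vs)}" for t
  proof -
    define j where "j = \<lfloor>t\<rfloor> mod int (length vs)"
    have len: "0 < int (length vs)" using assms by simp
    have j: "0 \<le> j" "j + 1 \<le> int (length vs)"
      using pos_mod_sign [OF len, of "\<lfloor>t\<rfloor>"] pos_mod_bound [OF len, of "\<lfloor>t\<rfloor>"] unfolding j_def by linarith+
    have "frac t < 1" "0 \<le> frac t" by (simp_all add: frac_lt_1)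
    moreover have "of_int j + 1 \<le> real (length vs)" using j(2) by linarith
    ultimately have "of_int j + frac t \<in> {0..<real (length vs)}" using j(1) by simp
    moreover have "\<lfloor>of_int j + frac t\<rfloor> = j" using \<open>frac t < 1\<close> by (simp add: floor_eq_iff)
    then have "polygon_curve vs t = polygon_curve vs (of_int j + frac t)"
      by (simp add: polygon_curve_def j_def frac_def)
    ultimately show ?thesis by blast
  qed
  then show ?thesis by auto
qed

lemma grown_polygon_curve:
  assumes "polygonal_knot vs"
  shows "grown (length vs) 0 (polygon_curve vs) {0}"
proof -
  have n: "0 < length vs" using assms by (auto simp: polygonal_knot_def)
  have "pl 0 (real (length vs)) (polygon_curve vs)" by (rule pl_unit_edges [OF polygon_curve_lin])
  then have "closed_pl (real (length vs)) (polygon_curve vs)"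
    using assms n by (simp add: closed_pl_def polygon_curve_period polygonal_knot_def)
  moreover have "cornered {0} 0 (polygon_curve vs)" unfolding cornered_def
  proof (intro conjI allI impI ballI)
    fix p q :: real assume "0 \<le> p \<and> p \<le> q \<and> q \<le> 0 \<and> {p<..<q} \<inter> {0} = {}"
    then have "p = q" by simp
    then show "lin p q (polygon_curve vs)" by (simp add: lin_refl)
  qed auto
  ultimately show ?thesis using n polygon_curve_lin unfolding grown_def by auto
qed

lemma polygon_curve_map:
  fixes c :: "real \<Rightarrow> 'a::real_normed_vector"
  assumes lin: "\<And>i. i < k \<Longrightarrow> lin (real i) (real i + 1) c" and c: "c (real k) = c 0"
    and k: "0 < k" and t: "0 \<le> t" "t \<le> real k"
  shows "polygon_curve (map (\<lambda>i. c (real i)) [0..<k]) t = c t"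
proof -
  define vs where "vs = map (\<lambda>i. c (real i)) [0..<k]"
  have len: "length vs = k" by (simp add: vs_def)
  have main: "polygon_curve vs t = c t" if t: "0 \<le> t" "t < real k" for t
  proof -
    define i where "i = nat \<lfloor>t\<rfloor>"
    have "real i = of_int \<lfloor>t\<rfloor>" using t by (simp add: i_def)
    then have i: "real i \<le> t" "t < real i + 1" "i < k" using t by linarith+
    have "vs ! i = c (real i)" using i by (simp add: vs_def)
    moreover have "vs ! (Suc i mod k) = c (real i + 1)"
    proof (cases "Suc i = k")
      case True
      then have ik: "real i + 1 = real k" by auto
      show ?thesis unfolding ik c True using k by (simp add: vs_def)
    next
      case False
      then have "Suc i < k" using i by simp
      then show ?thesis by (simp add: vs_def add.commute)
    qed
    ultimately show ?thesis
      using polygon_curve_edge [of i vs t] lin_eq [OF lin [OF i(3)], of t] i by (simp add: len)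
  qed
  show ?thesis
  proof (cases "t < real k")
    case True
    then show ?thesis using main t by (simp add: vs_def)
  next
    case False
    then have "t = real (length vs)" using t len by simp
    then show ?thesis using polygon_curve_period [of vs] main [of 0] k c len by (simp add: vs_def)
  qed
qed

section \<open>Knot words\<close>

lemma straight_word_append:
  assumes "distinct ys" "set ys = {1..n}" shows "straight_word n ([1..<Suc n] @ ys)"
proof -
  have len: "length ys = n" using distinct_card [OF assms(1)] assms(2) by simp
  \<comment> \<open>The shift by one is due to list positions starting at 0; outside
    \<open>{1..n}\<close> the identity is required by \<open>permutes\<close>.\<close>
  define p where "p = (\<lambda>i. if i \<in> {1..n} then ys ! (i - 1) else i)"
  have map: "map p [1..<Suc n] = ys"
    by (rule nth_equalityI) (auto simp: len p_def nth_upt simp del: upt_Suc)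
  have "p ` {1..n} = {1..n}"
  proof -
    have "p ` {1..n} = set (map p [1..<Suc n])" unfolding set_map set_upt atLeastLessThanSuc_atLeastAtMost ..
    then show ?thesis unfolding map assms(2) .
  qed
  then have "bij_betw p {1..n} {1..n}" unfolding bij_betw_def by (simp add: eq_card_imp_inj_on)
  then have "p permutes {1..n}" by (rule bij_imp_permutes) (auto simp: p_def)
  then show ?thesis unfolding straight_word_def using map by auto
qed

lemma sorted_list_of_set_append:
  fixes A B :: "real set"
  assumes "finite A" "finite B" "\<And>a b. a \<in> A \<Longrightarrow> b \<in> B \<Longrightarrow> a < b"
  shows "sorted_list_of_set (A \<union> B) = sorted_list_of_set A @ sorted_list_of_set B"
proof -
  have "sorted (sorted_list_of_set A @ sorted_list_of_set B)" 
    using assms by (auto simp: sorted_append less_imp_le)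
  moreover have "distinct (sorted_list_of_set A @ sorted_list_of_set B)" using assms by force
  ultimately have "sorted_list_of_set (set (sorted_list_of_set A @ sorted_list_of_set B)) =
      sorted_list_of_set A @ sorted_list_of_set B"
    by (rule sorted_list_of_set.idem_if_sorted_distinct)
  then show ?thesis using assms by simp
qed

text \<open>For numbering the crossings along the strand, where each of them is met for the first
  time.\<close>

lemma ranks:
  fixes T :: "real set"
  assumes "finite T"
  shows "map (\<lambda>x. card {y \<in> T. y \<le> x}) (sorted_list_of_set T) = [1..<Suc (card T)]"
  using assms
proof (induction rule: finite_linorder_max_induct)
  case (insert b A)
  have b: "b \<notin> A" using insert by auto
  have "map (\<lambda>x. card {y \<in> insert b A. y \<le> x}) (sorted_list_of_set A) =
      map (\<lambda>x. card {y \<in> A. y \<le> x}) (sorted_list_of_set A)"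
  proof (rule map_cong [OF refl])
    fix x assume "x \<in> set (sorted_list_of_set A)"
    then have "x < b" using insert by simp
    then have "{y \<in> insert b A. y \<le> x} = {y \<in> A. y \<le> x}" by auto
    then show "card {y \<in> insert b A. y \<le> x} = card {y \<in> A. y \<le> x}" by simp
  qed
  moreover have "{y \<in> insert b A. y \<le> b} = insert b A" using insert by (auto simp: less_imp_le)
  moreover have "sorted_list_of_set (insert b A) = sorted_list_of_set A @ [b]"
    using sorted_list_of_set_append [of A "{b}"] insert by simp
  ultimately show ?case using insert b by simp
qed simp

text \<open>All coincidences pair a zero \<open>s\<close> of the second coordinate after the strand
  with the time \<open>\<tau> s\<close> at which the strand has the same first coordinate. So the
  strand meets every crossing once, and the rest meets each of them once again. Confinement provides
  \<open>\<tau> s\<close> for every zero \<open>s\<close>, which is also why the diagram misses the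
  extended strand.\<close>

lemma contained_straight_diagram:
  assumes st: "straightened k \<mu> c" and finZ: "finite {s \<in> {real \<mu><..<real k}. c s $ 2 = 0}"
    and gen: "\<And>s. s \<in> {real \<mu><..<real k} \<Longrightarrow> c s $ 2 = 0 \<Longrightarrow> s \<notin> \<int> \<and> (\<forall>i\<le>\<mu>. c (real i) $ 1 \<noteq> c s $ 1)"
  shows "\<exists>vs. knot_of vs = Some ` c ` {0..<real k} \<and> knot_diagram vs \<and> contained_straight_position vs"
proof -
  have cl: "closed_pl (real k) c" and \<mu>: "0 < \<mu>" "\<mu> + 1 < k"
    and lin: "\<And>i. i < k \<Longrightarrow> lin (real i) (real i + 1) c" and T: "\<And>t. 0 \<le> t \<Longrightarrow> t \<le> real \<mu> \<Longrightarrow> c t $ 2 = 0"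
    and mono: "strict_mono_on {0..real \<mu>} (\<lambda>t. c t $ 1)"
    and inj: "inj_on (\<lambda>t. shadow (c t)) {real \<mu>..real k}"
    and V: "\<And>i. \<mu> < i \<Longrightarrow> i < k \<Longrightarrow> c 0 $ 1 < c (real i) $ 1 \<and> c (real i) $ 1 < c (real \<mu>) $ 1"
    using st by (auto simp: straightened_def)
  have ck: "c (real k) = c 0" using cl by (simp add: closed_pl_def)
  define vs where "vs = map (\<lambda>i. c (real i)) [0..<k]"
  have len: "length vs = k" by (simp add: vs_def)
  have pc: "polygon_curve vs t = c t" if "0 \<le> t" "t \<le> real k" for t
    unfolding vs_def by (rule polygon_curve_map [OF lin ck _ that]) (use \<mu> in auto)
  define \<sigma> where "\<sigma> = (\<lambda>t. shadow (c t))"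
  define D where "D = diagram_curve vs"
  have D: "D t = \<sigma> t" if "0 \<le> t" "t \<le> real k" for t
    using pc [OF that] by (simp add: D_def diagram_curve_def \<sigma>_def)
  have \<sigma>n: "\<sigma> t $ 1 = c t $ 1" "\<sigma> t $ 2 = c t $ 2" for t by (simp_all add: \<sigma>_def shadow_def)
  have \<sigma>eq: "\<sigma> s = \<sigma> t \<longleftrightarrow> c s $ 1 = c t $ 1 \<and> c s $ 2 = c t $ 2" for s t by (simp add: \<sigma>_def shadow_eq_iff)
  have injE: "s = t" if "\<sigma> s = \<sigma> t" "s \<in> {real \<mu>..real k}" "t \<in> {real \<mu>..real k}" for s t
    using inj_onD [OF inj] that by (simp add: \<sigma>_def)
  have injT: "s = t" if "\<sigma> s = \<sigma> t" "s \<in> {0..real \<mu>}" "t \<in> {0..real \<mu>}" for s t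
    using inj_onD [OF strict_mono_on_imp_inj_on [OF mono], of s t] that by (simp add: \<sigma>eq)
  \<comment> \<open>Points of an edge are convex combinations of its ends. An extreme value occurs
    only at an end of the strand, and on the first and the last edge the other end supplies
    strictness.\<close>
  have E: "c 0 $ 1 < c s $ 1 \<and> c s $ 1 < c (real \<mu>) $ 1" if s: "real \<mu> < s" "s < real k" for s
  proof -
    define i where "i = nat \<lfloor>s\<rfloor>"
    have "real i = of_int \<lfloor>s\<rfloor>" using s by (simp add: i_def)
    then have i: "real i \<le> s" "s < real i + 1" "\<mu> \<le> i" "i < k" using s by linarith+
    define l where "l = c 0 $ 1"
    define h where "h = c (real \<mu>) $ 1"
    define a where "a = c (real i) $ 1"
    define b where "b = c (real (Suc i)) $ 1"
    define x where "x = s - real i"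
    have lh: "l < h" using strict_mono_onD [OF mono, of 0 "real \<mu>"] \<mu> by (simp add: l_def h_def)
    have sx: "c s $ 1 = (1 - x) * a + x * b"
      using lin_eq [OF lin_linear [OF linear_nth lin [OF i(4)]] _ i(1), of 1] i
      by (simp add: a_def b_def x_def algebra_simps)
    have x: "0 \<le> x" "x < 1" using i by (auto simp: x_def)
    have a: "(i = \<mu> \<and> a = h) \<or> (l < a \<and> a < h)" using V [of i] i by (cases "i = \<mu>") (auto simp: a_def l_def h_def)
    have b: "(Suc i = k \<and> b = l) \<or> (l < b \<and> b < h)" using V [of "Suc i"] i ck
      by (cases "Suc i = k") (auto simp: b_def l_def h_def)
    have x0: "x \<noteq> 0" if "i = \<mu>" using that s by (simp add: x_def)
    have "l < (1 - x) * a + x * b"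
    proof -
      have "0 < (1 - x) * (a - l)" using x a lh by (intro mult_pos_pos) auto
      moreover have "0 \<le> x * (b - l)" using x b by (intro mult_nonneg_nonneg) auto
      ultimately show ?thesis by (simp add: algebra_simps)
    qed
    moreover have "(1 - x) * a + x * b < h"
    proof (cases "i = \<mu>")
      case True
      then have "Suc i \<noteq> k" using \<mu> by simp
      then have "b < h" using b by auto
      then have "0 < x * (h - b)" using x x0 True by (intro mult_pos_pos) auto
      moreover have "0 \<le> (1 - x) * (h - a)" using x a by (intro mult_nonneg_nonneg) auto
      ultimately show ?thesis by (simp add: algebra_simps)
    next
      case False
      then have "a < h" using a by auto
      then have "0 < (1 - x) * (h - a)" using x by (intro mult_pos_pos) auto
      moreover have "0 \<le> x * (h - b)" using x b lh by (intro mult_nonneg_nonneg) auto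
      ultimately show ?thesis by (simp add: algebra_simps)
    qed
    ultimately show ?thesis unfolding sx l_def [symmetric] h_def [symmetric] by simp
  qed
  define Z where "Z = {s \<in> {real \<mu><..<real k}. c s $ 2 = 0}"
  have onT: "\<exists>t\<in>{0..real \<mu>}. \<sigma> t = \<sigma> s" if s: "real \<mu> < s" "s < real k" "c s $ 2 = 0" for s
  proof -
    have "pl 0 (real k) c" using cl by (simp add: closed_pl_def)
    then have "pl 0 (real \<mu>) c" by (rule pl_subset) (use \<mu> in auto)
    then have ct: "continuous_on {0..real \<mu>} (\<lambda>t. c t $ 1)"
      by (intro pl_continuous_on pl_linear [OF linear_nth])
    have iv: "c 0 $ 1 \<le> c s $ 1" "c s $ 1 \<le> c (real \<mu>) $ 1" "0 \<le> real \<mu>" using E [OF s(1,2)] by auto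
    obtain t where "0 \<le> t" "t \<le> real \<mu>" "c t $ 1 = c s $ 1" using IVT' [OF iv ct] by blast
    then show ?thesis using T s by (intro bexI [of _ t]) (auto simp: \<sigma>eq)
  qed
  have "\<exists>\<tau>. \<forall>s\<in>Z. \<tau> s \<in> {0..real \<mu>} \<and> \<sigma> (\<tau> s) = \<sigma> s"
  proof (rule bchoice, rule ballI)
    fix s assume "s \<in> Z"
    then have "real \<mu> < s" "s < real k" "c s $ 2 = 0" by (simp_all add: Z_def)
    from onT [OF this] show "\<exists>t. t \<in> {0..real \<mu>} \<and> \<sigma> t = \<sigma> s" by blast
  qed
  then obtain \<tau> where \<tau>: "\<And>s. s \<in> Z \<Longrightarrow> \<tau> s \<in> {0..real \<mu>}" "\<And>s. s \<in> Z \<Longrightarrow> \<sigma> (\<tau> s) = \<sigma> s" by blast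
  have ZE: "real \<mu> < s" "s < real k" if "s \<in> Z" for s using that by (auto simp: Z_def)
  have \<tau>nonint: "\<tau> s \<notin> \<int>" if s: "s \<in> Z" for s
  proof
    assume "\<tau> s \<in> \<int>"
    then obtain j where j: "\<tau> s = of_int j" by (auto simp: Ints_def)
    then have i: "\<tau> s = real (nat j)" "nat j \<le> \<mu>" using \<tau>(1) [OF s] by auto
    then show False using gen [of s] s \<tau>(2) [OF s] by (auto simp: Z_def \<sigma>eq)
  qed
  have \<tau>T: "0 < \<tau> s" "\<tau> s < real \<mu>" if s: "s \<in> Z" for s
  proof -
    have "\<tau> s \<noteq> 0" "\<tau> s \<noteq> real \<mu>" using \<tau>nonint [OF s] Ints_0 Ints_of_nat [of \<mu>] by metis+
    then show "0 < \<tau> s" "\<tau> s < real \<mu>" using \<tau>(1) [OF s] by simp_all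
  qed
  have \<tau>k: "\<tau> s < real k" if "s \<in> Z" for s using \<tau>T [OF that] \<mu> by simp
  have pair: "t \<in> Z \<and> s = \<tau> t" if st: "s \<in> {0..<real k}" "t \<in> {0..<real k}" "s < t" "\<sigma> s = \<sigma> t" for s t
  proof -
    have s: "s < real \<mu>"
    proof (rule ccontr)
      assume "\<not> s < real \<mu>"
      then have "s = t" using st by (intro injE) auto
      then show False using st by simp
    qed
    have t: "real \<mu> < t"
    proof (rule ccontr)
      assume "\<not> real \<mu> < t"
      then have "s = t" using st by (intro injT) auto
      then show False using st by simp
    qed
    have "c t $ 2 = c s $ 2" using st by (simp add: \<sigma>eq)
    then have "t \<in> Z" using T [of s] s t st by (simp add: Z_def)
    moreover have "s = \<tau> t" using \<tau> [OF \<open>t \<in> Z\<close>] st s by (intro injT) auto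
    ultimately show ?thesis ..
  qed
  have inj\<sigma>Z: "inj_on \<sigma> Z" using injE ZE by (intro inj_onI) (auto simp: less_imp_le)
  have inj\<tau>: "inj_on \<tau> Z"
  proof (rule inj_onI)
    fix s t assume st: "s \<in> Z" "t \<in> Z" "\<tau> s = \<tau> t"
    then have "\<sigma> s = \<sigma> t" using \<tau>(2) by metis
    then show "s = t" using inj_onD [OF inj\<sigma>Z] st by blast
  qed
  define CT where "CT = crossing_times D (real k)"
  have CT: "CT = \<tau> ` Z \<union> Z"
  proof
    show "CT \<subseteq> \<tau> ` Z \<union> Z"
    proof
      fix t assume "t \<in> CT"
      then obtain u where u: "t \<in> {0..<real k}" "u \<in> {0..<real k}" "u \<noteq> t" "\<sigma> u = \<sigma> t"
        using D by (auto simp: CT_def crossing_times_def)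
      then show "t \<in> \<tau> ` Z \<union> Z" using pair [of t u] pair [of u t] by (cases t u rule: linorder_cases) auto
    qed
    have "s \<in> CT \<and> \<tau> s \<in> CT" if s: "s \<in> Z" for s
    proof -
      have r: "s \<in> {0..<real k}" "\<tau> s \<in> {0..<real k}" using ZE [OF s] \<tau>T [OF s] by auto
      have ne: "\<tau> s \<noteq> s" using ZE [OF s] \<tau>T [OF s] by auto
      have "D (\<tau> s) = D s" using r \<tau>(2) [OF s] by (simp add: D)
      then show ?thesis using r ne unfolding CT_def crossing_times_def by (metis (mono_tags, lifting) mem_Collect_eq)
    qed
    then show "\<tau> ` Z \<union> Z \<subseteq> CT" by auto
  qed
  have CTk: "t \<in> {0..<real k}" if "t \<in> CT" for t using that by (simp add: CT_def crossing_times_def)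
  have finZ': "finite Z" using finZ by (simp add: Z_def)
  then have finCT: "finite CT" by (simp add: CT)
  have fibre: "{u \<in> {0..<real k}. D u = D t} = {\<tau> s, s}" if s: "s \<in> Z" "t = s \<or> t = \<tau> s" for s t
  proof -
    have r: "s \<in> {0..<real k}" "\<tau> s \<in> {0..<real k}" using ZE [OF s(1)] \<tau>T [OF s(1)] by auto
    have Dt: "D t = \<sigma> s" using s r \<tau>(2) [OF s(1)] by (auto simp: D)
    show ?thesis
    proof
      show "{u \<in> {0..<real k}. D u = D t} \<subseteq> {\<tau> s, s}"
      proof
        fix u assume "u \<in> {u \<in> {0..<real k}. D u = D t}"
        then have u: "u \<in> {0..<real k}" "\<sigma> u = \<sigma> s" using Dt D by auto
        consider "u = s" | "u < s" | "s < u" by linarith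
        then show "u \<in> {\<tau> s, s}"
        proof cases
          case 2
          then show ?thesis using pair [of u s] u r by auto
        next
          case 3
          then have "s = \<tau> u" "u \<in> Z" using pair [of s u] u r by auto
          then show ?thesis using \<tau>T(2) [of u] ZE(1) [OF s(1)] by auto
        qed simp
      qed
      show "{\<tau> s, s} \<subseteq> {u \<in> {0..<real k}. D u = D t}" using r Dt \<tau>(2) [OF s(1)] by (auto simp: D)
    qed
  qed
  have \<tau>ne: "\<tau> s < s" if "s \<in> Z" for s using ZE [OF that] \<tau>T [OF that] by simp
  have pk: "polygonal_knot vs"
    unfolding polygonal_knot_def len
  proof
    show "3 \<le> k" using \<mu> by simp
    have "inj_on c {0..<real k}" using cl by (simp add: closed_pl_def)
    then show "inj_on (polygon_curve vs) {0..<real k}"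
      by (rule inj_on_cong [THEN iffD1, rotated]) (simp add: pc)
  qed
  have kd: "knot_diagram vs"
    unfolding knot_diagram_def Let_def len D_def [symmetric] CT_def [symmetric]
  proof (intro conjI ballI)
    fix t assume "t \<in> CT"
    then obtain s where s: "s \<in> Z" "t = s \<or> t = \<tau> s" by (auto simp: CT)
    show "t \<notin> \<int>" using s \<tau>nonint [of s] gen [of s] by (auto simp: Z_def)
    show "card {u \<in> {0..<real k}. D u = D t} = 2" unfolding fibre [OF s] using \<tau>ne [OF s(1)] by simp
  qed (use pk finCT in auto)
  have crossings: "crossings D (real k) = \<sigma> ` Z" "crossings D (real k) = \<sigma> ` \<tau> ` Z"
  proof -
    have "D ` Z = \<sigma> ` Z"
    proof (rule image_cong [OF refl])
      show "D s = \<sigma> s" if "s \<in> Z" for s using ZE [OF that] by (intro D) auto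
    qed
    moreover have "D ` \<tau> ` Z = \<sigma> ` Z"
      unfolding image_image
    proof (rule image_cong [OF refl])
      fix s assume s: "s \<in> Z"
      have "D (\<tau> s) = \<sigma> (\<tau> s)" using \<tau>T(1) [OF s] \<tau>k [OF s] by (intro D) auto
      then show "D (\<tau> s) = \<sigma> s" using \<tau>(2) [OF s] by simp
    qed
    ultimately show 1: "crossings D (real k) = \<sigma> ` Z"
      unfolding crossings_def CT_def [symmetric] CT by (simp add: image_Un)
    have "\<sigma> ` \<tau> ` Z = \<sigma> ` Z" unfolding image_image by (rule image_cong) (simp_all add: \<tau>(2))
    then show "crossings D (real k) = \<sigma> ` \<tau> ` Z" using 1 by simp
  qed
  define n where "n = card Z"
  have count: "crossing_count vs = n"
    unfolding crossing_count_def len D_def [symmetric] crossings(1) n_def by (rule card_image [OF inj\<sigma>Z])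
  define rank where "rank = (\<lambda>x. card {y \<in> \<tau> ` Z. y \<le> x})"
  \<comment> \<open>The crossing is first encountered on the strand, so its label is the rank of
    \<open>\<tau> s\<close> among the crossing times of the strand.\<close>
  have label: "crossing_label D (real k) t = rank (\<tau> s)" if s: "s \<in> Z" "t = s \<or> t = \<tau> s" for s t
  proof -
    have "{w \<in> CT. D w = D t} = {u \<in> {0..<real k}. D u = D t} \<inter> CT" using CTk by auto
    also have "\<dots> = {\<tau> s, s}" unfolding fibre [OF s] using s by (auto simp: CT)
    finally have min: "Min {w \<in> CT. D w = D t} = \<tau> s" using \<tau>ne [OF s(1)] by simp
    have le: "{u \<in> CT. u \<le> \<tau> s} = {y \<in> \<tau> ` Z. y \<le> \<tau> s}"
      using \<tau>T(2) [OF s(1)] ZE(1) by (force simp: CT)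
    have "inj_on D {y \<in> \<tau> ` Z. y \<le> \<tau> s}"
    proof (rule inj_onI)
      fix x y assume xy: "x \<in> {y \<in> \<tau> ` Z. y \<le> \<tau> s}" "y \<in> {y \<in> \<tau> ` Z. y \<le> \<tau> s}" "D x = D y"
      then have "x \<in> {0..real \<mu>}" "y \<in> {0..real \<mu>}" using \<tau>(1) by auto
      moreover have "\<sigma> x = \<sigma> y" using calculation xy(3) \<mu> by (simp add: D)
      ultimately show "x = y" by (intro injT)
    qed
    then show ?thesis
      unfolding crossing_label_def CT_def [symmetric] min le rank_def by (rule card_image)
  qed
  have cT: "card (\<tau> ` Z) = n" unfolding n_def by (rule card_image [OF inj\<tau>])
  have ranks: "map rank (sorted_list_of_set (\<tau> ` Z)) = [1..<Suc n]"
    unfolding rank_def using ranks [of "\<tau> ` Z"] finZ' unfolding cT by simp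
  have word: "straight_word n (knot_word D (real k))"
  proof -
    have slt: "a < b" if "a \<in> \<tau> ` Z" "b \<in> Z" for a b using that \<tau>T ZE by fastforce
    have "sorted_list_of_set CT = sorted_list_of_set (\<tau> ` Z) @ sorted_list_of_set Z"
      unfolding CT using finZ' slt by (intro sorted_list_of_set_append) auto
    moreover have "map (crossing_label D (real k)) (sorted_list_of_set (\<tau> ` Z)) = [1..<Suc n]"
      unfolding ranks [symmetric] by (rule map_cong [OF refl]) (use finZ' label in auto)
    moreover define ys where "ys = map (crossing_label D (real k)) (sorted_list_of_set Z)"
    ultimately have kw: "knot_word D (real k) = [1..<Suc n] @ ys"
      unfolding knot_word_def CT_def [symmetric] by simp
    \<comment> \<open>The second half of the word takes the same ranks as the first; having length
      \<open>n\<close>, it takes each of them once.\<close>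
    have "set ys = (\<lambda>s. rank (\<tau> s)) ` Z" unfolding ys_def using finZ' label by (auto simp: image_iff)
    also have "\<dots> = set (map rank (sorted_list_of_set (\<tau> ` Z)))" using finZ' by (simp add: image_image)
    also have "\<dots> = {1..n}" unfolding ranks set_upt atLeastLessThanSuc_atLeastAtMost ..
    finally have set: "set ys = {1..n}" .
    have "length ys = n" by (simp add: ys_def n_def)
    then have "distinct ys" using set by (intro card_distinct) simp
    then show ?thesis unfolding kw using set by (rule straight_word_append)
  qed
  have trav: "traversal vs 0 1 = D" by (simp add: traversal_def D_def fun_eq_iff)
  have "0 \<notin> CT" unfolding CT using \<tau>T(1) ZE(1) by fastforce
  then have straight: "straight_traversal vs 0 1"
    unfolding straight_traversal_def Let_def trav len count CT_def [symmetric] using word by simp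
  have DT: "D t = \<sigma> t" if "t \<in> {0..real \<mu>}" for t using that \<mu> by (intro D) auto
  have strand: "straight_strand vs 0 1 (real \<mu>)"
    unfolding straight_strand_def Let_def trav len
  proof (intro conjI ballI)
    show "D t $ 2 = D 0 $ 2" if "t \<in> {0..real \<mu>}" for t
      using DT [OF that] DT [of 0] T [of t] T [of 0] that by (simp add: \<sigma>n)
    show "strict_mono_on {0..real \<mu>} (\<lambda>t. D t $ 1)"
      using mono by (auto simp: strict_mono_on_def DT \<sigma>n)
    show "crossings D (real k) \<subseteq> D ` {0..real \<mu>}"
    proof
      fix x assume "x \<in> crossings D (real k)"
      then obtain s where s: "s \<in> Z" "x = \<sigma> (\<tau> s)" unfolding crossings(2) by blast
      then show "x \<in> D ` {0..real \<mu>}" using DT [OF \<tau>(1) [OF s(1)]] \<tau>(1) [OF s(1)] by (intro image_eqI [of _ _ "\<tau> s"]) auto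
    qed
    show "inj_on D {real \<mu>..real k}"
      using inj by (rule inj_on_cong [THEN iffD1, rotated]) (simp add: D \<sigma>_def)
  qed (use \<mu> straight in auto)
  have "range D \<inter> extended_straight_strand vs 0 1 (real \<mu>) = {}"
  proof -
    have ne: "vs \<noteq> []" using len \<mu> by auto
    have "range D = shadow ` range (polygon_curve vs)" by (auto simp: D_def diagram_curve_def)
    also have "\<dots> = \<sigma> ` {0..<real k}"
      unfolding range_polygon_curve [OF ne] len image_image by (rule image_cong) (simp_all add: pc \<sigma>_def)
    finally have rng: "range D = \<sigma> ` {0..<real k}" .
    have "D 0 $ 2 = 0" using DT [of 0] T [of 0] by (simp add: \<sigma>n)
    moreover have "\<sigma> t \<in> D ` {0..real \<mu>}" if t: "t \<in> {0..<real k}" "\<sigma> t $ 2 = 0" for t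
    proof -
      have "\<exists>u\<in>{0..real \<mu>}. \<sigma> u = \<sigma> t"
      proof (cases "t \<le> real \<mu>")
        case True
        then show ?thesis using t by auto
      next
        case False
        then show ?thesis using onT [of t] t by (simp add: \<sigma>n)
      qed
      then obtain u where u: "u \<in> {0..real \<mu>}" "\<sigma> u = \<sigma> t" by blast
      then show ?thesis using DT [OF u(1)] by (intro image_eqI [of _ _ u]) auto
    qed
    ultimately show ?thesis unfolding extended_straight_strand_def trav rng by auto
  qed
  then have "contained_straight_position vs"
    unfolding contained_straight_position_def D_def using kd strand by blast
  moreover have "knot_of vs = Some ` c ` {0..<real k}"
    unfolding knot_of_def len by (intro image_cong [OF _ refl]) (simp add: pc)
  ultimately show ?thesis using kd by blast
qed

theorem theorem2p8:
  fixes K :: "(real^3) option set"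
  assumes "knot K"
  shows "(\<exists>vs. diagram_of K vs \<and> straight_position vs \<and> contained_straight_position vs) \<and>
    cstr K \<in> contained_crossing_counts K \<and>
    (\<forall>n\<in>contained_crossing_counts K. cstr K \<le> n)"
proof -
  obtain us where us: "polygonal_knot us" "ambient_isotopic K (knot_of us)" using assms by (auto simp: knot_def)
  define n where "n = length us"
  have n: "3 \<le> n" using us(1) by (simp add: polygonal_knot_def n_def)
  have g0: "grown n 0 (polygon_curve us) {0}" unfolding n_def by (rule grown_polygon_curve [OF us(1)])
  obtain c B where c: "grown n (n - 1) c B"
    "ambient_isotopic (Some ` polygon_curve us ` {0..<real n}) (Some ` c ` {0..<real n})" "c (real (n - 1)) $ 2 \<noteq> c (real n) $ 2"
    by (rule fully_grown [OF g0 n]) (rule that)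
  have n2: "2 \<le> n" using n by simp
  obtain N M d where d: "flat N M d" "ambient_isotopic (Some ` c ` {0..<real n}) (Some ` d ` {0..<N})"
    by (rule flatten_grown [OF c(1) n2 c(3)]) (rule that)
  obtain k \<mu> e where e: "straightened k \<mu> e" "e ` {0..<real k} = d ` {0..<N}"
    using straightened_of_flat [OF d(1)] by blast
  obtain f where f: "straightened k \<mu> f" "ambient_isotopic (Some ` e ` {0..<real k}) (Some ` f ` {0..<real k})"
    "finite {s \<in> {real \<mu><..<real k}. f s $ 2 = 0}"
    "\<And>s. s \<in> {real \<mu><..<real k} \<Longrightarrow> f s $ 2 = 0 \<Longrightarrow> s \<notin> \<int> \<and> (\<forall>i\<le>\<mu>. f (real i) $ 1 \<noteq> f s $ 1)"
    using generic_straightened [OF e(1)] by blast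
  obtain vs where vs: "knot_of vs = Some ` f ` {0..<real k}" "knot_diagram vs" "contained_straight_position vs"
    using contained_straight_diagram [OF f(1,3,4)] by blast
  have "ambient_isotopic K (knot_of vs)"
    by (rule ambient_isotopic_trans [OF us(2) [unfolded knot_of_def n_def [symmetric]]
          ambient_isotopic_trans [OF c(2) ambient_isotopic_trans [OF d(2) f(2) [unfolded e(2), folded vs(1)]]]])
  then have D: "diagram_of K vs" using vs(2) by (simp add: diagram_of_def)
  have "straight_position vs"
    using vs(3) by (auto simp: contained_straight_position_def straight_position_def)
  moreover have mem: "crossing_count vs \<in> contained_crossing_counts K"
    using D vs(3) by (auto simp: contained_crossing_counts_def)
  moreover have "cstr K \<in> contained_crossing_counts K" unfolding cstr_def by (rule LeastI [of "\<lambda>n. n \<in> contained_crossing_counts K", OF mem])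
  moreover have "\<forall>n\<in>contained_crossing_counts K. cstr K \<le> n" unfolding cstr_def by (auto intro: Least_le)
  ultimately show ?thesis using D vs(3) by blast
qed

end
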